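(* Let $\alpha>0$, $\kappa\in(0,2]$, $c_Y>0$, let $Y\in\mathbf{S}(\alpha,\kappa,c_Y)$ and let $R>0$. (i) If $\kappa=1$, then \[ 1+\frac1R\left(\inf_{x\in[0,1)}\frac{V_Y(1,x^{1/\alpha})}{|1-x|}\right)\;\le\;\mathcal{H}_Y^R\;\le\;1+\frac1R\left(\sup_{x\in[0,1)}\frac{V_Y(1,x^{1/\alpha})}{|1-x|}\right). \] (ii) If $\kappa=2$, then \[ \frac12\left(1+\sqrt{1+\frac1R}\right)\;\le\;\mathcal{H}_Y^R\;\le\;\frac12\left(1+\sqrt{1+\frac1R\left(\sup_{x\in[0,1)}\frac{V_Y(1,x^{2/\alpha})}{|1-x|^2}\right)}\right). \]
   Context: Class $\mathbf{S}(\alpha,\kappa,c_Y)$ (with $\alpha>0$, $\kappa\in(0,2]$, $c_Y>0$): a centered Gaussian process $Y=\{Y(t):t\ge 0\}$ with a.s. continuous sample paths belongs to $\mathbf{S}(\alpha,\kappa,c_Y)$ if (S1) $Y$ is self-similar with index $\alpha/2$, i.e. for every $a>0$ the processes $\{Y(at):t\ge0\}$ and $\{a^{\alpha/2}Y(t):t\ge0\}$ have the same law, and $\mathbf{Var}(Y(1))=1$ (hence $\mathbf{Var}(Y(t))=t^\alpha$); (S2) $\mathbf{Var}(Y(1)-Y(1-h))=c_Y|h|^\kappa+o(|h|^\kappa)$ as $h\to0$. Notation: $V_Y(s,t)=\mathbf{Var}(Y(s)-Y(t))$. For $R>0$, $\mathcal{H}_Y^R:=\lim_{T\to\infty}\mathbf{E}\exp\left(\sup_{t\in[0,T]}\left(\sqrt2\,Y(t)-(1+R)t^\alpha\right)\right)$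 (the expectation is nondecreasing in $T$, so the limit exists). *)

theory Defs
  imports "HOL-Probability.Probability" "HOL-Library.Landau_Symbols"
begin

text \<open>The degenerate case \<open>\<sigma> = 0\<close> is a point mass; it must be admitted, since for a self-similar
  process \<open>Y 0 = 0\<close> almost surely.\<close>

definition gaussian_rv :: "'a measure \<Rightarrow> ('a \<Rightarrow> real) \<Rightarrow> bool" where
  "gaussian_rv M X \<longleftrightarrow> X \<in> borel_measurable M \<and>
     (\<exists>\<mu> \<sigma>. (\<sigma> = 0 \<and> (AE \<omega> in M. X \<omega> = \<mu>)) \<or>
            (\<sigma> > 0 \<and> distributed M lborel X (normal_density \<mu> \<sigma>)))"

text \<open>Joint normality of the finite-dimensional distributions is expressed through linear
  combinations. Processes are indexed by \<open>real\<close>, but only the times \<open>t \<ge> 0\<close> are ever constrained.\<close>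

definition gaussian_process :: "'a measure \<Rightarrow> (real \<Rightarrow> 'a \<Rightarrow> real) \<Rightarrow> bool" where
  "gaussian_process M Y \<longleftrightarrow>
     (\<forall>I c. finite I \<and> I \<subseteq> {0..} \<longrightarrow> gaussian_rv M (\<lambda>\<omega>. \<Sum>t\<in>I. c t * Y t \<omega>))"

definition centered :: "'a measure \<Rightarrow> (real \<Rightarrow> 'a \<Rightarrow> real) \<Rightarrow> bool" where
  "centered M Y \<longleftrightarrow> (\<forall>t\<ge>0. prob_space.expectation M (Y t) = 0)"

definition ae_continuous_paths :: "'a measure \<Rightarrow> (real \<Rightarrow> 'a \<Rightarrow> real) \<Rightarrow> bool" where
  "ae_continuous_paths M Y \<longleftrightarrow> (AE \<omega> in M. continuous_on {0..} (\<lambda>t. Y t \<omega>))"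

definition process_law :: "'a measure \<Rightarrow> (real \<Rightarrow> 'a \<Rightarrow> real) \<Rightarrow> (real \<Rightarrow> real) measure" where
  "process_law M Y =
     distr M (\<Pi>\<^sub>M t\<in>{0..}. (borel :: real measure)) (\<lambda>\<omega>. \<lambda>t\<in>{0..}. Y t \<omega>)"

definition self_similar :: "'a measure \<Rightarrow> real \<Rightarrow> (real \<Rightarrow> 'a \<Rightarrow> real) \<Rightarrow> bool" where
  "self_similar M H Y \<longleftrightarrow>
     (\<forall>a>0. process_law M (\<lambda>t. Y (a * t)) = process_law M (\<lambda>t \<omega>. a powr H * Y t \<omega>))"

definition incr_var :: "'a measure \<Rightarrow> (real \<Rightarrow> 'a \<Rightarrow> real) \<Rightarrow> real \<Rightarrow> real \<Rightarrow> real" where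
  "incr_var M Y s t = prob_space.variance M (\<lambda>\<omega>. Y s \<omega> - Y t \<omega>)"

definition class_S ::
  "'a measure \<Rightarrow> real \<Rightarrow> real \<Rightarrow> real \<Rightarrow> (real \<Rightarrow> 'a \<Rightarrow> real) \<Rightarrow> bool" where
  "class_S M \<alpha> \<kappa> c Y \<longleftrightarrow>
     gaussian_process M Y \<and> centered M Y \<and> ae_continuous_paths M Y \<and>
     self_similar M (\<alpha> / 2) Y \<and> prob_space.variance M (Y 1) = 1 \<and>
     (\<lambda>h. incr_var M Y 1 (1 - h) - c * \<bar>h\<bar> powr \<kappa>) \<in> o[at 0](\<lambda>h. \<bar>h\<bar> powr \<kappa>)"

text \<open>The expectation is taken as a nonnegative integral: the supremum is only almost everywhere
  equal to a measurable function (null sets need not be complete), which would make a Bochner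
  integral possibly degenerate, whereas the nonnegative integral is invariant under
  almost-everywhere changes without any measurability requirement. The real supremum is that of a
  continuous function on a compact interval for almost every \<open>\<omega>\<close>.\<close>

definition pickands_const :: "'a measure \<Rightarrow> real \<Rightarrow> (real \<Rightarrow> 'a \<Rightarrow> real) \<Rightarrow> real \<Rightarrow> ennreal" where
  "pickands_const M \<alpha> Y R =
     Lim at_top (\<lambda>T::real.
       \<integral>\<^sup>+ \<omega>. ennreal (exp (SUP t\<in>{0..T}. sqrt 2 * Y t \<omega> - (1 + R) * t powr \<alpha>)) \<partial>M)"

end

theory Submission
  imports Defs "HOL-Real_Asymp.Real_Asymp"
begin

text \<open>After the time change \<open>s = t powr (\<alpha> / \<kappa>)\<close> the exponent becomes
  \<open>X s - Var (X s) / 2 - R * s powr \<kappa>\<close> with \<open>Var (X s) = 2 * s powr \<kappa>\<close>, and the expected maximum of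
  such exponentials over a finite set of times is monotone in the variogram of \<open>X\<close>: replace the
  maximum by \<open>(\<Sum>i. exp (p * y i)) powr (1 / p)\<close>, interpolate between the two Gaussian vectors along
  \<open>sin \<theta> * X + cos \<theta> * W\<close>, and integrate by parts. Since the smoothed maximum is homogeneous in the
  \<open>exp (y i)\<close>, the diagonal terms of its Hessian combine with the drift so that the derivative in
  \<open>\<theta>\<close> is a positive combination of the variogram differences.

  By self-similarity the bounds on \<open>V(1, x) / (1 - x) powr \<kappa>\<close> bound the variogram everywhere by that of
  \<open>sqrt C\<close> times Brownian motion (\<open>\<kappa> = 1\<close>) or of \<open>sqrt C * N * s\<close> with \<open>N\<close> standard normal
  (\<open>\<kappa> = 2\<close>). The latter is explicit. The former only enters on uniform grids, as a Gaussian random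
  walk with negative drift, whose maximum satisfies Lindley's recursion.\<close>

section \<open>Uniqueness of joint laws\<close>

text \<open>The compared vectors have different variances, so Slepian's inequality does not apply.
  What replaces equal variances is the compensator: after subtracting half the variance,
  \<open>exp (X s)\<close> has mean 1 whatever the covariance, and only the variogram is left to
  compare. Covariances here are singular (time 0 has variance 0, the linear process has rank one),
  so no joint densities are available. Gaussian vectors are therefore handled through characteristic
  functions, and uniqueness of joint laws is what turns zero covariance into independence. Origin of
  the constants: for Brownian motion B the supremum of sqrt(2C) B(s) - (C + R) s is exponential with
  rate 1 + R/C, and its exponential has mean 1 + C/R. For a standard normal N the supremum over s
  \<ge> 0 of sqrt(2C) N s - (C + R) s^2 is C N^2 / (2 (C + R)) if N > 0 and 0 otherwise, and the
  mean of its exponential is half of 1 + sqrt(1 + C/R). The lower bound for \<kappa> = 2 is the case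
  C = 1, which Cauchy-Schwarz provides. For the walk, the upper bound holds at every mesh, while the
  lower bound is only approached as the mesh tends to 0 and needs an error estimate.\<close>

lemma char_distr_eq_integral:
  assumes "prob_space M" "X \<in> borel_measurable M"
  shows "char (distr M borel X) t = (CLINT \<omega>|M. iexp (t * X \<omega>))"
  using assms unfolding char_def by (subst integral_distr) auto

lemma distr_eq_of_iexp:
  assumes "prob_space M" "prob_space N"
    and X: "X \<in> borel_measurable M" and Y: "Y \<in> borel_measurable N"
    and eq: "\<And>t. (CLINT \<omega>|M. iexp (t * X \<omega>)) = (CLINT \<omega>|N. iexp (t * Y \<omega>))"
  shows "distr M borel X = distr N borel (Y :: _ \<Rightarrow> real)"
proof (rule Levy_uniqueness)
  show "real_distribution (distr M borel X)" "real_distribution (distr N borel Y)"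
    using assms by (auto intro!: prob_space.real_distribution_distr)
  show "char (distr M borel X) = char (distr N borel Y)"
    using assms by (auto simp: fun_eq_iff char_distr_eq_integral)
qed

lemma integrable_bounded_real:
  fixes f :: "'a \<Rightarrow> real"
  assumes "prob_space M" "f \<in> borel_measurable M" "\<And>x. \<bar>f x\<bar> \<le> B"
  shows "integrable M f"
proof -
  interpret prob_space M by fact
  show ?thesis by (rule integrable_const_bound[where B=B]) (use assms in auto)
qed

lemma integrable_bounded_complex:
  fixes f :: "'a \<Rightarrow> complex"
  assumes "prob_space M" "f \<in> borel_measurable M" "\<And>x. norm (f x) \<le> B"
  shows "integrable M f"
proof -
  interpret prob_space M by fact
  show ?thesis by (rule integrable_const_bound[where B=B]) (use assms in auto)
qed

lemma integral_indicator_eq_of_distr: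
  assumes "X \<in> borel_measurable M" "Y \<in> borel_measurable N" "A \<in> sets borel"
    and "distr M borel X = distr N borel (Y :: _ \<Rightarrow> real)"
  shows "(LINT \<omega>|M. indicator A (X \<omega>) :: real) = (LINT \<omega>|N. indicator A (Y \<omega>))"
proof -
  have "(LINT \<omega>|M. indicator A (X \<omega>) :: real) = (LINT x|distr M borel X. indicator A x)"
    by (rule integral_distr[symmetric]) (use assms in auto)
  also have "\<dots> = (LINT \<omega>|N. indicator A (Y \<omega>))"
    unfolding assms(4) by (rule integral_distr) (use assms in auto)
  finally show ?thesis .
qed

text \<open>The constant \<open>2\<close> keeps the weight \<open>2 + k\<close> between 1 and 3, so
  its mean \<open>m\<close> is at least 1 and may be divided by; with \<open>1\<close> in its place
  the mean could vanish. The numerators of both test integrals are affine in \<open>k\<close>, so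
  the signed part can be recovered once the unweighted integrals are known.\<close>

lemma tilted_law:
  fixes X k :: "'a \<Rightarrow> real"
  assumes pM: "prob_space M" and [measurable]: "X \<in> borel_measurable M" "k \<in> borel_measurable M" "A \<in> sets borel"
    and kb: "\<And>x. \<bar>k x\<bar> \<le> 1"
  defines "m \<equiv> 2 + (LINT \<omega>|M. k \<omega>)"
  defines "D \<equiv> density M (\<lambda>\<omega>. ennreal ((2 + k \<omega>) / m))"
  shows "m \<ge> 1" and "prob_space D"
    and "(CLINT \<omega>|D. iexp (t * X \<omega>)) = (2 * (CLINT \<omega>|M. iexp (t * X \<omega>)) + (CLINT \<omega>|M. complex_of_real (k \<omega>) * iexp (t * X \<omega>))) / m"
    and "(LINT \<omega>|D. indicator A (X \<omega>)) = (2 * (LINT \<omega>|M. indicator A (X \<omega>)) + (LINT \<omega>|M. k \<omega> * indicator A (X \<omega>))) / m"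
proof -
  interpret prob_space M by fact
  have ik: "integrable M k" by (rule integrable_bounded_real[OF pM _ kb]) auto
  have k0: "0 \<le> 2 + k x" for x using kb[of x] by linarith
  have "(LINT \<omega>|M. -1) \<le> (LINT \<omega>|M. k \<omega>)"
    by (rule integral_mono) (use ik kb in \<open>auto simp: abs_le_iff minus_le_iff\<close>)
  then show m1: "m \<ge> 1" by (simp add: m_def prob_space)
  show "prob_space D"
  proof
    have "emeasure D (space D) = (\<integral>\<^sup>+ \<omega>. ennreal ((2 + k \<omega>) / m) \<partial>M)"
      by (simp add: D_def emeasure_density cong: nn_integral_cong)
    also have "\<dots> = ennreal (LINT \<omega>|M. (2 + k \<omega>) / m)"
      by (rule nn_integral_eq_integral) (use ik k0 m1 in auto)
    also have "\<dots> = 1" using m1 ik by (simp add: m_def prob_space)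
    finally show "emeasure D (space D) = 1" .
  qed
  have i1: "integrable M (\<lambda>\<omega>. iexp (t * X \<omega>))" "integrable M (\<lambda>\<omega>. complex_of_real (k \<omega>) * iexp (t * X \<omega>))"
    by (rule integrable_bounded_complex[OF pM, where B=1]; use kb in \<open>auto simp: norm_mult\<close>)+
  have "(CLINT \<omega>|D. iexp (t * X \<omega>)) = (CLINT \<omega>|M. ((2 + k \<omega>) / m) *\<^sub>R iexp (t * X \<omega>))"
    unfolding D_def by (rule integral_density) (use k0 m1 in auto)
  also have "\<dots> = (CLINT \<omega>|M. (2 * iexp (t * X \<omega>) + complex_of_real (k \<omega>) * iexp (t * X \<omega>)) / m)"
    by (intro Bochner_Integration.integral_cong) (auto simp: scaleR_conv_of_real field_simps)
  finally show "(CLINT \<omega>|D. iexp (t * X \<omega>)) = (2 * (CLINT \<omega>|M. iexp (t * X \<omega>)) + (CLINT \<omega>|M. complex_of_real (k \<omega>) * iexp (t * X \<omega>))) / m"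
    using i1 by (simp only: integral_divide_zero Bochner_Integration.integral_add integrable_mult_right integral_mult_right_zero)
  have i2: "integrable M (\<lambda>\<omega>. indicator A (X \<omega>) :: real)" "integrable M (\<lambda>\<omega>. k \<omega> * indicator A (X \<omega>))"
    by (rule integrable_bounded_real[OF pM, where B=1]; use kb in \<open>auto simp: indicator_def\<close>)+
  have "(LINT \<omega>|D. indicator A (X \<omega>) :: real) = (LINT \<omega>|M. ((2 + k \<omega>) / m) *\<^sub>R indicator A (X \<omega>))"
    unfolding D_def by (rule integral_density) (use k0 m1 in auto)
  also have "\<dots> = (LINT \<omega>|M. (2 * indicator A (X \<omega>) + k \<omega> * indicator A (X \<omega>)) / m)"
    by (intro Bochner_Integration.integral_cong) (auto simp: field_simps)
  finally show "(LINT \<omega>|D. indicator A (X \<omega>)) = (2 * (LINT \<omega>|M. indicator A (X \<omega>)) + (LINT \<omega>|M. k \<omega> * indicator A (X \<omega>))) / m"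
    using i2 by (simp only: integral_divide_zero Bochner_Integration.integral_add integrable_mult_right integral_mult_right_zero)
qed

text \<open>Levy's uniqueness theorem is about probability measures, so the signed weights \<open>k\<close> and \<open>l\<close> are
  made positive by adding \<open>2\<close>, whose contribution is known from the unweighted laws.\<close>

lemma weighted_distr_eq:
  fixes X :: "'a \<Rightarrow> real" and Y :: "'b \<Rightarrow> real"
  assumes M: "prob_space M" "X \<in> borel_measurable M" "k \<in> borel_measurable M" "\<And>x. \<bar>k x\<bar> \<le> 1"
    and N: "prob_space N" "Y \<in> borel_measurable N" "l \<in> borel_measurable N" "\<And>x. \<bar>l x\<bar> \<le> 1"
    and eq1: "\<And>t. (CLINT \<omega>|M. iexp (t * X \<omega>)) = (CLINT \<omega>|N. iexp (t * Y \<omega>))"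
    and eqk: "\<And>t. (CLINT \<omega>|M. complex_of_real (k \<omega>) * iexp (t * X \<omega>))
                 = (CLINT \<omega>|N. complex_of_real (l \<omega>) * iexp (t * Y \<omega>))"
    and A: "A \<in> sets borel"
  shows "(LINT \<omega>|M. k \<omega> * indicator A (X \<omega>)) = (LINT \<omega>|N. l \<omega> * indicator A (Y \<omega>))"
proof -
  note tM = tilted_law[OF M(1-3) A M(4)] and tN = tilted_law[OF N(1-3) A N(4)]
  \<comment> \<open>The hypothesis at \<open>t = 0\<close> equates the total weights, so both tilted
    measures share the normalising constant \<open>m\<close>.\<close>
  have kl: "(LINT \<omega>|M. k \<omega>) = (LINT \<omega>|N. l \<omega>)"
    using eqk[of 0] by (simp only: mult_zero_left mult_zero_right of_real_0 exp_zero mult_1_right integral_complex_of_real of_real_eq_iff)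
  define m where "m = 2 + (LINT \<omega>|M. k \<omega>)"
  have m: "2 + (LINT \<omega>|N. l \<omega>) = m" by (simp add: m_def kl)
  note tM = tM[folded m_def] and tN = tN[unfolded m]
  have "distr (density M (\<lambda>\<omega>. ennreal ((2 + k \<omega>) / m))) borel X = distr (density N (\<lambda>\<omega>. ennreal ((2 + l \<omega>) / m))) borel Y"
  proof (rule distr_eq_of_iexp[OF tM(2) tN(2)])
    show "X \<in> borel_measurable (density M (\<lambda>\<omega>. ennreal ((2 + k \<omega>) / m)))" "Y \<in> borel_measurable (density N (\<lambda>\<omega>. ennreal ((2 + l \<omega>) / m)))"
      using M(2) N(2) by auto
  qed (simp only: tM(3) tN(3) eq1 eqk)
  then have "(LINT \<omega>|density M (\<lambda>\<omega>. ennreal ((2 + k \<omega>) / m)). indicator A (X \<omega>) :: real) = (LINT \<omega>|density N (\<lambda>\<omega>. ennreal ((2 + l \<omega>) / m)). indicator A (Y \<omega>))"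
    using M(2) N(2) A by (intro integral_indicator_eq_of_distr) auto
  moreover have "(LINT \<omega>|M. indicator A (X \<omega>) :: real) = (LINT \<omega>|N. indicator A (Y \<omega>))"
    using M(2) N(2) A by (intro integral_indicator_eq_of_distr distr_eq_of_iexp[OF M(1) N(1)] eq1) auto
  ultimately show ?thesis unfolding tM(4) tN(4) using tM(1) by simp
qed

text \<open>Euler's formulas, in the shape used to convert one coordinate \<open>X\<close> from a
  character to an indicator. \<open>P\<close> stands for the indicators already obtained and
  \<open>S\<close> for the phase of the coordinates still to come. The real weights
  \<open>P * cos S\<close> and \<open>P * sin S\<close> are bounded by 1, as
  \<open>weighted_distr_eq\<close> demands, and the last identity reassembles the two
  results.\<close>

lemma weighted_cos_sin_iexp:
  fixes P S X :: "'a \<Rightarrow> real"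
  assumes pM: "prob_space M" and [measurable]: "P \<in> borel_measurable M" "S \<in> borel_measurable M" "X \<in> borel_measurable M" "A \<in> sets borel"
    and P: "\<And>\<omega>. 0 \<le> P \<omega>" "\<And>\<omega>. P \<omega> \<le> 1"
  shows "(CLINT \<omega>|M. complex_of_real (P \<omega> * cos (S \<omega>)) * iexp (t * X \<omega>))
       = ((CLINT \<omega>|M. P \<omega> * iexp (1 * S \<omega> + t * X \<omega>)) + (CLINT \<omega>|M. P \<omega> * iexp (-1 * S \<omega> + t * X \<omega>))) / 2"
    and "(CLINT \<omega>|M. complex_of_real (P \<omega> * sin (S \<omega>)) * iexp (t * X \<omega>))
       = ((CLINT \<omega>|M. P \<omega> * iexp (1 * S \<omega> + t * X \<omega>)) - (CLINT \<omega>|M. P \<omega> * iexp (-1 * S \<omega> + t * X \<omega>))) / (2 * \<i>)"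
    and "(CLINT \<omega>|M. complex_of_real (P \<omega> * indicator A (X \<omega>)) * iexp (S \<omega>))
       = complex_of_real (LINT \<omega>|M. P \<omega> * cos (S \<omega>) * indicator A (X \<omega>)) + \<i> * complex_of_real (LINT \<omega>|M. P \<omega> * sin (S \<omega>) * indicator A (X \<omega>))"
proof -
  have int: "integrable M (\<lambda>\<omega>. P \<omega> * iexp (s * S \<omega> + t * X \<omega>))" for s t
    by (rule integrable_bounded_complex[OF pM, where B=1]) (use P in \<open>auto simp: norm_mult abs_le_iff simp del: of_real_add of_real_mult intro: order_trans[of _ 0]\<close>)
  have cosexp: "complex_of_real (p * cos x) * iexp y = (of_real p * iexp (1 * x + y) + of_real p * iexp (-1 * x + y)) / 2" for p x y :: real
    by (simp add: exp_add exp_diff exp_minus cos_of_real[symmetric] cos_exp_eq field_simps del: cos_of_real)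
  have sinexp: "complex_of_real (p * sin x) * iexp y = (of_real p * iexp (1 * x + y) - of_real p * iexp (-1 * x + y)) / (2 * \<i>)" for p x y :: real
    by (simp add: exp_add exp_diff exp_minus sin_of_real[symmetric] sin_exp_eq field_simps del: sin_of_real)
  show "(CLINT \<omega>|M. complex_of_real (P \<omega> * cos (S \<omega>)) * iexp (t * X \<omega>))
       = ((CLINT \<omega>|M. P \<omega> * iexp (1 * S \<omega> + t * X \<omega>)) + (CLINT \<omega>|M. P \<omega> * iexp (-1 * S \<omega> + t * X \<omega>))) / 2"
    unfolding cosexp integral_divide_zero by (subst Bochner_Integration.integral_add[OF int int]) (rule refl)
  show "(CLINT \<omega>|M. complex_of_real (P \<omega> * sin (S \<omega>)) * iexp (t * X \<omega>))
       = ((CLINT \<omega>|M. P \<omega> * iexp (1 * S \<omega> + t * X \<omega>)) - (CLINT \<omega>|M. P \<omega> * iexp (-1 * S \<omega> + t * X \<omega>))) / (2 * \<i>)"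
    unfolding sinexp integral_divide_zero by (subst Bochner_Integration.integral_diff[OF int int]) (rule refl)
  have im: "\<bar>p * q * indicator B x\<bar> \<le> 1" if "0 \<le> p" "p \<le> 1" "\<bar>q\<bar> \<le> 1" for p q :: real and B and x :: real
    using that by (auto simp: abs_mult indicator_def intro!: mult_le_one)
  have ii: "integrable M (\<lambda>\<omega>. P \<omega> * cos (S \<omega>) * indicator A (X \<omega>))" "integrable M (\<lambda>\<omega>. P \<omega> * sin (S \<omega>) * indicator A (X \<omega>))"
    by (auto intro!: integrable_bounded_real[OF pM, where B=1] im P)
  have "complex_of_real (P \<omega> * indicator A (X \<omega>)) * iexp (S \<omega>)
      = complex_of_real (P \<omega> * cos (S \<omega>) * indicator A (X \<omega>)) + \<i> * complex_of_real (P \<omega> * sin (S \<omega>) * indicator A (X \<omega>))" for \<omega>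
    by (simp add: exp_Euler algebra_simps cos_of_real sin_of_real)
  then show "(CLINT \<omega>|M. complex_of_real (P \<omega> * indicator A (X \<omega>)) * iexp (S \<omega>))
       = complex_of_real (LINT \<omega>|M. P \<omega> * cos (S \<omega>) * indicator A (X \<omega>)) + \<i> * complex_of_real (LINT \<omega>|M. P \<omega> * sin (S \<omega>) * indicator A (X \<omega>))"
    by (simp only: Bochner_Integration.integral_add ii integrable_mult_right integral_mult_right_zero integral_complex_of_real integrable_of_real)
qed

text \<open>Characters are exchanged for indicators one coordinate at a time: \<open>claim\<close>
  carries indicators on \<open>J\<close> and a character on \<open>I - J\<close>. At
  \<open>J = I\<close> it gives the measures of boxes, which determine the law on a finite
  product.\<close>

lemma distr_PiM_eq_of_iexp:
  fixes X :: "'i \<Rightarrow> 'a \<Rightarrow> real" and Y :: "'i \<Rightarrow> 'b \<Rightarrow> real"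
  assumes pM: "prob_space M" and pN: "prob_space N" and fin: "finite I"
    and X: "\<And>i. i \<in> I \<Longrightarrow> X i \<in> borel_measurable M" and Y: "\<And>i. i \<in> I \<Longrightarrow> Y i \<in> borel_measurable N"
    and eq: "\<And>c. (CLINT \<omega>|M. iexp (\<Sum>i\<in>I. c i * X i \<omega>)) = (CLINT \<omega>|N. iexp (\<Sum>i\<in>I. c i * Y i \<omega>))"
  shows "distr M (PiM I (\<lambda>_. borel)) (\<lambda>\<omega>. \<lambda>i\<in>I. X i \<omega>) = distr N (PiM I (\<lambda>_. borel)) (\<lambda>\<omega>. \<lambda>i\<in>I. Y i \<omega>)"
proof -
  interpret M: prob_space M by fact
  interpret N: prob_space N by fact
  have claim: "(CLINT \<omega>|M. (\<Prod>i\<in>J. indicator (A i) (X i \<omega>)) * iexp (\<Sum>i\<in>I-J. c i * X i \<omega>))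
     = (CLINT \<omega>|N. (\<Prod>i\<in>J. indicator (A i) (Y i \<omega>)) * iexp (\<Sum>i\<in>I-J. c i * Y i \<omega>))"
    if "J \<subseteq> I" and A: "\<And>i. A i \<in> sets borel" for J c A
  proof -
    have "finite J" using that fin by (auto intro: finite_subset)
    then show ?thesis using \<open>J \<subseteq> I\<close>
    proof (induction J arbitrary: c)
      case empty
      then show ?case using eq[of c] by simp
    next
      case (insert m J)
      have mI: "m \<in> I" and J: "J \<subseteq> I" "m \<notin> J" using insert by auto
      define P where "P \<omega> = (\<Prod>i\<in>J. indicator (A i) (X i \<omega>) :: real)" for \<omega>
      define Q where "Q \<omega> = (\<Prod>i\<in>J. indicator (A i) (Y i \<omega>) :: real)" for \<omega>
      define S where "S \<omega> = (\<Sum>i\<in>I-insert m J. c i * X i \<omega>)" for \<omega>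
      define T where "T \<omega> = (\<Sum>i\<in>I-insert m J. c i * Y i \<omega>)" for \<omega>
      have [measurable]: "\<And>i. i \<in> J \<Longrightarrow> X i \<in> borel_measurable M" "\<And>i. i \<in> J \<Longrightarrow> Y i \<in> borel_measurable N"
        "X m \<in> borel_measurable M" "Y m \<in> borel_measurable N" using X Y mI J by auto
      note [measurable] = A
      have [measurable]: "P \<in> borel_measurable M" "Q \<in> borel_measurable N" unfolding P_def Q_def by measurable
      have [measurable]: "S \<in> borel_measurable M" "T \<in> borel_measurable N" unfolding S_def T_def using X Y by auto
      have Pb: "0 \<le> P \<omega>" "P \<omega> \<le> 1" for \<omega> unfolding P_def by (auto intro!: prod_nonneg prod_le_1 simp: indicator_def)
      have Qb: "0 \<le> Q \<omega>" "Q \<omega> \<le> 1" for \<omega> unfolding Q_def by (auto intro!: prod_nonneg prod_le_1 simp: indicator_def)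
      \<comment> \<open>The induction hypothesis with coefficient \<open>t\<close> at
        \<open>m\<close> and \<open>s * c i\<close> elsewhere. The signs \<open>s = 1\<close> and
        \<open>s = -1\<close> give the two exponentials that make up cosine and sine.\<close>
      have sg: "(CLINT \<omega>|M. P \<omega> * iexp (s * S \<omega> + t * X m \<omega>)) = (CLINT \<omega>|N. Q \<omega> * iexp (s * T \<omega> + t * Y m \<omega>))" for s t
      proof -
        have IJ: "I - J = insert m (I - insert m J)" using mI J by auto
        have "(\<Sum>i\<in>I-J. (if i = m then t else s * c i) * X i \<omega>) = s * S \<omega> + t * X m \<omega>" for \<omega>
          unfolding IJ S_def sum_distrib_left using fin by (subst sum.insert) (auto intro!: sum.cong)
        moreover have "(\<Sum>i\<in>I-J. (if i = m then t else s * c i) * Y i \<omega>) = s * T \<omega> + t * Y m \<omega>" for \<omega>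
          unfolding IJ T_def sum_distrib_left using fin by (subst sum.insert) (auto intro!: sum.cong)
        moreover have "complex_of_real (P \<omega>) = (\<Prod>i\<in>J. indicator (A i) (X i \<omega>))" for \<omega>
          unfolding P_def by (auto simp: indicator_def intro!: prod.cong)
        moreover have "complex_of_real (Q \<omega>) = (\<Prod>i\<in>J. indicator (A i) (Y i \<omega>))" for \<omega>
          unfolding Q_def by (auto simp: indicator_def intro!: prod.cong)
        ultimately show ?thesis
          using insert.IH[OF J(1), of "\<lambda>i. if i = m then t else s * c i"] by simp
      qed
      have eq1: "(CLINT \<omega>|M. iexp (t * X m \<omega>)) = (CLINT \<omega>|N. iexp (t * Y m \<omega>))" for t
      proof -
        have "(\<Sum>i\<in>I. (if i = m then t else 0) * X i \<omega>) = t * X m \<omega>" for \<omega>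
          using fin mI by (simp add: if_distrib[of "\<lambda>x. x * _"] cong: if_cong)
        moreover have "(\<Sum>i\<in>I. (if i = m then t else 0) * Y i \<omega>) = t * Y m \<omega>" for \<omega>
          using fin mI by (simp add: if_distrib[of "\<lambda>x. x * _"] cong: if_cong)
        ultimately show ?thesis using eq[of "\<lambda>i. if i = m then t else 0"] by simp
      qed
      have mc: "\<bar>p * cos x\<bar> \<le> 1" "\<bar>p * sin x\<bar> \<le> 1" if "0 \<le> p" "p \<le> 1" for p x :: real
        using that by (auto simp: abs_mult intro!: mult_le_one)
      have Am: "A m \<in> sets borel" using A .
      have STm: "P \<in> borel_measurable M" "S \<in> borel_measurable M" "Q \<in> borel_measurable N" "T \<in> borel_measurable N" by measurable
      note wM = weighted_cos_sin_iexp[OF pM STm(1,2) X[OF mI] Am Pb]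
       and wN = weighted_cos_sin_iexp[OF pN STm(3,4) Y[OF mI] Am Qb]
      have meas: "X m \<in> borel_measurable M" "Y m \<in> borel_measurable N" "(\<lambda>\<omega>. P \<omega> * cos (S \<omega>)) \<in> borel_measurable M" "(\<lambda>\<omega>. Q \<omega> * cos (T \<omega>)) \<in> borel_measurable N"
        "(\<lambda>\<omega>. P \<omega> * sin (S \<omega>)) \<in> borel_measurable M" "(\<lambda>\<omega>. Q \<omega> * sin (T \<omega>)) \<in> borel_measurable N"
        by measurable
      have C: "(LINT \<omega>|M. P \<omega> * cos (S \<omega>) * indicator (A m) (X m \<omega>)) = (LINT \<omega>|N. Q \<omega> * cos (T \<omega>) * indicator (A m) (Y m \<omega>))"
        by (rule weighted_distr_eq[OF pM meas(1,3) mc(1)[OF Pb] pN meas(2,4) mc(1)[OF Qb] eq1 _ Am]) (simp only: wM(1) wN(1) sg)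
      have Sn: "(LINT \<omega>|M. P \<omega> * sin (S \<omega>) * indicator (A m) (X m \<omega>)) = (LINT \<omega>|N. Q \<omega> * sin (T \<omega>) * indicator (A m) (Y m \<omega>))"
        by (rule weighted_distr_eq[OF pM meas(1,5) mc(2)[OF Pb] pN meas(2,6) mc(2)[OF Qb] eq1 _ Am]) (simp only: wM(2) wN(2) sg)
      have "(\<Prod>i\<in>insert m J. indicator (A i) (X i \<omega>)) = complex_of_real (P \<omega> * indicator (A m) (X m \<omega>))" for \<omega>
        unfolding P_def using insert by (auto simp: indicator_def intro!: prod.cong)
      moreover have "(\<Prod>i\<in>insert m J. indicator (A i) (Y i \<omega>)) = complex_of_real (Q \<omega> * indicator (A m) (Y m \<omega>))" for \<omega>
        unfolding Q_def using insert by (auto simp: indicator_def intro!: prod.cong)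
      ultimately show ?case unfolding S_def[symmetric] T_def[symmetric]
        by (simp only: wM(3) wN(3) C Sn)
    qed
  qed
  have [measurable]: "(\<lambda>\<omega>. \<lambda>i\<in>I. X i \<omega>) \<in> measurable M (PiM I (\<lambda>_. borel))" "(\<lambda>\<omega>. \<lambda>i\<in>I. Y i \<omega>) \<in> measurable N (PiM I (\<lambda>_. borel))"
    using X Y by (auto intro!: measurable_restrict)
  have box: "measure M {\<omega>\<in>space M. \<forall>i\<in>I. X i \<omega> \<in> A i} = measure N {\<omega>\<in>space N. \<forall>i\<in>I. Y i \<omega> \<in> A i}" if A: "\<And>i. A i \<in> sets borel" for A
  proof -
    have "(\<Prod>i\<in>I. indicator (A i) (X i \<omega>) :: complex) = complex_of_real (indicator {\<omega>. \<forall>i\<in>I. X i \<omega> \<in> A i} \<omega>)" for \<omega>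
      using fin by (auto simp: indicator_def)
    moreover have "(\<Prod>i\<in>I. indicator (A i) (Y i \<omega>) :: complex) = complex_of_real (indicator {\<omega>. \<forall>i\<in>I. Y i \<omega> \<in> A i} \<omega>)" for \<omega>
      using fin by (auto simp: indicator_def)
    ultimately have "(CLINT \<omega>|M. complex_of_real (indicator {\<omega>. \<forall>i\<in>I. X i \<omega> \<in> A i} \<omega>))
        = (CLINT \<omega>|N. complex_of_real (indicator {\<omega>. \<forall>i\<in>I. Y i \<omega> \<in> A i} \<omega>))"
      using claim[OF subset_refl A, of "\<lambda>i. i" "\<lambda>_. 0"]
      by (simp only: Diff_cancel sum.empty of_real_0 mult_zero_right exp_zero mult_1_right)
    then have "measure M ({\<omega>. \<forall>i\<in>I. X i \<omega> \<in> A i} \<inter> space M) = measure N ({\<omega>. \<forall>i\<in>I. Y i \<omega> \<in> A i} \<inter> space N)"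
      unfolding integral_complex_of_real of_real_eq_iff by simp
    then show ?thesis by (simp add: Int_def conj_commute)
  qed
  define A0 :: "nat \<Rightarrow> ('i \<Rightarrow> real) set" where "A0 = (\<lambda>_. Pi\<^sub>E I (\<lambda>_. UNIV))"
  show ?thesis
  proof (rule measure_eqI_PiM_finite[OF fin, where A=A0])
    show "sets (distr M (PiM I (\<lambda>_. borel)) (\<lambda>\<omega>. \<lambda>i\<in>I. X i \<omega>)) = sets (PiM I (\<lambda>_. borel))" by simp
    show "sets (distr N (PiM I (\<lambda>_. borel)) (\<lambda>\<omega>. \<lambda>i\<in>I. Y i \<omega>)) = sets (PiM I (\<lambda>_. borel))" by simp
    fix A :: "'i \<Rightarrow> real set" assume A: "\<And>i. i \<in> I \<Longrightarrow> A i \<in> sets borel"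
    define B where "B i = (if i \<in> I then A i else {})" for i
    have B: "B i \<in> sets borel" for i using A by (auto simp: B_def)
    have AB: "Pi\<^sub>E I A = Pi\<^sub>E I B" by (auto simp: B_def PiE_def Pi_def)
    have "(\<lambda>\<omega>. \<lambda>i\<in>I. X i \<omega>) -` Pi\<^sub>E I B \<inter> space M = {\<omega>\<in>space M. \<forall>i\<in>I. X i \<omega> \<in> B i}"
      "(\<lambda>\<omega>. \<lambda>i\<in>I. Y i \<omega>) -` Pi\<^sub>E I B \<inter> space N = {\<omega>\<in>space N. \<forall>i\<in>I. Y i \<omega> \<in> B i}"
      by auto
    moreover have "Pi\<^sub>E I B \<in> sets (PiM I (\<lambda>_. borel))" using fin B by (intro sets_PiM_I_finite) auto
    ultimately show "emeasure (distr M (PiM I (\<lambda>_. borel)) (\<lambda>\<omega>. \<lambda>i\<in>I. X i \<omega>)) (Pi\<^sub>E I A) = emeasure (distr N (PiM I (\<lambda>_. borel)) (\<lambda>\<omega>. \<lambda>i\<in>I. Y i \<omega>)) (Pi\<^sub>E I A)"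
      unfolding AB by (simp add: emeasure_distr M.emeasure_eq_measure N.emeasure_eq_measure box[OF B])
  next
    have "Pi\<^sub>E I (\<lambda>_. UNIV :: real set) \<in> prod_algebra I (\<lambda>_. borel)" using fin by (intro prod_algebraI_finite) auto
    then show "range A0 \<subseteq> prod_algebra I (\<lambda>_. borel)" by (auto simp: A0_def)
    show "\<Union> (range A0) = space (PiM I (\<lambda>_. borel))" by (auto simp: A0_def space_PiM)
    interpret D: prob_space "distr M (PiM I (\<lambda>_. borel)) (\<lambda>\<omega>. \<lambda>i\<in>I. X i \<omega>)" by (rule M.prob_space_distr) measurable
    show "emeasure (distr M (PiM I (\<lambda>_. borel)) (\<lambda>\<omega>. \<lambda>i\<in>I. X i \<omega>)) (A0 i) \<noteq> \<infinity>" for i using D.emeasure_finite by simp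
  qed
qed

section \<open>Gaussian integration by parts\<close>

lemma integrable_std_normal_exp: "integrable std_normal_distribution (\<lambda>x. exp (a * x))"
  and integral_std_normal_exp: "(LINT x|std_normal_distribution. exp (a * x)) = exp (a\<^sup>2 / 2)"
proof -
  have e: "std_normal_density x * exp (a * x) = exp (a\<^sup>2 / 2) * normal_density a 1 x" for x
    by (simp add: normal_density_def exp_add[symmetric] power2_eq_square field_simps)
  show "integrable std_normal_distribution (\<lambda>x. exp (a * x))"
    by (subst integrable_density) (auto simp: e)
  show "(LINT x|std_normal_distribution. exp (a * x)) = exp (a\<^sup>2 / 2)"
    by (subst integral_density) (auto simp: e)
qed

lemma integrable_std_normal_exp_abs: "integrable std_normal_distribution (\<lambda>x. exp (a * \<bar>x\<bar>))"
proof (rule Bochner_Integration.integrable_bound)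
  show "integrable std_normal_distribution (\<lambda>x. exp (a * x) + exp ((-a) * x))"
    by (intro Bochner_Integration.integrable_add integrable_std_normal_exp)
  show "AE x in std_normal_distribution. norm (exp (a * \<bar>x\<bar>)) \<le> norm (exp (a * x) + exp ((-a) * x))"
    unfolding real_norm_def by (intro AE_I2 order_trans[OF _ abs_ge_self]) (auto simp: abs_if)
qed auto

text \<open>Controls the boundary terms when integrating by parts against the normal density.
  Allowing any filter along which the absolute value grows covers both ends of the line with one
  statement.\<close>

lemma tendsto_exp_abs_normal_density:
  assumes "filterlim (\<lambda>x::real. \<bar>x\<bar>) at_top F"
  shows "((\<lambda>x. exp (B * \<bar>x\<bar>) * std_normal_density x) \<longlongrightarrow> 0) F"
proof -
  have "((\<lambda>y. exp (B * y) * exp (- y\<^sup>2 / 2)) \<longlongrightarrow> 0) at_top" for B :: real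
  proof (rule tendsto_sandwich[OF _ _ tendsto_const])
    show "((\<lambda>y::real. exp (- y)) \<longlongrightarrow> 0) at_top"
      by real_asymp
    show "\<forall>\<^sub>F y in at_top. exp (B * y) * exp (- y\<^sup>2 / 2) \<le> exp (- y)"
      using eventually_ge_at_top[of "max 0 (2 * (B + 1))"]
    proof eventually_elim
      case (elim y)
      then have "2 * (B + 1) * y \<le> y * y" by (intro mult_right_mono) auto
      then show ?case by (simp add: exp_add[symmetric] power2_eq_square algebra_simps)
    qed
  qed auto
  from filterlim_compose[OF this assms]
  have "((\<lambda>x. exp (B * \<bar>x\<bar>) * exp (- x\<^sup>2 / 2)) \<longlongrightarrow> 0) F" by simp
  from tendsto_mult_right_zero[OF this, of "1 / sqrt (2 * pi)"] show ?thesis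
    by (simp add: normal_density_def mult_ac)
qed

text \<open>The function \<open>h x * std_normal_density x\<close> has derivative
  \<open>(h' x - x * h x) * std_normal_density x\<close> and, by the exponential growth bound,
  vanishes at both ends of the line, so this derivative integrates to 0.\<close>

lemma stein_std_normal:
  fixes h h' :: "real \<Rightarrow> real"
  assumes h: "\<And>x. (h has_real_derivative h' x) (at x)" and h': "continuous_on UNIV h'"
    and hb: "\<And>x. \<bar>h x\<bar> \<le> A * exp (B * \<bar>x\<bar>)" and h'b: "\<And>x. \<bar>h' x\<bar> \<le> A * exp (B * \<bar>x\<bar>)"
  shows "(LINT x|std_normal_distribution. x * h x) = (LINT x|std_normal_distribution. h' x)"
proof -
  have ch: "continuous_on UNIV h" using h by (intro DERIV_continuous_on) (auto intro: has_field_derivative_at_within)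
  have [measurable]: "h \<in> borel_measurable borel" "h' \<in> borel_measurable borel"
    using ch h' by (auto intro: borel_measurable_continuous_onI)
  have A0: "A \<ge> 0" using hb[of 0] by (auto intro: order_trans[of _ "\<bar>h 0\<bar>"])
  have i1: "integrable std_normal_distribution (\<lambda>x. x * h x)"
  proof (rule Bochner_Integration.integrable_bound)
    show "integrable std_normal_distribution (\<lambda>x. A * exp ((B + 1) * \<bar>x\<bar>))"
      by (intro integrable_mult_right integrable_std_normal_exp_abs)
    have "\<bar>x\<bar> * \<bar>h x\<bar> \<le> A * exp ((B + 1) * \<bar>x\<bar>)" for x
    proof -
      have "\<bar>x\<bar> \<le> exp \<bar>x\<bar>" using exp_ge_add_one_self[of "\<bar>x\<bar>"] by linarith
      then have "\<bar>x\<bar> * \<bar>h x\<bar> \<le> exp \<bar>x\<bar> * (A * exp (B * \<bar>x\<bar>))" using hb[of x] by (intro mult_mono) auto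
      also have "\<dots> = A * exp ((B + 1) * \<bar>x\<bar>)" by (simp add: algebra_simps exp_add)
      finally show ?thesis .
    qed
    then show "AE x in std_normal_distribution. norm (x * h x) \<le> norm (A * exp ((B + 1) * \<bar>x\<bar>))"
      using A0 by (auto simp: abs_mult)
  qed auto
  have i2: "integrable std_normal_distribution h'"
  proof (rule Bochner_Integration.integrable_bound)
    show "integrable std_normal_distribution (\<lambda>x. A * exp (B * \<bar>x\<bar>))"
      by (intro integrable_mult_right integrable_std_normal_exp_abs)
    show "AE x in std_normal_distribution. norm (h' x) \<le> norm (A * exp (B * \<bar>x\<bar>))"
      using A0 h'b by (auto simp: abs_mult)
  qed auto
  define f where "f x = (h' x - x * h x) * std_normal_density x" for x
  have i3: "integrable lborel f"
  proof -
    have "integrable std_normal_distribution (\<lambda>x. h' x - x * h x)" using i1 i2 by auto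
    then show ?thesis by (subst (asm) integrable_density) (auto simp: f_def[abs_def] mult.commute)
  qed
  have "continuous_on UNIV std_normal_density" unfolding normal_density_def by (intro continuous_intros) auto
  then have cf: "continuous_on UNIV f" unfolding f_def using ch h' by (intro continuous_intros) auto
  have dn: "(std_normal_density has_real_derivative (- x * std_normal_density x)) (at x)" for x
    unfolding normal_density_def by (auto intro!: derivative_eq_intros simp: field_simps)
  have lim: "((\<lambda>x. h x * std_normal_density x) \<longlongrightarrow> 0) F" if "filterlim (\<lambda>x::real. \<bar>x\<bar>) at_top F" for F
  proof (rule Lim_null_comparison)
    show "((\<lambda>x. A * (exp (B * \<bar>x\<bar>) * std_normal_density x)) \<longlongrightarrow> 0) F"
      by (intro tendsto_mult_right_zero tendsto_exp_abs_normal_density that)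
    have "norm (h x * std_normal_density x) \<le> A * (exp (B * \<bar>x\<bar>) * std_normal_density x)" for x
      using mult_right_mono[OF hb[of x], of "std_normal_density x"] by (simp add: abs_mult mult_ac)
    then show "\<forall>\<^sub>F x in F. norm (h x * std_normal_density x) \<le> A * (exp (B * \<bar>x\<bar>) * std_normal_density x)"
      by simp
  qed
  have "(LBINT x=-\<infinity>..\<infinity>. f x) = 0 - 0"
  proof (rule interval_integral_FTC_integrable[where F="\<lambda>x. h x * std_normal_density x"])
    show "((\<lambda>x. h x * std_normal_density x) has_vector_derivative f x) (at x)" for x
      unfolding has_real_derivative_iff_has_vector_derivative[symmetric] f_def
      by (auto intro!: derivative_eq_intros h dn simp: algebra_simps)
    show "isCont f x" for x using cf by (simp add: continuous_on_eq_continuous_at)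
    show "set_integrable lborel (einterval (-\<infinity>) \<infinity>) f" using i3 by (simp add: set_integrable_def)
    have "filterlim (\<lambda>x::real. \<bar>x\<bar>) at_top at_bot" "filterlim (\<lambda>x::real. \<bar>x\<bar>) at_top at_top"
      using filterlim_abs_real filterlim_at_infinity_imp_norm_at_top[OF filterlim_at_bot_imp_at_infinity[OF filterlim_ident]] by auto
    then show "(((\<lambda>x. h x * std_normal_density x) \<circ> real_of_ereal) \<longlongrightarrow> 0) (at_right (-\<infinity>))"
      "(((\<lambda>x. h x * std_normal_density x) \<circ> real_of_ereal) \<longlongrightarrow> 0) (at_left \<infinity>)"
      unfolding ereal_tendsto_simps by (auto intro!: lim)
  qed auto
  then have "(LINT x|lborel. f x) = 0" by (simp add: interval_lebesgue_integral_def set_lebesgue_integral_def)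
  moreover have "(LINT x|lborel. f x) = (LINT x|std_normal_distribution. h' x - x * h x)"
    by (subst integral_density) (auto simp: f_def intro!: Bochner_Integration.integral_cong)
  ultimately show ?thesis using i1 i2 by simp
qed

text \<open>The sign of \<open>v\<close> is derived, from the bound 1 on the modulus of a
  characteristic function. The case \<open>v = 0\<close> is the point mass at 0.\<close>

lemma centered_gaussian_distr:
  assumes "prob_space M" "U \<in> borel_measurable M"
    and ch: "\<And>t. (CLINT \<omega>|M. iexp (t * U \<omega>)) = of_real (exp (- (t\<^sup>2 * v) / 2))"
  shows "v \<ge> 0" and "distr M borel U = distr std_normal_distribution borel (\<lambda>x. sqrt v * x)"
proof -
  interpret prob_space M by fact
  have "norm (CLINT \<omega>|M. iexp (1 * U \<omega>)) \<le> (LINT \<omega>|M. 1)"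
    using integral_norm_bound[of M "\<lambda>\<omega>. iexp (1 * U \<omega>)"] by simp
  then show v: "v \<ge> 0" unfolding ch by (simp add: prob_space)
  interpret N: real_distribution std_normal_distribution by (rule real_dist_normal_dist)
  show "distr M borel U = distr std_normal_distribution borel (\<lambda>x. sqrt v * x)"
  proof (rule distr_eq_of_iexp[OF assms(1) N.prob_space_axioms assms(2)])
    fix t
    have "(CLINT x|std_normal_distribution. iexp (t * (sqrt v * x))) = char std_normal_distribution (t * sqrt v)"
      by (simp add: char_def mult.assoc)
    also have "\<dots> = of_real (exp (- (t\<^sup>2 * v) / 2))"
      by (simp add: char_std_normal_distribution power_mult_distrib v)
    finally show "(CLINT \<omega>|M. iexp (t * U \<omega>)) = (CLINT x|std_normal_distribution. iexp (t * (sqrt v * x)))"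
      using ch by simp
  qed auto
qed

lemma integrable_exp_abs_centered_gaussian:
  assumes "prob_space M" "U \<in> borel_measurable M"
    and ch: "\<And>t. (CLINT \<omega>|M. iexp (t * U \<omega>)) = of_real (exp (- (t\<^sup>2 * v) / 2))"
  shows "integrable M (\<lambda>\<omega>. exp (a * \<bar>U \<omega>\<bar>))"
proof -
  note d = centered_gaussian_distr[OF assms]
  have "integrable std_normal_distribution (\<lambda>x. exp (a * \<bar>sqrt v * x\<bar>))"
    using integrable_std_normal_exp_abs[of "a * sqrt v"] d(1) by (simp add: abs_mult mult.assoc)
  then have "integrable (distr std_normal_distribution borel (\<lambda>x. sqrt v * x)) (\<lambda>x. exp (a * \<bar>x\<bar>))"
    by (subst integrable_distr_eq) auto
  then show ?thesis using assms(2) unfolding d(2)[symmetric] by (subst (asm) integrable_distr_eq) auto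
qed

text \<open>Valid for every joint law: the sum is at most \<open>card I\<close> times its largest
  term, and the exponential of that multiple of the largest term is one summand of the dominating
  function. The extra 1 accounts for empty \<open>I\<close>.\<close>

lemma integrable_exp_sum_abs:
  fixes X :: "'i \<Rightarrow> 'a \<Rightarrow> real"
  assumes "prob_space M" "finite I" and X: "\<And>i. i \<in> I \<Longrightarrow> X i \<in> borel_measurable M"
    and int: "\<And>i a. i \<in> I \<Longrightarrow> integrable M (\<lambda>\<omega>. exp (a * \<bar>X i \<omega>\<bar>))"
    and B: "0 \<le> B"
  shows "integrable M (\<lambda>\<omega>. exp (B * (\<Sum>i\<in>I. \<bar>X i \<omega>\<bar>)))"
proof (rule Bochner_Integration.integrable_bound)
  interpret prob_space M by fact
  show "integrable M (\<lambda>\<omega>. 1 + (\<Sum>i\<in>I. exp (B * card I * \<bar>X i \<omega>\<bar>)))"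
    using int by (intro Bochner_Integration.integrable_add Bochner_Integration.integrable_sum) auto
  have "exp (B * (\<Sum>i\<in>I. \<bar>x i\<bar>)) \<le> 1 + (\<Sum>i\<in>I. exp (B * card I * \<bar>x i\<bar>))" for x :: "'i \<Rightarrow> real"
  proof (cases "I = {}")
    case False
    have "Max ((\<lambda>i. \<bar>x i\<bar>) ` I) \<in> (\<lambda>i. \<bar>x i\<bar>) ` I" using False assms(2) by (intro Max_in) auto
    then obtain m where m: "m \<in> I" "Max ((\<lambda>i. \<bar>x i\<bar>) ` I) = \<bar>x m\<bar>" by auto
    have m': "\<bar>x i\<bar> \<le> \<bar>x m\<bar>" if "i \<in> I" for i unfolding m(2)[symmetric] using that assms(2) by (intro Max_ge) auto
    have "(\<Sum>i\<in>I. \<bar>x i\<bar>) \<le> card I * \<bar>x m\<bar>" using sum_bounded_above[of I "\<lambda>i. \<bar>x i\<bar>" "\<bar>x m\<bar>"] m' by simp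
    then have "exp (B * (\<Sum>i\<in>I. \<bar>x i\<bar>)) \<le> exp (B * card I * \<bar>x m\<bar>)" 
      using mult_left_mono[OF _ B] by (simp add: mult.assoc)
    also have "\<dots> \<le> (\<Sum>i\<in>I. exp (B * card I * \<bar>x i\<bar>))"
      by (rule member_le_sum[OF m(1)]) (use assms in auto)
    finally show ?thesis by simp
  qed auto
  then show "AE \<omega> in M. norm (exp (B * (\<Sum>i\<in>I. \<bar>X i \<omega>\<bar>))) \<le> norm (1 + (\<Sum>i\<in>I. exp (B * card I * \<bar>X i \<omega>\<bar>)))"
    by (auto intro!: AE_I2 order_trans[OF _ abs_ge_self])
  show "(\<lambda>\<omega>. exp (B * (\<Sum>i\<in>I. \<bar>X i \<omega>\<bar>))) \<in> borel_measurable M" using X by measurable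
qed

lemma stein_centered_gaussian:
  fixes h h' :: "real \<Rightarrow> real"
  assumes "prob_space M" and U: "U \<in> borel_measurable M"
    and ch: "\<And>t. (CLINT \<omega>|M. iexp (t * U \<omega>)) = of_real (exp (- (t\<^sup>2 * v) / 2))"
    and h: "\<And>x. (h has_real_derivative h' x) (at x)" and h': "continuous_on UNIV h'"
    and hb: "\<And>x. \<bar>h x\<bar> \<le> A * exp (B * \<bar>x\<bar>)" and h'b: "\<And>x. \<bar>h' x\<bar> \<le> A * exp (B * \<bar>x\<bar>)"
  shows "(LINT \<omega>|M. U \<omega> * h (U \<omega>)) = v * (LINT \<omega>|M. h' (U \<omega>))"
proof -
  note d = centered_gaussian_distr[OF assms(1-3)]
  have ch: "continuous_on UNIV h" using h by (intro DERIV_continuous_on) (auto intro: has_field_derivative_at_within)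
  have [measurable]: "h \<in> borel_measurable borel" "h' \<in> borel_measurable borel"
    using ch h' by (auto intro: borel_measurable_continuous_onI)
  have A0: "A \<ge> 0" using hb[of 0] by (auto intro: order_trans[of _ "\<bar>h 0\<bar>"])
  have "(LINT \<omega>|M. U \<omega> * h (U \<omega>)) = (LINT x|distr M borel U. x * h x)"
    by (rule integral_distr[symmetric]) (use U in auto)
  also have "\<dots> = (LINT x|std_normal_distribution. sqrt v * x * h (sqrt v * x))"
    unfolding d(2) by (rule integral_distr) auto
  also have "\<dots> = sqrt v * (LINT x|std_normal_distribution. x * h (sqrt v * x))"
    by (subst integral_mult_right_zero[symmetric]) (simp add: mult.assoc)
  also have "(LINT x|std_normal_distribution. x * h (sqrt v * x)) = (LINT x|std_normal_distribution. sqrt v * h' (sqrt v * x))"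
  \<comment> \<open>The factor \<open>1 + sqrt v\<close> serves both bounds: the chain rule puts
    \<open>sqrt v\<close> on the derivative but not on the function.\<close>
  proof (rule stein_std_normal[where A = "A * (1 + sqrt v)" and B = "B * sqrt v"])
    show "((\<lambda>x. h (sqrt v * x)) has_real_derivative sqrt v * h' (sqrt v * x)) (at x)" for x
    proof -
      have "((\<lambda>x. sqrt v * x) has_real_derivative sqrt v) (at x)" by (auto intro!: derivative_eq_intros)
      from DERIV_chain2[OF h this] show ?thesis by (simp add: mult.commute)
    qed
    show "continuous_on UNIV (\<lambda>x. sqrt v * h' (sqrt v * x))"
      by (intro continuous_intros continuous_on_compose2[OF h']) auto
    show "\<bar>h (sqrt v * x)\<bar> \<le> A * (1 + sqrt v) * exp (B * sqrt v * \<bar>x\<bar>)" for x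
    proof -
      have "\<bar>h (sqrt v * x)\<bar> \<le> 1 * (A * exp (B * sqrt v * \<bar>x\<bar>))" using hb[of "sqrt v * x"] d(1) by (simp add: abs_mult mult.assoc)
      also have "\<dots> \<le> (1 + sqrt v) * (A * exp (B * sqrt v * \<bar>x\<bar>))" using A0 d(1) by (intro mult_right_mono) auto
      finally show ?thesis by (simp add: mult_ac)
    qed
    show "\<bar>sqrt v * h' (sqrt v * x)\<bar> \<le> A * (1 + sqrt v) * exp (B * sqrt v * \<bar>x\<bar>)" for x
    proof -
      have "\<bar>sqrt v * h' (sqrt v * x)\<bar> \<le> sqrt v * (A * exp (B * sqrt v * \<bar>x\<bar>))" 
        using mult_left_mono[OF h'b[of "sqrt v * x"], of "sqrt v"] d(1) by (simp add: abs_mult mult.assoc)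
      also have "\<dots> \<le> (1 + sqrt v) * (A * exp (B * sqrt v * \<bar>x\<bar>))" using A0 d(1) by (intro mult_right_mono) auto
      finally show ?thesis by (simp add: mult_ac)
    qed
  qed
  also have "sqrt v * \<dots> = v * (LINT x|std_normal_distribution. h' (sqrt v * x))"
    using d(1) by (simp add: mult.assoc[symmetric])
  also have "(LINT x|std_normal_distribution. h' (sqrt v * x)) = (LINT x|distr M borel U. h' x)"
    unfolding d(2) by (rule integral_distr[symmetric]) auto
  also have "\<dots> = (LINT \<omega>|M. h' (U \<omega>))"
    by (rule integral_distr) (use U in auto)
  finally show ?thesis .
qed

text \<open>A substitute for Hoelder's inequality: the exponential of a sum is bounded by functions
  of the separate summands, whatever their dependence, at the price of doubled exponents.\<close>

lemma exp_add_le_sum: "exp (a + b) \<le> exp (2 * a) + exp (2 * b)" for a b :: real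
proof -
  have "exp (a + b) \<le> exp (max (2 * a) (2 * b))" by auto
  also have "\<dots> \<le> exp (2 * a) + exp (2 * b)" by (auto simp: max_def add_increasing add_increasing2)
  finally show ?thesis .
qed

text \<open>\<open>Z i - b i / v * U\<close> is independent of \<open>U\<close>, so conditioning on it reduces the claim to the
  one-dimensional Stein identity. The case \<open>v = 0\<close> is separate, since then \<open>b i / v = 0\<close> by convention.\<close>

lemma gaussian_integration_by_parts:
  fixes Z :: "'i \<Rightarrow> 'a \<Rightarrow> real" and f :: "('i \<Rightarrow> real) \<Rightarrow> real"
  assumes pM: "prob_space M" and fin: "finite I"
    and U: "U \<in> borel_measurable M" and Z: "\<And>i. i \<in> I \<Longrightarrow> Z i \<in> borel_measurable M"
    and ch: "\<And>a c. (CLINT \<omega>|M. iexp (a * U \<omega> + (\<Sum>i\<in>I. c i * Z i \<omega>)))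
                = of_real (exp (- (a\<^sup>2 * v + 2 * a * (\<Sum>i\<in>I. c i * b i) + Q c) / 2))"
    and Q0: "Q (\<lambda>_. 0) = 0"
    and int: "\<And>i a. i \<in> I \<Longrightarrow> integrable M (\<lambda>\<omega>. exp (a * \<bar>Z i \<omega>\<bar>))"
    and f: "f \<in> borel_measurable (PiM I (\<lambda>_. borel))" and f': "\<And>i. i \<in> I \<Longrightarrow> f' i \<in> borel_measurable (PiM I (\<lambda>_. borel))"
    and fr: "\<And>z. f (restrict z I) = f z" and f'r: "\<And>i z. i \<in> I \<Longrightarrow> f' i (restrict z I) = f' i z"
    and deriv: "\<And>z d t. ((\<lambda>t. f (\<lambda>i. z i + t * d i)) has_real_derivative (\<Sum>i\<in>I. d i * f' i (\<lambda>i. z i + t * d i))) (at t)"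
    and cont: "\<And>z d i. i \<in> I \<Longrightarrow> continuous_on UNIV (\<lambda>t. f' i (\<lambda>i. z i + t * d i))"
    and B: "0 \<le> B"
    and fb: "\<And>z. \<bar>f z\<bar> \<le> A * exp (B * (\<Sum>i\<in>I. \<bar>z i\<bar>))" 
    and f'b: "\<And>i z. i \<in> I \<Longrightarrow> \<bar>f' i z\<bar> \<le> A * exp (B * (\<Sum>i\<in>I. \<bar>z i\<bar>))" 
  shows "integrable M (\<lambda>\<omega>. U \<omega> * f (\<lambda>i. Z i \<omega>))" (is ?int)
    and "\<And>i. i \<in> I \<Longrightarrow> integrable M (\<lambda>\<omega>. f' i (\<lambda>i. Z i \<omega>))"
    and "(LINT \<omega>|M. U \<omega> * f (\<lambda>i. Z i \<omega>)) = (\<Sum>i\<in>I. b i * (LINT \<omega>|M. f' i (\<lambda>i. Z i \<omega>)))" (is ?eq)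
proof -
  interpret M: prob_space M by fact
  interpret MM: pair_prob_space M M ..
  have chU: "(CLINT \<omega>|M. iexp (t * U \<omega>)) = of_real (exp (- (t\<^sup>2 * v) / 2))" for t
    using ch[of t "\<lambda>_. 0"] Q0 by simp
  note v0 = centered_gaussian_distr(1)[OF pM U chU] and dU = centered_gaussian_distr(2)[OF pM U chU]
  have intU: "integrable M (\<lambda>\<omega>. exp (a * \<bar>U \<omega>\<bar>))" for a by (rule integrable_exp_abs_centered_gaussian[OF pM U chU])
  have A0: "A \<ge> 0" using fb[of "\<lambda>_. 0"] by (auto intro: order_trans[of _ "\<bar>f (\<lambda>_. 0)\<bar>"])
  have ZP: "(\<lambda>\<omega>. \<lambda>i\<in>I. Z i \<omega>) \<in> measurable M (PiM I (\<lambda>_. borel))" using Z by (auto intro!: measurable_restrict)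
  have fZ: "(\<lambda>\<omega>. f (\<lambda>i. Z i \<omega>)) \<in> borel_measurable M"
    using measurable_compose[OF ZP f] by (simp add: fr)
  have f'Z: "(\<lambda>\<omega>. f' i (\<lambda>i. Z i \<omega>)) \<in> borel_measurable M" if "i \<in> I" for i
    using measurable_compose[OF ZP f'[OF that]] that by (simp add: f'r)
  have iZ: "integrable M (\<lambda>\<omega>. exp (C * (\<Sum>i\<in>I. \<bar>Z i \<omega>\<bar>)))" if "0 \<le> C" for C
    by (rule integrable_exp_sum_abs[OF pM fin Z int that])
  show f'int: "integrable M (\<lambda>\<omega>. f' i (\<lambda>i. Z i \<omega>))" if "i \<in> I" for i
  proof (rule Bochner_Integration.integrable_bound)
    show "integrable M (\<lambda>\<omega>. A * exp (B * (\<Sum>i\<in>I. \<bar>Z i \<omega>\<bar>)))" using iZ[OF B] by auto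
    show "AE \<omega> in M. norm (f' i (\<lambda>i. Z i \<omega>)) \<le> norm (A * exp (B * (\<Sum>i\<in>I. \<bar>Z i \<omega>\<bar>)))"
      unfolding real_norm_def by (intro AE_I2 order_trans[OF f'b abs_ge_self] that)
  qed (rule f'Z[OF that])
  show ?int
  proof (rule Bochner_Integration.integrable_bound)
    show "integrable M (\<lambda>\<omega>. A * (exp (2 * \<bar>U \<omega>\<bar>) + exp (2 * B * (\<Sum>i\<in>I. \<bar>Z i \<omega>\<bar>))))" 
      using iZ[of "2 * B"] B intU[of 2] by auto
    have "\<bar>u * f z\<bar> \<le> A * (exp (2 * \<bar>u\<bar>) + exp (2 * B * (\<Sum>i\<in>I. \<bar>z i\<bar>)))" for u z
    proof -
      have "\<bar>u\<bar> \<le> exp \<bar>u\<bar>" using exp_ge_add_one_self[of "\<bar>u\<bar>"] by linarith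
      then have "\<bar>u * f z\<bar> \<le> exp \<bar>u\<bar> * (A * exp (B * (\<Sum>i\<in>I. \<bar>z i\<bar>)))" unfolding abs_mult using fb[of z] by (intro mult_mono) auto
      also have "\<dots> = A * exp (\<bar>u\<bar> + B * (\<Sum>i\<in>I. \<bar>z i\<bar>))" by (simp add: exp_add)
      also have "\<dots> \<le> A * (exp (2 * \<bar>u\<bar>) + exp (2 * (B * (\<Sum>i\<in>I. \<bar>z i\<bar>))))" by (intro mult_left_mono exp_add_le_sum A0)
      finally show ?thesis by (simp add: mult.assoc)
    qed
    then show "AE \<omega> in M. norm (U \<omega> * f (\<lambda>i. Z i \<omega>)) \<le> norm (A * (exp (2 * \<bar>U \<omega>\<bar>) + exp (2 * B * (\<Sum>i\<in>I. \<bar>Z i \<omega>\<bar>))))"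
      unfolding real_norm_def by (intro AE_I2 order_trans[OF _ abs_ge_self]) auto
  qed (use U fZ in auto)
  note Uint = this
  show ?eq
  proof (cases "v = 0")
    case True
    have "AE \<omega> in M. U \<omega> = 0"
    proof -
      have "AE x in distr std_normal_distribution borel (\<lambda>x. sqrt v * x). x = 0"
        by (subst AE_distr_iff) (auto simp: True)
      then have "AE x in distr M borel U. x = 0" unfolding dU .
      then show ?thesis using U by (subst (asm) AE_distr_iff) auto
    qed
    then have "(LINT \<omega>|M. U \<omega> * f (\<lambda>i. Z i \<omega>)) = (LINT \<omega>|M. 0)"
      by (intro integral_cong_AE) (use U fZ in auto)
    \<comment> \<open>A degenerate \<open>U\<close> has covariance 0 with every \<open>Z i\<close>.
      Otherwise the exponent would be unbounded in \<open>a\<close>: the chosen \<open>a\<close>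
      makes \<open>2 * a * b i + Q c\<close> equal to -1, and the characteristic function would
      exceed 1.\<close>
    moreover have "b i = 0" if "i \<in> I" for i
    proof (rule ccontr)
      assume bi: "b i \<noteq> 0"
      define c where "c = (\<lambda>j. if j = i then 1 else 0 :: real)"
      define a where "a = - (Q c + 1) / (2 * b i)"
      have cb: "(\<Sum>j\<in>I. c j * b j) = b i" using that fin by (simp add: c_def if_distrib[of "\<lambda>x. x * _"] cong: if_cong)
      have "norm (CLINT \<omega>|M. iexp (a * U \<omega> + (\<Sum>i\<in>I. c i * Z i \<omega>))) \<le> 1"
        using integral_norm_bound[of M "\<lambda>\<omega>. iexp (a * U \<omega> + (\<Sum>i\<in>I. c i * Z i \<omega>))"] by (simp only: norm_exp_i_times integral_const) (simp add: M.prob_space)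
      then have "2 * a * b i + Q c \<ge> 0" unfolding ch cb True by simp
      moreover have "2 * a * b i = - (Q c + 1)" using bi by (simp add: a_def)
      ultimately show False by simp
    qed
    ultimately show ?thesis by simp
  next
    case False
    with v0 have v: "v > 0" by simp
    define R where "R i \<omega> = Z i \<omega> - b i / v * U \<omega>" for i \<omega>
    let ?MM = "M \<Otimes>\<^sub>M M" and ?Z = "\<lambda>x y i. R i x + U y * (b i / v)"
    have R: "R i \<in> borel_measurable M" if "i \<in> I" for i unfolding R_def using Z[OF that] U by measurable
    \<comment> \<open>\<open>None\<close> indexes \<open>U\<close> and \<open>Some i\<close> the
      residual \<open>R i\<close>. The family \<open>W\<close> reads the residuals off one copy of
      the space and \<open>U\<close> off another, so equality of the joint laws of \<open>V\<close>
      and \<open>W\<close> is the independence of \<open>U\<close> from the residuals.\<close>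
    define J where "J = insert None (Some ` I)"
    define V where "V j = (case j of None \<Rightarrow> U | Some i \<Rightarrow> R i)" for j
    define W where "W j \<omega> = (case j of None \<Rightarrow> U (snd \<omega>) | Some i \<Rightarrow> R i (fst \<omega>))" for j and \<omega> :: "'a \<times> 'a"
    let ?PJ = "PiM J (\<lambda>_. borel :: real measure)" and ?VJ = "\<lambda>\<omega>. \<lambda>j\<in>J. V j \<omega>" and ?WJ = "\<lambda>\<omega>. \<lambda>j\<in>J. W j \<omega>"
    have finJ: "finite J" using fin by (auto simp: J_def)
    have Vm: "V j \<in> borel_measurable M" if "j \<in> J" for j using that R U by (auto simp: J_def V_def)
    have Wm: "W j \<in> borel_measurable ?MM" if "j \<in> J" for j
      using that R U by (auto simp: J_def W_def[abs_def] intro: measurable_compose[OF measurable_fst] measurable_compose[OF measurable_snd])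
    have sumJ: "(\<Sum>j\<in>J. g j) = g None + (\<Sum>i\<in>I. g (Some i))" for g :: "'i option \<Rightarrow> real"
      unfolding J_def using fin by (subst sum.insert) (auto simp: sum.reindex)
    have law: "distr M ?PJ ?VJ = distr ?MM ?PJ ?WJ"
    proof (rule distr_PiM_eq_of_iexp[OF pM MM.prob_space_axioms finJ Vm Wm])
      fix c :: "'i option \<Rightarrow> real"
      define a where "a = c None"
      define d where "d i = c (Some i)" for i
      define s where "s = (\<Sum>i\<in>I. d i * b i)"
      have sV: "(\<Sum>j\<in>J. c j * V j \<omega>) = (a - s / v) * U \<omega> + (\<Sum>i\<in>I. d i * Z i \<omega>)" for \<omega>
        unfolding sumJ V_def s_def d_def[symmetric] a_def[symmetric]
        by (simp add: R_def algebra_simps sum_subtractf sum_distrib_left sum_divide_distrib)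
      have sR: "(\<Sum>i\<in>I. d i * R i \<omega>) = (- s / v) * U \<omega> + (\<Sum>i\<in>I. d i * Z i \<omega>)" for \<omega>
        unfolding s_def by (simp add: R_def algebra_simps sum_subtractf sum_distrib_left sum_divide_distrib)
      have sW: "iexp (\<Sum>j\<in>J. c j * W j \<omega>) = iexp (\<Sum>i\<in>I. d i * R i (fst \<omega>)) * iexp (a * U (snd \<omega>))" for \<omega>
        unfolding sumJ W_def d_def[symmetric] a_def[symmetric] exp_add[symmetric] by (simp add: algebra_simps)
      have mR: "(\<lambda>\<omega>. \<Sum>i\<in>I. d i * R i \<omega>) \<in> borel_measurable M" using R by auto
      have [measurable]: "(\<lambda>\<omega>. \<Sum>i\<in>I. d i * R i (fst \<omega>)) \<in> borel_measurable ?MM"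
        "(\<lambda>\<omega>. U (snd \<omega>)) \<in> borel_measurable ?MM"
        using measurable_compose[OF measurable_fst mR] measurable_compose[OF measurable_snd U] by auto
      have "(CLINT \<omega>|?MM. iexp (\<Sum>j\<in>J. c j * W j \<omega>)) = (CLINT x|M. CLINT y|M. iexp (\<Sum>i\<in>I. d i * R i x) * iexp (a * U y))"
        unfolding sW
      proof (subst MM.integral_fst'[symmetric])
        show "integrable ?MM (\<lambda>\<omega>. iexp (\<Sum>i\<in>I. d i * R i (fst \<omega>)) * iexp (a * U (snd \<omega>)))"
          by (rule integrable_bounded_complex[OF MM.prob_space_axioms, where B=1])
             (auto simp: norm_mult simp del: of_real_sum of_real_mult)
      qed simp
      also have "\<dots> = (CLINT x|M. iexp (\<Sum>i\<in>I. d i * R i x)) * (CLINT y|M. iexp (a * U y))"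
        by (simp only: integral_mult_right_zero integral_mult_left_zero)
      also have "\<dots> = of_real (exp (- ((- s / v)\<^sup>2 * v + 2 * (- s / v) * s + Q d) / 2) * exp (- (a\<^sup>2 * v) / 2))"
        unfolding sR ch chU s_def[symmetric] by simp
      \<comment> \<open>Both sides equal
        \<open>exp (- (a\<^sup>2 * v + Q d - s\<^sup>2 / v) / 2)\<close>: the slope
        \<open>b i / v\<close> is the regression coefficient of \<open>Z i\<close> on
        \<open>U\<close>, chosen to cancel the cross term in \<open>a * s\<close>.\<close>
      also have "exp (- ((- s / v)\<^sup>2 * v + 2 * (- s / v) * s + Q d) / 2) * exp (- (a\<^sup>2 * v) / 2) = exp (- ((a - s / v)\<^sup>2 * v + 2 * (a - s / v) * s + Q d) / 2)"
        unfolding exp_add[symmetric] using v by (simp add: field_simps power2_eq_square)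
      also have "of_real \<dots> = (CLINT \<omega>|M. iexp (\<Sum>j\<in>J. c j * V j \<omega>))"
        unfolding sV ch s_def[symmetric] ..
      finally show "(CLINT \<omega>|M. iexp (\<Sum>j\<in>J. c j * V j \<omega>)) = (CLINT \<omega>|?MM. iexp (\<Sum>j\<in>J. c j * W j \<omega>))" ..
    qed
    have VP: "?VJ \<in> measurable M ?PJ" using Vm by (auto intro!: measurable_restrict)
    have WP: "?WJ \<in> measurable ?MM ?PJ" using Wm by (auto intro!: measurable_restrict)
    have transfer: "integrable ?MM (\<lambda>\<omega>. g (\<lambda>j\<in>J. W j \<omega>))" 
       "(LINT \<omega>|M. g (\<lambda>j\<in>J. V j \<omega>)) = (LINT \<omega>|?MM. g (\<lambda>j\<in>J. W j \<omega>))"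
      if g: "g \<in> borel_measurable ?PJ" and "integrable M (\<lambda>\<omega>. g (\<lambda>j\<in>J. V j \<omega>))" for g :: "('i option \<Rightarrow> real) \<Rightarrow> real"
    proof -
      show "integrable ?MM (\<lambda>\<omega>. g (\<lambda>j\<in>J. W j \<omega>))"
        using that(2) unfolding integrable_distr_eq[OF VP g, symmetric] law integrable_distr_eq[OF WP g] .
      show "(LINT \<omega>|M. g (\<lambda>j\<in>J. V j \<omega>)) = (LINT \<omega>|?MM. g (\<lambda>j\<in>J. W j \<omega>))"
        unfolding integral_distr[OF VP g, symmetric] law integral_distr[OF WP g] ..
    qed
    \<comment> \<open>Recovers \<open>Z\<close> from \<open>U\<close> and the residuals, so that
      integrals of functions of \<open>Z\<close> can be moved to the product space.\<close>
    define \<phi> where "\<phi> w = (\<lambda>i\<in>I. w (Some i) + b i / v * w None)" for w :: "'i option \<Rightarrow> real"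
    have NJ: "None \<in> J" "\<And>i. i \<in> I \<Longrightarrow> Some i \<in> J" by (auto simp: J_def)
    have \<phi>: "\<phi> \<in> measurable ?PJ (PiM I (\<lambda>_. borel))"
      unfolding \<phi>_def using NJ by (intro measurable_restrict borel_measurable_add borel_measurable_times measurable_component_singleton) auto
    have \<phi>V: "\<phi> (\<lambda>j\<in>J. V j \<omega>) = restrict (\<lambda>i. Z i \<omega>) I" for \<omega>
      using NJ by (auto simp: \<phi>_def V_def R_def restrict_def fun_eq_iff)
    have \<phi>W: "\<phi> (\<lambda>j\<in>J. W j \<omega>) = restrict (?Z (fst \<omega>) (snd \<omega>)) I" for \<omega>
      using NJ by (auto simp: \<phi>_def W_def restrict_def fun_eq_iff)
    define G where "G w = w None * f (\<phi> w)" for w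
    define G' where "G' i w = f' i (\<phi> w)" for i w
    have GV: "G (\<lambda>j\<in>J. V j \<omega>) = U \<omega> * f (\<lambda>i. Z i \<omega>)" for \<omega>
      unfolding G_def \<phi>V fr using NJ by (simp add: V_def)
    have GW: "G (\<lambda>j\<in>J. W j \<omega>) = U (snd \<omega>) * f (?Z (fst \<omega>) (snd \<omega>))" for \<omega>
      unfolding G_def \<phi>W fr using NJ by (simp add: W_def)
    have G'V: "G' i (\<lambda>j\<in>J. V j \<omega>) = f' i (\<lambda>i. Z i \<omega>)" if "i \<in> I" for \<omega> i
      unfolding G'_def \<phi>V f'r[OF that] ..
    have G'W: "G' i (\<lambda>j\<in>J. W j \<omega>) = f' i (?Z (fst \<omega>) (snd \<omega>))" if "i \<in> I" for \<omega> i
      unfolding G'_def \<phi>W f'r[OF that] ..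
    have Gm: "G \<in> borel_measurable ?PJ" unfolding G_def 
      by (intro borel_measurable_times measurable_component_singleton NJ measurable_compose[OF \<phi> f])
    have G'm: "G' i \<in> borel_measurable ?PJ" if "i \<in> I" for i unfolding G'_def
      by (intro measurable_compose[OF \<phi> f'] that)
    note tG = transfer[OF Gm, unfolded GV GW, OF Uint]
    have tG': "integrable ?MM (\<lambda>\<omega>. f' i (?Z (fst \<omega>) (snd \<omega>)))"
      "(LINT \<omega>|M. f' i (\<lambda>i. Z i \<omega>)) = (LINT \<omega>|?MM. f' i (?Z (fst \<omega>) (snd \<omega>)))"
      if "i \<in> I" for i
      using transfer[OF G'm[OF that]] f'int[OF that] by (simp_all only: G'V[OF that] G'W[OF that])
    \<comment> \<open>With the residuals frozen at \<open>x\<close>, the integrand depends on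
      \<open>U y\<close> alone, through a line of slope \<open>b i / v\<close>. The factor
      \<open>v\<close> from the one-dimensional identity cancels the denominator.\<close>
    have inner: "(LINT y|M. U y * f (?Z x y)) = (LINT y|M. (\<Sum>i\<in>I. b i * f' i (?Z x y)))" for x
    proof -
      define h where "h u = f (\<lambda>i. R i x + u * (b i / v))" for u
      define h' where "h' u = (\<Sum>i\<in>I. (b i / v) * f' i (\<lambda>i. R i x + u * (b i / v)))" for u
      define SR where "SR = (\<Sum>i\<in>I. \<bar>R i x\<bar>)"
      define Sb where "Sb = (\<Sum>i\<in>I. \<bar>b i / v\<bar>)"
      have gb: "A * exp (B * (\<Sum>i\<in>I. \<bar>R i x + u * (b i / v)\<bar>)) \<le> A * exp (B * SR) * exp (B * Sb * \<bar>u\<bar>)" for u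
      proof -
        have "(\<Sum>i\<in>I. \<bar>R i x + u * (b i / v)\<bar>) \<le> (\<Sum>i\<in>I. \<bar>R i x\<bar> + \<bar>b i / v\<bar> * \<bar>u\<bar>)"
          by (intro sum_mono order_trans[OF abs_triangle_ineq]) (simp add: abs_mult mult.commute)
        also have "\<dots> = SR + Sb * \<bar>u\<bar>" unfolding SR_def Sb_def by (simp add: sum.distrib sum_distrib_right)
        finally have "B * (\<Sum>i\<in>I. \<bar>R i x + u * (b i / v)\<bar>) \<le> B * SR + B * Sb * \<bar>u\<bar>"
          using mult_left_mono[OF _ B] by (fastforce simp: algebra_simps)
        then show ?thesis using A0 by (simp add: exp_add[symmetric] mult.assoc mult_left_mono)
      qed
      have "(LINT y|M. U y * h (U y)) = v * (LINT y|M. h' (U y))"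
      proof (rule stein_centered_gaussian[OF pM U chU, where A="A * exp (B * SR) * (1 + Sb)" and B="B * Sb"])
        show "(h has_real_derivative h' u) (at u)" for u unfolding h_def h'_def by (rule deriv)
        show "continuous_on UNIV h'" unfolding h'_def by (intro continuous_intros cont)
        have Sb0: "0 \<le> Sb" by (simp add: Sb_def sum_nonneg)
        have E0: "0 \<le> A * exp (B * SR) * exp (B * Sb * \<bar>u\<bar>)" for u using A0 by simp
        show "\<bar>h u\<bar> \<le> A * exp (B * SR) * (1 + Sb) * exp (B * Sb * \<bar>u\<bar>)" for u
        proof -
          have "\<bar>h u\<bar> \<le> A * exp (B * SR) * exp (B * Sb * \<bar>u\<bar>)" unfolding h_def by (rule order_trans[OF fb gb])
          also have "\<dots> \<le> A * exp (B * SR) * exp (B * Sb * \<bar>u\<bar>) + A * exp (B * SR) * exp (B * Sb * \<bar>u\<bar>) * Sb" using E0 Sb0 by simp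
          finally show ?thesis by (simp add: algebra_simps)
        qed
        show "\<bar>h' u\<bar> \<le> A * exp (B * SR) * (1 + Sb) * exp (B * Sb * \<bar>u\<bar>)" for u
        proof -
          have "\<bar>h' u\<bar> \<le> (\<Sum>i\<in>I. \<bar>b i / v\<bar> * (A * exp (B * SR) * exp (B * Sb * \<bar>u\<bar>)))" unfolding h'_def
            by (intro order_trans[OF sum_abs] sum_mono) (auto simp only: abs_mult intro!: mult_left_mono order_trans[OF f'b gb])
          also have "\<dots> = Sb * (A * exp (B * SR) * exp (B * Sb * \<bar>u\<bar>))" unfolding Sb_def sum_distrib_right ..
          also have "\<dots> \<le> A * exp (B * SR) * exp (B * Sb * \<bar>u\<bar>) + A * exp (B * SR) * exp (B * Sb * \<bar>u\<bar>) * Sb" using E0 Sb0 by simp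
          finally show ?thesis by (simp add: algebra_simps)
        qed
      qed
      also have "\<dots> = (LINT y|M. v * h' (U y))" by simp
      also have "\<dots> = (LINT y|M. (\<Sum>i\<in>I. b i * f' i (?Z x y)))"
        unfolding h'_def sum_distrib_left using v by (intro Bochner_Integration.integral_cong sum.cong) auto
      finally show ?thesis unfolding h_def .
    qed
    have "(LINT \<omega>|M. U \<omega> * f (\<lambda>i. Z i \<omega>)) = (LINT x|M. LINT y|M. U y * f (?Z x y))"
      unfolding tG(2) by (subst MM.integral_fst'[symmetric, OF tG(1)]) simp
    also have "\<dots> = (LINT x|M. LINT y|M. (\<Sum>i\<in>I. b i * f' i (?Z x y)))"
      unfolding inner ..
    also have "\<dots> = (LINT \<omega>|?MM. (\<Sum>i\<in>I. b i * f' i (?Z (fst \<omega>) (snd \<omega>))))"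
    proof (subst MM.integral_fst'[symmetric])
      show "integrable ?MM (\<lambda>\<omega>. (\<Sum>i\<in>I. b i * f' i (?Z (fst \<omega>) (snd \<omega>))))"
        by (intro Bochner_Integration.integrable_sum integrable_mult_right tG'(1))
    qed simp
    also have "\<dots> = (\<Sum>i\<in>I. b i * (LINT \<omega>|M. f' i (\<lambda>i. Z i \<omega>)))"
      by (subst Bochner_Integration.integral_sum)
        (intro integrable_mult_right tG'(1) sum.cong refl | assumption | simp only: integral_mult_right_zero tG'(2))+
    finally show ?thesis .
  qed
qed

section \<open>Gaussian comparison\<close>

text \<open>The exponential of a scaled log-sum-exp, that is, the p-norm of the vector with entries
  \<open>exp (z i)\<close>. In terms of \<open>exp\<close> and \<open>ln\<close> it can be
  differentiated directly.\<close>

definition lse :: "real \<Rightarrow> 'i set \<Rightarrow> ('i \<Rightarrow> real) \<Rightarrow> real" where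
  "lse p I z = exp (ln (\<Sum>i\<in>I. exp (p * z i)) / p)"

text \<open>These are the logarithmic partial derivatives of \<open>lse\<close>, and they form a
  probability vector on a finite nonempty \<open>I\<close>.\<close>

definition softmax :: "real \<Rightarrow> 'i set \<Rightarrow> ('i \<Rightarrow> real) \<Rightarrow> 'i \<Rightarrow> real" where
  "softmax p I z i = exp (p * z i) / (\<Sum>j\<in>I. exp (p * z j))"

section \<open>Calculus of the smoothed maximum\<close>

context
  fixes p :: real and I :: "'i set"
  assumes p: "p \<ge> 1" and fin: "finite I" and ne: "I \<noteq> {}"
begin

lemma sum_exp_pos: "(\<Sum>i\<in>I. exp (p * z i)) > 0"
  using fin ne by (intro sum_pos) auto

lemma softmax_nonneg: "softmax p I z i \<ge> 0"
  unfolding softmax_def using sum_exp_pos[of z] by simp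

lemma sum_softmax: "(\<Sum>i\<in>I. softmax p I z i) = 1"
  unfolding softmax_def using sum_exp_pos[of z] by (simp add: sum_divide_distrib[symmetric])

lemma softmax_le_1: "i \<in> I \<Longrightarrow> softmax p I z i \<le> 1"
  using member_le_sum[of i I "softmax p I z"] fin softmax_nonneg sum_softmax[of z] by auto

lemma lse_pos: "lse p I z > 0"
  by (simp add: lse_def)

lemma lse_has_derivative:
  assumes "\<And>i. i \<in> I \<Longrightarrow> (y i has_real_derivative y' i) (at t)"
  shows "((\<lambda>t. lse p I (\<lambda>i. y i t)) has_real_derivative
     (\<Sum>i\<in>I. y' i * (lse p I (\<lambda>i. y i t) * softmax p I (\<lambda>i. y i t) i))) (at t)"
proof -
  have d: "((\<lambda>t. \<Sum>i\<in>I. exp (p * y i t)) has_real_derivative (\<Sum>i\<in>I. exp (p * y i t) * (p * y' i))) (at t)"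
    using assms by (auto intro!: derivative_eq_intros simp: mult.commute)
  have "((\<lambda>t. lse p I (\<lambda>i. y i t)) has_real_derivative
     lse p I (\<lambda>i. y i t) * ((\<Sum>i\<in>I. exp (p * y i t) * (p * y' i)) / (\<Sum>i\<in>I. exp (p * y i t)) / p)) (at t)"
    unfolding lse_def
    by (rule DERIV_cong[OF DERIV_fun_exp[OF DERIV_cdivide[OF DERIV_chain2[OF DERIV_ln[OF sum_exp_pos] d]]]])
      (simp add: field_simps)
  also have "lse p I (\<lambda>i. y i t) * ((\<Sum>i\<in>I. exp (p * y i t) * (p * y' i)) / (\<Sum>i\<in>I. exp (p * y i t)) / p)
    = (\<Sum>i\<in>I. y' i * (lse p I (\<lambda>i. y i t) * softmax p I (\<lambda>i. y i t) i))"
    unfolding sum_divide_distrib sum_distrib_left softmax_def using p by (intro sum.cong) (auto simp: field_simps)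
  finally show ?thesis .
qed

lemma softmax_has_derivative:
  assumes "\<And>i. i \<in> I \<Longrightarrow> (y i has_real_derivative y' i) (at t)" and k: "k \<in> I"
  shows "((\<lambda>t. softmax p I (\<lambda>i. y i t) k) has_real_derivative
     p * softmax p I (\<lambda>i. y i t) k * (y' k - (\<Sum>i\<in>I. y' i * softmax p I (\<lambda>i. y i t) i))) (at t)"
proof -
  have d: "((\<lambda>t. \<Sum>i\<in>I. exp (p * y i t)) has_real_derivative (\<Sum>i\<in>I. exp (p * y i t) * (p * y' i))) (at t)"
    using assms by (auto intro!: derivative_eq_intros simp: mult.commute)
  have dk: "((\<lambda>t. exp (p * y k t)) has_real_derivative (exp (p * y k t) * (p * y' k))) (at t)"
    using assms by (auto intro!: derivative_eq_intros)
  have S: "(\<Sum>i\<in>I. exp (p * y i t)) > 0" by (rule sum_exp_pos)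
  have e: "(\<Sum>i\<in>I. y' i * softmax p I (\<lambda>i. y i t) i) = (\<Sum>i\<in>I. exp (p * y i t) * (p * y' i)) / (\<Sum>i\<in>I. exp (p * y i t)) / p"
    unfolding sum_divide_distrib sum_distrib_left softmax_def using p by (intro sum.cong) (auto simp: field_simps)
  show ?thesis
    unfolding e unfolding softmax_def
    by (rule DERIV_cong[OF DERIV_divide[OF dk d]]) (use S p in \<open>auto simp: field_simps\<close>)
qed

text \<open>Since \<open>lse * softmax\<close> is the gradient of \<open>lse\<close>, the factors of
  \<open>y' i\<close> are entries of its Hessian. Writing \<open>s\<close> for the softmax vector,
  the product rule contributes \<open>s i * s k\<close> from the first factor and
  \<open>p * s k * (e - s i)\<close> from the second, where \<open>e\<close> is 1 if
  \<open>i = k\<close> and 0 otherwise.\<close>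

lemma lse_softmax_has_derivative:
  assumes "\<And>i. i \<in> I \<Longrightarrow> (y i has_real_derivative y' i) (at t)" and k: "k \<in> I"
  shows "((\<lambda>t. lse p I (\<lambda>i. y i t) * softmax p I (\<lambda>i. y i t) k) has_real_derivative
     (\<Sum>i\<in>I. y' i * (lse p I (\<lambda>i. y i t) * ((if i = k then p * softmax p I (\<lambda>i. y i t) k else 0)
        - (p - 1) * softmax p I (\<lambda>i. y i t) i * softmax p I (\<lambda>i. y i t) k)))) (at t)"
proof -
  define l where "l = lse p I (\<lambda>i. y i t)"
  define s where "s = softmax p I (\<lambda>i. y i t)"
  have "(\<Sum>i\<in>I. y' i * (l * ((if i = k then p * s k else 0) - (p - 1) * s i * s k)))
    = (\<Sum>i\<in>I. (if i = k then y' k * l * p * s k else 0)) - l * (p - 1) * s k * (\<Sum>i\<in>I. y' i * s i)"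
    unfolding sum_distrib_left sum_subtractf[symmetric] by (intro sum.cong) (auto simp: algebra_simps)
  also have "(\<Sum>i\<in>I. (if i = k then y' k * l * p * s k else 0)) = y' k * l * p * s k" using fin k by simp
  finally have e: "(\<Sum>i\<in>I. y' i * (l * ((if i = k then p * s k else 0) - (p - 1) * s i * s k)))
    = y' k * l * p * s k - l * (p - 1) * s k * (\<Sum>i\<in>I. y' i * s i)" .
  have e2: "(\<Sum>i\<in>I. y' i * (l * s i)) = l * (\<Sum>i\<in>I. y' i * s i)"
    unfolding sum_distrib_left by (intro sum.cong) auto
  have "((\<lambda>t. lse p I (\<lambda>i. y i t) * softmax p I (\<lambda>i. y i t) k) has_real_derivative
      (y' k * l * p * s k - l * (p - 1) * s k * (\<Sum>i\<in>I. y' i * s i))) (at t)"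
  proof (rule DERIV_cong[OF DERIV_mult])
    show "((\<lambda>t. lse p I (\<lambda>i. y i t)) has_real_derivative l * (\<Sum>i\<in>I. y' i * s i)) (at t)"
      unfolding e2[symmetric] unfolding l_def s_def by (rule lse_has_derivative) (rule assms)
    show "((\<lambda>t. softmax p I (\<lambda>i. y i t) k) has_real_derivative p * s k * (y' k - (\<Sum>i\<in>I. y' i * s i))) (at t)"
      unfolding s_def by (rule softmax_has_derivative) (use assms in auto)
    show "l * (\<Sum>i\<in>I. y' i * s i) * softmax p I (\<lambda>i. y i t) k + p * s k * (y' k - (\<Sum>i\<in>I. y' i * s i)) * lse p I (\<lambda>i. y i t)
      = y' k * l * p * s k - l * (p - 1) * s k * (\<Sum>i\<in>I. y' i * s i)"
      unfolding l_def[symmetric] s_def[symmetric] by algebra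
  qed
  then show ?thesis unfolding e[symmetric] unfolding l_def s_def .
qed

text \<open>Separates a deterministic constant from the exponential of the fluctuations
  \<open>x i\<close>. This provides the growth bounds for integration by parts and the domination
  over all angles of the interpolation.\<close>

lemma lse_bound:
  assumes "\<And>i. i \<in> I \<Longrightarrow> z i \<le> x i + E i" "\<And>i. i \<in> I \<Longrightarrow> 0 \<le> x i"
  shows "lse p I z \<le> exp (ln (\<Sum>i\<in>I. exp (p * E i)) / p) * exp (\<Sum>i\<in>I. x i)"
proof -
  have "(\<Sum>i\<in>I. exp (p * z i)) \<le> (\<Sum>i\<in>I. exp (p * E i) * exp (p * (\<Sum>i\<in>I. x i)))"
  proof (rule sum_mono)
    fix i assume i: "i \<in> I"
    have "x i \<le> (\<Sum>i\<in>I. x i)" by (rule member_le_sum[OF i]) (use assms fin in auto)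
    with assms(1)[OF i] have "z i \<le> E i + (\<Sum>i\<in>I. x i)" by linarith
    then have "p * z i \<le> p * E i + p * (\<Sum>i\<in>I. x i)" using p by (simp add: distrib_left[symmetric])
    then show "exp (p * z i) \<le> exp (p * E i) * exp (p * (\<Sum>i\<in>I. x i))" by (simp add: exp_add[symmetric])
  qed
  then have "(\<Sum>i\<in>I. exp (p * z i)) \<le> (\<Sum>i\<in>I. exp (p * E i)) * exp (p * (\<Sum>i\<in>I. x i))" by (simp only: sum_distrib_right)
  then have "ln (\<Sum>i\<in>I. exp (p * z i)) \<le> ln ((\<Sum>i\<in>I. exp (p * E i)) * exp (p * (\<Sum>i\<in>I. x i)))"
    by (rule ln_mono[OF _ sum_exp_pos])
  also have "\<dots> = ln (\<Sum>i\<in>I. exp (p * E i)) + p * (\<Sum>i\<in>I. x i)"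
    using sum_exp_pos[of E] by (simp add: ln_mult)
  finally have "ln (\<Sum>i\<in>I. exp (p * z i)) / p \<le> ln (\<Sum>i\<in>I. exp (p * E i)) / p + (\<Sum>i\<in>I. x i)"
    using p by (simp add: field_simps)
  then show ?thesis unfolding lse_def by (simp add: exp_add[symmetric])
qed

lemma lse_ge_Max: "Max ((\<lambda>i. exp (z i)) ` I) \<le> lse p I z"
proof -
  have "exp (z i) \<le> lse p I z" if "i \<in> I" for i
  proof -
    have "exp (p * z i) \<le> (\<Sum>i\<in>I. exp (p * z i))" by (rule member_le_sum[OF that]) (use fin in auto)
    then have "p * z i \<le> ln (\<Sum>i\<in>I. exp (p * z i))" using ln_ge_iff[OF sum_exp_pos] by blast
    then show ?thesis unfolding lse_def using p by (simp add: field_simps)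
  qed
  then show ?thesis using fin ne by (auto intro!: Max.boundedI)
qed

text \<open>The factor is the \<open>p\<close>-th root of \<open>card I\<close>, which tends to 1;
  together with \<open>lse_ge_Max\<close> this removes the smoothing as \<open>p\<close>
  grows.\<close>

lemma lse_le_Max: "lse p I z \<le> exp (ln (card I) / p) * Max ((\<lambda>i. exp (z i)) ` I)"
proof -
  have "Max ((\<lambda>i. exp (z i)) ` I) \<in> (\<lambda>i. exp (z i)) ` I" using fin ne by (intro Max_in) auto
  then obtain m where m: "m \<in> I" "Max ((\<lambda>i. exp (z i)) ` I) = exp (z m)" by auto
  have le: "z i \<le> z m" if "i \<in> I" for i
  proof -
    have "exp (z i) \<le> Max ((\<lambda>i. exp (z i)) ` I)" using that fin by (intro Max_ge) auto
    then show ?thesis by (simp add: m)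
  qed
  have "(\<Sum>i\<in>I. exp (p * z i)) \<le> card I * exp (p * z m)"
    using sum_bounded_above[of I "\<lambda>i. exp (p * z i)" "exp (p * z m)"] le p by simp
  then have "ln (\<Sum>i\<in>I. exp (p * z i)) \<le> ln (card I * exp (p * z m))" by (rule ln_mono[OF _ sum_exp_pos])
  also have "\<dots> = ln (card I) + p * z m" using fin ne by (subst ln_mult) (auto simp: card_gt_0_iff)
  finally have "ln (\<Sum>i\<in>I. exp (p * z i)) / p \<le> ln (card I) / p + z m" using p by (simp add: field_simps)
  then show ?thesis unfolding m lse_def by (simp add: exp_add[symmetric])
qed

end

text \<open>Joint normality is encoded by the characteristic function so that \<open>K\<close> may
  be singular: every grid contains time 0, where the variance is 0, and the linear process has a
  covariance of rank one.\<close>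

definition gaussian_vector :: "'a measure \<Rightarrow> 'i set \<Rightarrow> ('i \<Rightarrow> 'a \<Rightarrow> real) \<Rightarrow> ('i \<Rightarrow> 'i \<Rightarrow> real) \<Rightarrow> bool" where
  "gaussian_vector M I X K \<longleftrightarrow> prob_space M \<and> finite I \<and> (\<forall>i\<in>I. X i \<in> borel_measurable M) \<and>
     (\<forall>i\<in>I. \<forall>j\<in>I. K i j = K j i) \<and>
     (\<forall>c. (CLINT \<omega>|M. iexp (\<Sum>i\<in>I. c i * X i \<omega>)) = of_real (exp (- (\<Sum>i\<in>I. \<Sum>j\<in>I. c i * c j * K i j) / 2)))"

lemma gaussian_vector_component:
  assumes "gaussian_vector M I X K" "i \<in> I"
  shows "(CLINT \<omega>|M. iexp (t * X i \<omega>)) = of_real (exp (- (t\<^sup>2 * K i i) / 2))"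
proof -
  have fin: "finite I" using assms by (auto simp: gaussian_vector_def)
  define c where "c j = (if j = i then t else 0)" for j
  have "(\<Sum>j\<in>I. c j * X j \<omega>) = t * X i \<omega>" for \<omega>
    using fin assms(2) by (simp add: c_def if_distrib[of "\<lambda>x. x * _"] cong: if_cong)
  moreover have "(\<Sum>j\<in>I. \<Sum>k\<in>I. c j * c k * K j k) = (\<Sum>j\<in>I. (if j = i then t\<^sup>2 * K i i else 0))"
  proof (rule sum.cong[OF refl])
    fix j
    have "(\<Sum>k\<in>I. c j * c k * K j k) = (\<Sum>k\<in>I. if k = i then c j * t * K j i else 0)"
      by (intro sum.cong) (auto simp: c_def)
    then show "(\<Sum>k\<in>I. c j * c k * K j k) = (if j = i then t\<^sup>2 * K i i else 0)"
      using fin assms(2) by (simp add: c_def power2_eq_square)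
  qed
  moreover have "(CLINT \<omega>|M. iexp (\<Sum>i\<in>I. c i * X i \<omega>)) = of_real (exp (- (\<Sum>i\<in>I. \<Sum>j\<in>I. c i * c j * K i j) / 2))"
    using assms(1) unfolding gaussian_vector_def by blast
  moreover have "(\<Sum>j\<in>I. (if j = i then t\<^sup>2 * K i i else 0)) = t\<^sup>2 * K i i" using fin assms(2) by simp
  ultimately show ?thesis by (simp only:)
qed

text \<open>The form is evaluated at \<open>a\<close> times the unit vector of \<open>i\<close> plus
  \<open>s * c\<close>. The outcome is the pattern in \<open>a\<close> from which integration by
  parts reads off its variance \<open>v\<close> and its covariances \<open>b\<close>.\<close>

lemma quadratic_form_add_unit:
  fixes K :: "'i \<Rightarrow> 'i \<Rightarrow> real"
  assumes "finite I" "i \<in> I" and sym: "\<And>j k. j \<in> I \<Longrightarrow> k \<in> I \<Longrightarrow> K j k = K k j"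
  shows "(\<Sum>j\<in>I. \<Sum>k\<in>I. ((if j = i then a else 0) + s * c j) * ((if k = i then a else 0) + s * c k) * K j k)
    = a\<^sup>2 * K i i + 2 * a * s * (\<Sum>j\<in>I. c j * K i j) + s\<^sup>2 * (\<Sum>j\<in>I. \<Sum>k\<in>I. c j * c k * K j k)"
proof -
  have "(\<Sum>k\<in>I. ((if j = i then a else 0) + s * c j) * ((if k = i then a else 0) + s * c k) * K j k)
    = (if j = i then a\<^sup>2 * K i i else 0) + a * s * (c j * K j i) + (if j = i then a * s * (\<Sum>k\<in>I. c k * K i k) else 0)
       + s\<^sup>2 * (\<Sum>k\<in>I. c j * c k * K j k)" if j: "j \<in> I" for j
  proof -
    have "(\<Sum>k\<in>I. ((if j = i then a else 0) + s * c j) * ((if k = i then a else 0) + s * c k) * K j k)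
      = (\<Sum>k\<in>I. (if k = i then ((if j = i then a else 0) + s * c j) * a * K j i else 0)
           + ((if j = i then a * s * (c k * K i k) else 0) + s\<^sup>2 * (c j * c k * K j k)))"
      by (intro sum.cong) (auto simp: algebra_simps power2_eq_square)
    also have "\<dots> = ((if j = i then a else 0) + s * c j) * a * K j i + ((\<Sum>k\<in>I. if j = i then a * s * (c k * K i k) else 0) + s\<^sup>2 * (\<Sum>k\<in>I. c j * c k * K j k))"
      using assms(1,2) by (simp add: sum.distrib sum_distrib_left)
    finally show ?thesis by (auto simp: sum_distrib_left algebra_simps power2_eq_square)
  qed
  then have "(\<Sum>j\<in>I. \<Sum>k\<in>I. ((if j = i then a else 0) + s * c j) * ((if k = i then a else 0) + s * c k) * K j k)
    = (\<Sum>j\<in>I. (if j = i then a\<^sup>2 * K i i else 0) + a * s * (c j * K j i) + (if j = i then a * s * (\<Sum>k\<in>I. c k * K i k) else 0)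
       + s\<^sup>2 * (\<Sum>k\<in>I. c j * c k * K j k))" by (intro sum.cong) auto
  also have "\<dots> = a\<^sup>2 * K i i + a * s * (\<Sum>j\<in>I. c j * K j i) + a * s * (\<Sum>k\<in>I. c k * K i k) + s\<^sup>2 * (\<Sum>j\<in>I. \<Sum>k\<in>I. c j * c k * K j k)"
    using assms(1,2) by (simp add: sum.distrib sum_distrib_left)
  also have "(\<Sum>j\<in>I. c j * K j i) = (\<Sum>j\<in>I. c j * K i j)" using sym assms(2) by (intro sum.cong) auto
  finally show ?thesis by (simp add: algebra_simps)
qed

lemma integral_iexp_pair:
  assumes "prob_space M" "prob_space N" "F \<in> borel_measurable M" "H \<in> borel_measurable N"
  shows "(CLINT \<omega>|(M \<Otimes>\<^sub>M N). iexp (F (fst \<omega>) + H (snd \<omega>))) = (CLINT x|M. iexp (F x)) * (CLINT y|N. iexp (H y))"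
proof -
  interpret M: prob_space M by fact
  interpret N: prob_space N by fact
  interpret P: pair_prob_space M N ..
  note [measurable] = assms(3,4)
  have "(CLINT \<omega>|(M \<Otimes>\<^sub>M N). iexp (F (fst \<omega>) + H (snd \<omega>))) = (CLINT x|M. CLINT y|N. iexp (F x + H y))"
    by (subst P.integral_fst'[symmetric])
       (auto intro!: integrable_bounded_complex[OF P.prob_space_axioms, where B=1] simp del: of_real_add)
  also have "\<dots> = (CLINT x|M. CLINT y|N. iexp (F x) * iexp (H y))"
    by (simp add: exp_add[symmetric] distrib_left)
  also have "\<dots> = (CLINT x|M. iexp (F x)) * (CLINT y|N. iexp (H y))"
    by (simp only: integral_mult_right_zero integral_mult_left_zero)
  finally show ?thesis .
qed

lemma integrable_pair_fst:
  fixes f :: "'a \<Rightarrow> real"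
  assumes "prob_space M" "prob_space N" "integrable M f"
  shows "integrable (M \<Otimes>\<^sub>M N) (\<lambda>\<omega>. f (fst \<omega>))"
proof -
  interpret N: prob_space N by fact
  have "integrable (distr (M \<Otimes>\<^sub>M N) M fst) f" using assms(3) by (simp add: N.distr_pair_fst)
  then show ?thesis by (rule integrable_distr[OF measurable_fst])
qed

lemma integrable_pair_snd:
  fixes f :: "'b \<Rightarrow> real"
  assumes "prob_space M" "prob_space N" "integrable N f"
  shows "integrable (M \<Otimes>\<^sub>M N) (\<lambda>\<omega>. f (snd \<omega>))"
proof -
  interpret M: prob_space M by fact
  interpret N: prob_space N by fact
  interpret Q: pair_prob_space N M ..
  have "integrable (N \<Otimes>\<^sub>M M) (\<lambda>\<omega>. f (fst \<omega>))" by (rule integrable_pair_fst) fact+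
  from Q.integrable_product_swap[OF this] show ?thesis by (simp add: split_beta')
qed

section \<open>Interpolation between two Gaussian vectors\<close>

lemma lse_shift_bound:
  assumes "p \<ge> 1" "finite I" "I \<noteq> {}"
  shows "lse p I (\<lambda>i. z i - e i) \<le> exp (ln (\<Sum>i\<in>I. exp (p * \<bar>e i\<bar>)) / p) * exp (\<Sum>i\<in>I. \<bar>z i\<bar>)"
  by (rule lse_bound[OF assms]) auto

text \<open>Total weight 1 lets each diagonal entry be averaged over the other index as well. This
  is the point where variances and covariances cease to matter separately and only the variogram of
  \<open>D\<close> remains.\<close>

lemma sum_variogram:
  fixes q :: "'i \<Rightarrow> real"
  assumes "(\<Sum>i\<in>I. q i) = 1"
  shows "(\<Sum>i\<in>I. \<Sum>j\<in>I. q i * q j * (D i i + D j j - 2 * D i j)) = 2 * ((\<Sum>i\<in>I. D i i * q i) - (\<Sum>i\<in>I. \<Sum>j\<in>I. D i j * q i * q j))"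
proof -
  have "(\<Sum>i\<in>I. \<Sum>j\<in>I. q i * q j * (D i i + D j j - 2 * D i j)) 
     = (\<Sum>i\<in>I. D i i * q i * (\<Sum>j\<in>I. q j)) + (\<Sum>i\<in>I. q i * (\<Sum>j\<in>I. D j j * q j)) - 2 * (\<Sum>i\<in>I. \<Sum>j\<in>I. D i j * q i * q j)"
    unfolding sum_distrib_left sum.distrib[symmetric] sum_subtractf[symmetric]
    by (intro sum.cong) (auto simp: algebra_simps)
  then show ?thesis using assms by (simp add: sum_distrib_right[symmetric])
qed

text \<open>The Hessian puts coefficient \<open>p\<close> on the diagonal sum and
  \<open>p - 1\<close> on the full quadratic form. The drift, half the variance differentiated along
  the path, lowers the former to \<open>p - 1\<close> as well, and with equal coefficients
  \<open>sum_variogram\<close> applies.\<close>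

lemma interpolation_integrand_eq:
  fixes q :: "'i \<Rightarrow> real"
  assumes "finite I" "(\<Sum>i\<in>I. q i) = 1"
  shows "(\<Sum>i\<in>I. (\<Sum>j\<in>I. (r * D i j) * (g * ((if j = i then p * q i else 0) - (p - 1) * q j * q i))) - r * D i i * (g * q i))
     = r * (p - 1) * g / 2 * (\<Sum>i\<in>I. \<Sum>j\<in>I. q i * q j * (D i i + D j j - 2 * D i j))"
proof -
  have "(\<Sum>i\<in>I. (\<Sum>j\<in>I. (r * D i j) * (g * ((if j = i then p * q i else 0) - (p - 1) * q j * q i))) - r * D i i * (g * q i))
    = (\<Sum>i\<in>I. (\<Sum>j\<in>I. (if j = i then r * g * p * D i i * q i else 0)) - r * (p - 1) * g * (\<Sum>j\<in>I. D i j * q i * q j) - r * g * (D i i * q i))"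
    unfolding sum_distrib_left sum_subtractf[symmetric] by (intro sum.cong arg_cong2[where f="(-)"]) (auto simp: algebra_simps)
  also have "\<dots> = (\<Sum>i\<in>I. r * (p - 1) * g * (D i i * q i) - r * (p - 1) * g * (\<Sum>j\<in>I. D i j * q i * q j))"
    using assms(1) by (intro sum.cong) (auto simp: algebra_simps)
  also have "\<dots> = r * (p - 1) * g * ((\<Sum>i\<in>I. D i i * q i) - (\<Sum>i\<in>I. \<Sum>j\<in>I. D i j * q i * q j))"
    by (simp add: sum_subtractf sum_distrib_left right_diff_distrib)
  finally show ?thesis unfolding sum_variogram[OF assms(2)] by simp
qed

lemma gaussian_vector_integrable_exp:
  assumes X: "gaussian_vector M I X K" and C: "0 \<le> C"
  shows "integrable M (\<lambda>\<omega>. exp (C * (\<Sum>i\<in>I. \<bar>X i \<omega>\<bar>)))"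
proof (rule integrable_exp_sum_abs)
  fix i a assume i: "i \<in> I"
  then show "integrable M (\<lambda>\<omega>. exp (a * \<bar>X i \<omega>\<bar>))"
    using X by (intro integrable_exp_abs_centered_gaussian[OF _ _ gaussian_vector_component[OF X]]) (auto simp: gaussian_vector_def)
qed (use X C in \<open>auto simp: gaussian_vector_def\<close>)

lemma gaussian_vector_integrable_lse:
  assumes X: "gaussian_vector M I X K" and p: "p \<ge> 1" and ne: "I \<noteq> {}"
  shows "integrable M (\<lambda>\<omega>. lse p I (\<lambda>i. X i \<omega> - e i))"
proof (rule Bochner_Integration.integrable_bound)
  have fin: "finite I" and [measurable]: "\<And>i. i \<in> I \<Longrightarrow> X i \<in> borel_measurable M" using X by (auto simp: gaussian_vector_def)
  show "integrable M (\<lambda>\<omega>. exp (ln (\<Sum>i\<in>I. exp (p * \<bar>e i\<bar>)) / p) * exp (1 * (\<Sum>i\<in>I. \<bar>X i \<omega>\<bar>)))"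
    by (intro integrable_mult_right gaussian_vector_integrable_exp[OF X]) simp
  show "AE \<omega> in M. norm (lse p I (\<lambda>i. X i \<omega> - e i)) \<le> norm (exp (ln (\<Sum>i\<in>I. exp (p * \<bar>e i\<bar>)) / p) * exp (1 * (\<Sum>i\<in>I. \<bar>X i \<omega>\<bar>)))"
    using lse_shift_bound[OF p fin ne] lse_pos[OF p fin ne] by (auto simp: less_imp_le)
  show "(\<lambda>\<omega>. lse p I (\<lambda>i. X i \<omega> - e i)) \<in> borel_measurable M" unfolding lse_def by measurable
qed

text \<open>The half-variances are part of the path and move with the angle, whereas the offset
  \<open>d i\<close> is common to both vectors and drops out on differentiation. It is therefore
  arbitrary here, and later carries the penalty with factor \<open>R\<close>.\<close>

lemma lse_comparison:
  assumes X: "gaussian_vector M I X K" and W: "gaussian_vector N I W L" and ne: "I \<noteq> {}" and p: "p \<ge> 1"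
    and V: "\<And>i j. i \<in> I \<Longrightarrow> j \<in> I \<Longrightarrow> L i i + L j j - 2 * L i j \<le> K i i + K j j - 2 * K i j"
  shows "(LINT \<omega>|N. lse p I (\<lambda>i. W i \<omega> - (L i i / 2 + d i))) \<le> (LINT \<omega>|M. lse p I (\<lambda>i. X i \<omega> - (K i i / 2 + d i)))"
proof -
  have pM: "prob_space M" and pN: "prob_space N" and fin: "finite I" 
    and Xm[measurable]: "\<And>i. i \<in> I \<Longrightarrow> X i \<in> borel_measurable M"
    and Wm[measurable]: "\<And>i. i \<in> I \<Longrightarrow> W i \<in> borel_measurable N"
    and Ksym: "\<And>i j. i \<in> I \<Longrightarrow> j \<in> I \<Longrightarrow> K i j = K j i" and Lsym: "\<And>i j. i \<in> I \<Longrightarrow> j \<in> I \<Longrightarrow> L i j = L j i"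
    and Xch: "\<And>c. (CLINT \<omega>|M. iexp (\<Sum>i\<in>I. c i * X i \<omega>)) = of_real (exp (- (\<Sum>i\<in>I. \<Sum>j\<in>I. c i * c j * K i j) / 2))"
    and Wch: "\<And>c. (CLINT \<omega>|N. iexp (\<Sum>i\<in>I. c i * W i \<omega>)) = of_real (exp (- (\<Sum>i\<in>I. \<Sum>j\<in>I. c i * c j * L i j) / 2))"
    using X W unfolding gaussian_vector_def by blast+
  interpret M: prob_space M by fact
  interpret N: prob_space N by fact
  interpret P: pair_prob_space M N ..
  interpret PL: pair_sigma_finite "M \<Otimes>\<^sub>M N" lborel ..
  note lsesimps = sum_exp_pos[OF p fin ne]
  have iX: "integrable M (\<lambda>\<omega>. exp (a * \<bar>X i \<omega>\<bar>))" if "i \<in> I" for a i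
    by (rule integrable_exp_abs_centered_gaussian[OF pM Xm[OF that] gaussian_vector_component[OF X that]])
  have iW: "integrable N (\<lambda>\<omega>. exp (a * \<bar>W i \<omega>\<bar>))" if "i \<in> I" for a i
    by (rule integrable_exp_abs_centered_gaussian[OF pN Wm[OF that] gaussian_vector_component[OF W that]])
  define SX where "SX \<omega> = (\<Sum>i\<in>I. \<bar>X i \<omega>\<bar>)" for \<omega>
  define SW where "SW \<omega> = (\<Sum>i\<in>I. \<bar>W i \<omega>\<bar>)" for \<omega>
  note iSX = gaussian_vector_integrable_exp[OF X, folded SX_def] and iSW = gaussian_vector_integrable_exp[OF W, folded SW_def]
  note intM = gaussian_vector_integrable_lse[OF X p ne, of "\<lambda>i. K i i / 2 + d i"]
   and intN = gaussian_vector_integrable_lse[OF W p ne, of "\<lambda>i. L i i / 2 + d i"]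
  define D where "D i j = K i j - L i j" for i j
  \<comment> \<open>\<open>X\<close> and \<open>W\<close> live on different factors of a product
    space and are thus independent: \<open>Z \<theta>\<close> has covariance \<open>(sin
    \<theta>)\<^sup>2 * K i j + (cos \<theta>)\<^sup>2 * L i j\<close>, and
    \<open>e \<theta> i\<close> contains half its diagonal. \<open>U \<theta>\<close> is the
    derivative of \<open>Z \<theta>\<close> in the angle; its covariance with
    \<open>Z \<theta>\<close> is \<open>sin \<theta> * cos \<theta> * D i j\<close>.\<close>
  define e where "e \<theta> i = ((sin \<theta>)\<^sup>2 * K i i + (cos \<theta>)\<^sup>2 * L i i) / 2 + d i" for \<theta> i
  define Z where "Z \<theta> i \<omega> = sin \<theta> * X i (fst \<omega>) + cos \<theta> * W i (snd \<omega>)" for \<theta> i and \<omega> :: "'a \<times> 'c"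
  define U where "U \<theta> i \<omega> = cos \<theta> * X i (fst \<omega>) - sin \<theta> * W i (snd \<omega>)" for \<theta> i and \<omega> :: "'a \<times> 'c"
  define y where "y \<theta> \<omega> i = Z \<theta> i \<omega> - e \<theta> i" for \<theta> i \<omega>
  define y' where "y' \<theta> \<omega> i = U \<theta> i \<omega> - sin \<theta> * cos \<theta> * D i i" for \<theta> i \<omega>
  define G where "G \<theta> \<omega> = lse p I (y \<theta> \<omega>)" for \<theta> \<omega>
  define \<phi> where "\<phi> \<theta> \<omega> = (\<Sum>i\<in>I. y' \<theta> \<omega> i * (G \<theta> \<omega> * softmax p I (y \<theta> \<omega>) i))" for \<theta> \<omega>
  let ?P = "M \<Otimes>\<^sub>M N"
  let ?s = "\<lambda>\<theta> \<omega>. softmax p I (y \<theta> \<omega>)"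
  let ?H = "\<lambda>\<theta> i j \<omega>. G \<theta> \<omega> * ((if j = i then p * ?s \<theta> \<omega> i else 0) - (p - 1) * ?s \<theta> \<omega> j * ?s \<theta> \<omega> i)"
  have Zm: "Z \<theta> i \<in> borel_measurable ?P" and Um: "U \<theta> i \<in> borel_measurable ?P" if "i \<in> I" for \<theta> i
    using that unfolding Z_def[abs_def] U_def[abs_def] by measurable
  have abs_lin: "\<bar>sin \<theta> * a + cos \<theta> * b\<bar> \<le> \<bar>a\<bar> + \<bar>b\<bar>" "\<bar>cos \<theta> * a - sin \<theta> * b\<bar> \<le> \<bar>a\<bar> + \<bar>b\<bar>" for \<theta> a b :: real
  proof -
    have "\<bar>sin \<theta>\<bar> * \<bar>x\<bar> \<le> 1 * \<bar>x\<bar>" "\<bar>cos \<theta>\<bar> * \<bar>x\<bar> \<le> 1 * \<bar>x\<bar>" for x by (intro mult_right_mono; simp)+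
    then have *: "\<bar>sin \<theta> * x\<bar> \<le> \<bar>x\<bar>" "\<bar>cos \<theta> * x\<bar> \<le> \<bar>x\<bar>" for x by (auto simp: abs_mult)
    show "\<bar>sin \<theta> * a + cos \<theta> * b\<bar> \<le> \<bar>a\<bar> + \<bar>b\<bar>" "\<bar>cos \<theta> * a - sin \<theta> * b\<bar> \<le> \<bar>a\<bar> + \<bar>b\<bar>"
      using *(1)[of a] *(2)[of b] *(2)[of a] *(1)[of b] by linarith+
  qed
  have iZ: "integrable ?P (\<lambda>\<omega>. exp (a * \<bar>Z \<theta> i \<omega>\<bar>))" if i: "i \<in> I" for a \<theta> i
  proof (rule Bochner_Integration.integrable_bound)
    show "integrable ?P (\<lambda>\<omega>. exp (2 * \<bar>a\<bar> * \<bar>X i (fst \<omega>)\<bar>) + exp (2 * \<bar>a\<bar> * \<bar>W i (snd \<omega>)\<bar>))"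
      using integrable_pair_fst[OF pM pN iX[OF i, of "2 * \<bar>a\<bar>"]] integrable_pair_snd[OF pM pN iW[OF i, of "2 * \<bar>a\<bar>"]] by auto
    have "exp (a * \<bar>Z \<theta> i \<omega>\<bar>) \<le> exp (2 * \<bar>a\<bar> * \<bar>X i (fst \<omega>)\<bar>) + exp (2 * \<bar>a\<bar> * \<bar>W i (snd \<omega>)\<bar>)" for \<omega>
    proof -
      have "a * \<bar>Z \<theta> i \<omega>\<bar> \<le> \<bar>a\<bar> * \<bar>Z \<theta> i \<omega>\<bar>" by (intro mult_right_mono) auto
      also have "\<dots> \<le> \<bar>a\<bar> * (\<bar>X i (fst \<omega>)\<bar> + \<bar>W i (snd \<omega>)\<bar>)" unfolding Z_def by (intro mult_left_mono abs_lin) auto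
      finally have "exp (a * \<bar>Z \<theta> i \<omega>\<bar>) \<le> exp (\<bar>a\<bar> * \<bar>X i (fst \<omega>)\<bar> + \<bar>a\<bar> * \<bar>W i (snd \<omega>)\<bar>)" by (simp add: distrib_left)
      also note exp_add_le_sum
      finally show ?thesis by (simp add: mult.assoc)
    qed
    then show "AE \<omega> in ?P. norm (exp (a * \<bar>Z \<theta> i \<omega>\<bar>)) \<le> norm (exp (2 * \<bar>a\<bar> * \<bar>X i (fst \<omega>)\<bar>) + exp (2 * \<bar>a\<bar> * \<bar>W i (snd \<omega>)\<bar>))"
      by (auto intro!: AE_I2 order_trans[OF _ abs_ge_self])
  qed (use Zm[OF i] in auto)
  have ch: "(CLINT \<omega>|?P. iexp (a * U \<theta> i \<omega> + (\<Sum>j\<in>I. c j * Z \<theta> j \<omega>)))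
     = of_real (exp (- (a\<^sup>2 * ((cos \<theta>)\<^sup>2 * K i i + (sin \<theta>)\<^sup>2 * L i i) + 2 * a * (\<Sum>j\<in>I. c j * (sin \<theta> * cos \<theta> * D i j))
        + ((sin \<theta>)\<^sup>2 * (\<Sum>j\<in>I. \<Sum>k\<in>I. c j * c k * K j k) + (cos \<theta>)\<^sup>2 * (\<Sum>j\<in>I. \<Sum>k\<in>I. c j * c k * L j k))) / 2))"
    if i: "i \<in> I" for \<theta> a c i
  proof -
    define u where "u j = (if j = i then a * cos \<theta> else 0) + sin \<theta> * c j" for j
    define w where "w j = (if j = i then - a * sin \<theta> else 0) + cos \<theta> * c j" for j
    have del: "(\<Sum>j\<in>I. (if j = i then r else 0) * g j) = r * g i" for r and g :: "_ \<Rightarrow> real"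
    proof -
      have "(\<Sum>j\<in>I. (if j = i then r else 0) * g j) = (\<Sum>j\<in>I. if j = i then r * g i else 0)" by (intro sum.cong) auto
      then show ?thesis using fin i by simp
    qed
    have sp: "a * U \<theta> i \<omega> + (\<Sum>j\<in>I. c j * Z \<theta> j \<omega>) = (\<Sum>j\<in>I. u j * X j (fst \<omega>)) + (\<Sum>j\<in>I. w j * W j (snd \<omega>))" for \<omega>
      unfolding u_def w_def distrib_right sum.distrib del U_def Z_def
      by (simp add: algebra_simps sum.distrib sum_distrib_left)
    have "(CLINT \<omega>|?P. iexp (a * U \<theta> i \<omega> + (\<Sum>j\<in>I. c j * Z \<theta> j \<omega>)))
      = (CLINT x|M. iexp (\<Sum>j\<in>I. u j * X j x)) * (CLINT x|N. iexp (\<Sum>j\<in>I. w j * W j x))"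
      unfolding sp by (rule integral_iexp_pair[OF pM pN]) auto
    also have "\<dots> = of_real (exp (- ((\<Sum>j\<in>I. \<Sum>k\<in>I. u j * u k * K j k) + (\<Sum>j\<in>I. \<Sum>k\<in>I. w j * w k * L j k)) / 2))"
      unfolding Xch Wch of_real_mult[symmetric] exp_add[symmetric] by (simp add: add_divide_distrib)
    also have "(\<Sum>j\<in>I. \<Sum>k\<in>I. u j * u k * K j k) = (a * cos \<theta>)\<^sup>2 * K i i + 2 * (a * cos \<theta>) * sin \<theta> * (\<Sum>j\<in>I. c j * K i j) + (sin \<theta>)\<^sup>2 * (\<Sum>j\<in>I. \<Sum>k\<in>I. c j * c k * K j k)"
      unfolding u_def by (rule quadratic_form_add_unit[OF fin i Ksym])
    also have "(\<Sum>j\<in>I. \<Sum>k\<in>I. w j * w k * L j k) = (- a * sin \<theta>)\<^sup>2 * L i i + 2 * (- a * sin \<theta>) * cos \<theta> * (\<Sum>j\<in>I. c j * L i j) + (cos \<theta>)\<^sup>2 * (\<Sum>j\<in>I. \<Sum>k\<in>I. c j * c k * L j k)"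
      unfolding w_def by (rule quadratic_form_add_unit[OF fin i Lsym])
    also have "(a * cos \<theta>)\<^sup>2 * K i i + 2 * (a * cos \<theta>) * sin \<theta> * (\<Sum>j\<in>I. c j * K i j) + (sin \<theta>)\<^sup>2 * (\<Sum>j\<in>I. \<Sum>k\<in>I. c j * c k * K j k)
       + ((- a * sin \<theta>)\<^sup>2 * L i i + 2 * (- a * sin \<theta>) * cos \<theta> * (\<Sum>j\<in>I. c j * L i j) + (cos \<theta>)\<^sup>2 * (\<Sum>j\<in>I. \<Sum>k\<in>I. c j * c k * L j k))
      = a\<^sup>2 * ((cos \<theta>)\<^sup>2 * K i i + (sin \<theta>)\<^sup>2 * L i i) + 2 * a * (\<Sum>j\<in>I. c j * (sin \<theta> * cos \<theta> * D i j))
        + ((sin \<theta>)\<^sup>2 * (\<Sum>j\<in>I. \<Sum>k\<in>I. c j * c k * K j k) + (cos \<theta>)\<^sup>2 * (\<Sum>j\<in>I. \<Sum>k\<in>I. c j * c k * L j k))"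
    proof -
      have "(\<Sum>j\<in>I. c j * (sin \<theta> * cos \<theta> * D i j)) = sin \<theta> * cos \<theta> * ((\<Sum>j\<in>I. c j * K i j) - (\<Sum>j\<in>I. c j * L i j))"
        unfolding D_def sum_distrib_left sum_subtractf[symmetric] by (intro sum.cong) (auto simp: algebra_simps)
      then show ?thesis by (simp only:) (simp add: power_mult_distrib algebra_simps)
    qed
    finally show ?thesis .
  qed
  have ibp: "integrable ?P (\<lambda>\<omega>. U \<theta> i \<omega> * (G \<theta> \<omega> * ?s \<theta> \<omega> i))"
     "\<And>j. j \<in> I \<Longrightarrow> integrable ?P (\<lambda>\<omega>. ?H \<theta> i j \<omega>)"
     "(LINT \<omega>|?P. U \<theta> i \<omega> * (G \<theta> \<omega> * ?s \<theta> \<omega> i))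
       = (\<Sum>j\<in>I. (sin \<theta> * cos \<theta> * D i j) * (LINT \<omega>|?P. ?H \<theta> i j \<omega>))"
    if i: "i \<in> I" for \<theta> i
  proof -
    let ?sz = "\<lambda>z. softmax p I (\<lambda>j. z j - e \<theta> j)" and ?lz = "\<lambda>z. lse p I (\<lambda>j. z j - e \<theta> j)"
    define f where "f z = ?lz z * ?sz z i" for z
    define f' where "f' j z = ?lz z * ((if j = i then p * ?sz z i else 0)
        - (p - 1) * ?sz z j * ?sz z i)" for j z
    define A where "A = exp (ln (\<Sum>i\<in>I. exp (p * \<bar>e \<theta> i\<bar>)) / p)"
    have bnd: "\<bar>?lz z * x\<bar> \<le> (2 * p * A) * exp (1 * (\<Sum>i\<in>I. \<bar>z i\<bar>))" if "\<bar>x\<bar> \<le> 2 * p" for z x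
    proof -
      have "\<bar>?lz z * x\<bar> \<le> (A * exp (\<Sum>i\<in>I. \<bar>z i\<bar>)) * (2 * p)"
        unfolding abs_mult A_def using lse_shift_bound[OF p fin ne, of z "e \<theta>"] lse_pos[OF p fin ne] that 
        by (intro mult_mono) (auto simp: less_imp_le)
      then show ?thesis by (simp add: mult_ac)
    qed
    have sm: "0 \<le> softmax p I z j" "softmax p I z j \<le> 1" if "j \<in> I" for j z
      using softmax_nonneg[OF p fin ne] softmax_le_1[OF p fin ne that] by auto
    have B: "0 \<le> (1::real)" by simp
    have fm: "f \<in> borel_measurable (PiM I (\<lambda>_. borel))" unfolding f_def lse_def softmax_def using i by measurable
    have f'm: "f' j \<in> borel_measurable (PiM I (\<lambda>_. borel))" if "j \<in> I" for j unfolding f'_def lse_def softmax_def using i that by measurable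
    have rst: "lse p I (\<lambda>j. restrict z I j - e \<theta> j) = ?lz z" for z
      unfolding lse_def by (intro arg_cong[where f=exp] arg_cong2[where f="(/)"] arg_cong[where f=ln] sum.cong) auto
    have rss: "softmax p I (\<lambda>j. restrict z I j - e \<theta> j) k = ?sz z k" if "k \<in> I" for z k
      unfolding softmax_def using that by (intro arg_cong2[where f="(/)"] sum.cong) auto
    have sne: "(\<Sum>i\<in>I. exp (p * z i)) \<noteq> 0" for z using lsesimps[of z] by simp
    have d1: "((\<lambda>t. f (\<lambda>i. z i + t * d i)) has_real_derivative (\<Sum>i\<in>I. d i * f' i (\<lambda>i. z i + t * d i))) (at t)" for z d t
      unfolding f_def f'_def
      by (rule lse_softmax_has_derivative[OF p fin ne _ i, where y="\<lambda>j t. z j + t * d j - e \<theta> j"]) (auto intro!: derivative_eq_intros)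
    have d2: "continuous_on UNIV (\<lambda>t. f' j (\<lambda>i. z i + t * d i))" if "j \<in> I" for z d j
      unfolding f'_def lse_def softmax_def using p by (cases "j = i") (auto intro!: continuous_intros simp: sne)
    have d3: "\<bar>f z\<bar> \<le> (2 * p * A) * exp (1 * (\<Sum>i\<in>I. \<bar>z i\<bar>))" for z
      unfolding f_def by (rule bnd) (use sm[OF i] p in \<open>auto intro: order_trans[of _ 1]\<close>)
    have abs_if_diff: "\<bar>(if B then a else 0) - b\<bar> \<le> 2 * p" if "0 \<le> b" "b \<le> p - 1" "0 \<le> a" "a \<le> p" for B a b
      using that by auto
    have d4: "\<bar>f' j z\<bar> \<le> (2 * p * A) * exp (1 * (\<Sum>i\<in>I. \<bar>z i\<bar>))" if j: "j \<in> I" for z j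
      unfolding f'_def
    proof (rule bnd)
      have "0 \<le> ?sz z j * ?sz z i" "?sz z j * ?sz z i \<le> 1"
        using sm i j by (auto intro!: mult_le_one)
      then have "0 \<le> (p - 1) * (?sz z j * ?sz z i)"
         "(p - 1) * (?sz z j * ?sz z i) \<le> p - 1"
        using p by (auto intro!: mult_nonneg_nonneg mult_left_le)
      moreover have "0 \<le> p * ?sz z i" "p * ?sz z i \<le> p"
        using p sm[OF i] by (auto intro!: mult_nonneg_nonneg mult_left_le)
      ultimately show "\<bar>(if j = i then p * ?sz z i else 0) - (p - 1) * ?sz z j * ?sz z i\<bar> \<le> 2 * p"
        using abs_if_diff unfolding mult.assoc by blast
    qed
    have Q0: "(sin \<theta>)\<^sup>2 * (\<Sum>j\<in>I. \<Sum>k\<in>I. 0 * 0 * K j k) + (cos \<theta>)\<^sup>2 * (\<Sum>j\<in>I. \<Sum>k\<in>I. 0 * 0 * L j k) = 0" by simp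
    note main = gaussian_integration_by_parts[OF P.prob_space_axioms fin Um[OF i] Zm ch[OF i] Q0 iZ fm f'm _ _ d1 d2 B d3 d4]
    have yZ: "y \<theta> \<omega> = (\<lambda>j. Z \<theta> j \<omega> - e \<theta> j)" for \<omega> by (auto simp: y_def)
    have fr: "f (restrict z I) = f z" "\<And>j. j \<in> I \<Longrightarrow> f' j (restrict z I) = f' j z" for z
      unfolding f_def f'_def by (simp_all only: rst rss i)
    show "integrable ?P (\<lambda>\<omega>. U \<theta> i \<omega> * (G \<theta> \<omega> * ?s \<theta> \<omega> i))"
      using main(1)[OF _ _ _ fr] unfolding f_def G_def yZ by blast
    show "integrable ?P (\<lambda>\<omega>. ?H \<theta> i j \<omega>)" if "j \<in> I" for j
      using main(2)[OF _ _ _ fr] that unfolding f'_def G_def yZ by blast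
    show "(LINT \<omega>|?P. U \<theta> i \<omega> * (G \<theta> \<omega> * ?s \<theta> \<omega> i))
       = (\<Sum>j\<in>I. (sin \<theta> * cos \<theta> * D i j) * (LINT \<omega>|?P. ?H \<theta> i j \<omega>))"
      using main(3)[OF _ _ _ fr] unfolding f_def f'_def G_def yZ by blast
  qed
  \<comment> \<open>Homogeneity of degree one in the \<open>exp (y i)\<close>: a row of the Hessian
    sums to the gradient entry. Integrability of the gradient terms is inherited from the Hessian
    terms in this way.\<close>
  have Gs_eq: "G \<theta> \<omega> * ?s \<theta> \<omega> i = (\<Sum>j\<in>I. ?H \<theta> i j \<omega>)"
    if i: "i \<in> I" for \<theta> \<omega> i
  proof -
    have "(\<Sum>j\<in>I. (if j = i then p * ?s \<theta> \<omega> i else 0) - (p - 1) * ?s \<theta> \<omega> j * ?s \<theta> \<omega> i)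
      = p * ?s \<theta> \<omega> i - (p - 1) * (\<Sum>j\<in>I. ?s \<theta> \<omega> j) * ?s \<theta> \<omega> i"
      using fin i unfolding sum_subtractf by (simp add: sum_distrib_left sum_distrib_right)
    then show ?thesis unfolding sum_softmax[OF p fin ne] sum_distrib_left[symmetric] by (simp add: algebra_simps)
  qed
  have iGs: "integrable ?P (\<lambda>\<omega>. G \<theta> \<omega> * ?s \<theta> \<omega> i)" if i: "i \<in> I" for \<theta> i
    unfolding Gs_eq[OF i] by (intro Bochner_Integration.integrable_sum ibp(2) i)
  have \<phi>_eq: "\<phi> \<theta> \<omega> = (\<Sum>i\<in>I. U \<theta> i \<omega> * (G \<theta> \<omega> * ?s \<theta> \<omega> i) - sin \<theta> * cos \<theta> * D i i * (G \<theta> \<omega> * ?s \<theta> \<omega> i))" for \<theta> \<omega>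
    unfolding \<phi>_def y'_def by (intro sum.cong) (auto simp: left_diff_distrib)
  have \<phi>_nonneg: "0 \<le> (LINT \<omega>|?P. \<phi> \<theta> \<omega>)" if \<theta>: "\<theta> \<in> {0..pi/2}" for \<theta>
  proof -
    define r where "r = sin \<theta> * cos \<theta>"
    have r0: "r \<ge> 0" unfolding r_def using \<theta> by (intro mult_nonneg_nonneg sin_ge_zero cos_ge_zero) auto
    have "(LINT \<omega>|?P. \<phi> \<theta> \<omega>) = (\<Sum>i\<in>I. (LINT \<omega>|?P. U \<theta> i \<omega> * (G \<theta> \<omega> * ?s \<theta> \<omega> i)) - r * D i i * (LINT \<omega>|?P. G \<theta> \<omega> * ?s \<theta> \<omega> i))"
      unfolding \<phi>_eq r_def[symmetric]
      by (subst Bochner_Integration.integral_sum)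
         (auto intro!: Bochner_Integration.integrable_diff integrable_mult_right ibp(1) iGs sum.cong simp: Bochner_Integration.integral_diff ibp(1) iGs simp del: integral_mult_right_zero)
    also have "\<dots> = (\<Sum>i\<in>I. (\<Sum>j\<in>I. (r * D i j) * (LINT \<omega>|?P. ?H \<theta> i j \<omega>))
        - r * D i i * (LINT \<omega>|?P. G \<theta> \<omega> * ?s \<theta> \<omega> i))"
      unfolding r_def by (intro sum.cong refl arg_cong2[where f="(-)"] ibp(3))
    also have "\<dots> = (LINT \<omega>|?P. (\<Sum>i\<in>I. (\<Sum>j\<in>I. (r * D i j) * (?H \<theta> i j \<omega>))
        - r * D i i * (G \<theta> \<omega> * ?s \<theta> \<omega> i)))"
    proof -
      have a: "integrable ?P (\<lambda>\<omega>. (r * D i j) * (?H \<theta> i j \<omega>))"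
        if "i \<in> I" "j \<in> I" for i j by (rule integrable_mult_right[OF ibp(2)[OF that]])
      have b: "integrable ?P (\<lambda>\<omega>. r * D i i * (G \<theta> \<omega> * ?s \<theta> \<omega> i))" if "i \<in> I" for i
        by (rule integrable_mult_right[OF iGs[OF that]])
      have c: "integrable ?P (\<lambda>\<omega>. \<Sum>j\<in>I. (r * D i j) * (?H \<theta> i j \<omega>))"
        if "i \<in> I" for i by (intro Bochner_Integration.integrable_sum a that)
      have "(LINT \<omega>|?P. (\<Sum>i\<in>I. (\<Sum>j\<in>I. (r * D i j) * (?H \<theta> i j \<omega>))
        - r * D i i * (G \<theta> \<omega> * ?s \<theta> \<omega> i)))
       = (\<Sum>i\<in>I. (LINT \<omega>|?P. (\<Sum>j\<in>I. (r * D i j) * (?H \<theta> i j \<omega>)))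
        - (LINT \<omega>|?P. r * D i i * (G \<theta> \<omega> * ?s \<theta> \<omega> i)))"
        by (subst Bochner_Integration.integral_sum)
          (intro sum.cong refl Bochner_Integration.integrable_diff Bochner_Integration.integral_diff b c | assumption)+
      also have "\<dots> = (\<Sum>i\<in>I. (\<Sum>j\<in>I. (LINT \<omega>|?P. (r * D i j) * (?H \<theta> i j \<omega>)))
        - (LINT \<omega>|?P. r * D i i * (G \<theta> \<omega> * ?s \<theta> \<omega> i)))"
        by (intro sum.cong refl arg_cong2[where f="(-)"] Bochner_Integration.integral_sum a)
      finally show ?thesis by (simp only: integral_mult_right_zero)
    qed
    also have "\<dots> = (LINT \<omega>|?P. r * (p - 1) * G \<theta> \<omega> / 2 * (\<Sum>i\<in>I. \<Sum>j\<in>I. ?s \<theta> \<omega> i * ?s \<theta> \<omega> j * (D i i + D j j - 2 * D i j)))"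
      by (simp only: interpolation_integrand_eq[OF fin sum_softmax[OF p fin ne]])
    also have "0 \<le> \<dots>"
    proof (rule Bochner_Integration.integral_nonneg)
      fix \<omega>
      have "0 \<le> D i i + D j j - 2 * D i j" if "i \<in> I" "j \<in> I" for i j
        using V[OF that] unfolding D_def by (simp add: algebra_simps)
      then have "0 \<le> (\<Sum>i\<in>I. \<Sum>j\<in>I. ?s \<theta> \<omega> i * ?s \<theta> \<omega> j * (D i i + D j j - 2 * D i j))"
        by (intro sum_nonneg mult_nonneg_nonneg softmax_nonneg[OF p fin ne])
      moreover have "0 \<le> G \<theta> \<omega>" unfolding G_def using lse_pos[OF p fin ne] by (rule less_imp_le)
      ultimately show "0 \<le> r * (p - 1) * G \<theta> \<omega> / 2 * (\<Sum>i\<in>I. \<Sum>j\<in>I. ?s \<theta> \<omega> i * ?s \<theta> \<omega> j * (D i i + D j j - 2 * D i j))"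
        using r0 p by (intro mult_nonneg_nonneg divide_nonneg_nonneg) auto
    qed
    finally show ?thesis .
  qed
  have sne: "(\<Sum>i\<in>I. exp (p * z i)) \<noteq> 0" for z using lsesimps[of z] by simp
  have dG: "((\<lambda>\<theta>. G \<theta> \<omega>) has_real_derivative \<phi> \<theta> \<omega>) (at \<theta>)" for \<theta> \<omega>
  proof -
    have "((\<lambda>\<theta>. y \<theta> \<omega> i) has_real_derivative y' \<theta> \<omega> i) (at \<theta>)" if "i \<in> I" for i
      unfolding y_def y'_def Z_def U_def e_def D_def
      by (auto intro!: derivative_eq_intros simp: power2_eq_square field_simps)
    then have "((\<lambda>\<theta>. lse p I (\<lambda>i. y \<theta> \<omega> i)) has_real_derivative (\<Sum>i\<in>I. y' \<theta> \<omega> i * (lse p I (\<lambda>i. y \<theta> \<omega> i) * softmax p I (\<lambda>i. y \<theta> \<omega> i) i))) (at \<theta>)"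
      by (rule lse_has_derivative[OF p fin ne])
    then show ?thesis unfolding G_def \<phi>_def .
  qed
  have c\<phi>: "continuous_on UNIV (\<lambda>\<theta>. \<phi> \<theta> \<omega>)" for \<omega>
    unfolding \<phi>_def G_def lse_def softmax_def y_def y'_def Z_def U_def e_def
    using p by (auto intro!: continuous_intros simp: sne)
  define E where "E i = \<bar>K i i\<bar> / 2 + \<bar>L i i\<bar> / 2 + \<bar>d i\<bar>" for i
  define A where "A = exp (ln (\<Sum>i\<in>I. exp (p * E i)) / p) * exp (\<Sum>i\<in>I. \<bar>D i i\<bar>)"
  \<comment> \<open>Dominates \<open>\<phi> \<theta>\<close> for all angles at once. One exponential
    of \<open>SX + SW\<close> comes from \<open>G\<close>, a second from bounding the linear factor
    \<open>y'\<close> by its exponential, and \<open>exp_add_le_sum\<close> doubles the resulting 2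
    to 4.\<close>
  define H where "H \<omega> = A * (exp (4 * SX (fst \<omega>)) + exp (4 * SW (snd \<omega>)))" for \<omega>
  have eE: "\<bar>e \<theta> i\<bar> \<le> E i" for \<theta> i
  proof -
    have "\<bar>(sin \<theta>)\<^sup>2 * K i i\<bar> \<le> \<bar>K i i\<bar>" "\<bar>(cos \<theta>)\<^sup>2 * L i i\<bar> \<le> \<bar>L i i\<bar>"
      by (auto simp: abs_mult abs_square_le_1 intro!: mult_left_le_one_le)
    moreover have "\<bar>(u + v) / 2 + w\<bar> \<le> k / 2 + l / 2 + \<bar>w\<bar>" if "\<bar>u\<bar> \<le> k" "\<bar>v\<bar> \<le> l" for u v w k l :: real
      using that abs_triangle_ineq[of "(u + v) / 2" w] abs_triangle_ineq[of u v] by (simp add: field_simps)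
    ultimately show ?thesis unfolding e_def E_def by blast
  qed
  have \<phi>b: "\<bar>\<phi> \<theta> \<omega>\<bar> \<le> H \<omega>" for \<theta> \<omega>
  proof -
    define x where "x i = \<bar>X i (fst \<omega>)\<bar> + \<bar>W i (snd \<omega>)\<bar>" for i
    have sx: "(\<Sum>i\<in>I. x i) = SX (fst \<omega>) + SW (snd \<omega>)" by (simp add: x_def SX_def SW_def sum.distrib)
    have G0: "0 \<le> G \<theta> \<omega>" unfolding G_def using lse_pos[OF p fin ne] by (rule less_imp_le)
    have "y \<theta> \<omega> i \<le> x i + E i" for i
      using abs_lin(1)[of \<theta> "X i (fst \<omega>)" "W i (snd \<omega>)"] eE[of \<theta> i] unfolding y_def x_def Z_def by linarith
    then have Gb: "G \<theta> \<omega> \<le> exp (ln (\<Sum>i\<in>I. exp (p * E i)) / p) * exp (\<Sum>i\<in>I. x i)"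
      unfolding G_def by (intro lse_bound[OF p fin ne]) (auto simp: x_def)
    have y'b: "\<bar>y' \<theta> \<omega> i\<bar> \<le> x i + \<bar>D i i\<bar>" for i
    proof -
      have "\<bar>sin \<theta> * cos \<theta> * D i i\<bar> \<le> \<bar>D i i\<bar>" by (auto simp: abs_mult intro!: mult_left_le_one_le mult_le_one)
      then show ?thesis
        using abs_lin(2)[of \<theta> "X i (fst \<omega>)" "W i (snd \<omega>)"] unfolding y'_def x_def U_def by linarith
    qed
    have "\<bar>\<phi> \<theta> \<omega>\<bar> \<le> (\<Sum>i\<in>I. (x i + \<bar>D i i\<bar>) * G \<theta> \<omega>)" unfolding \<phi>_def
    proof (intro order_trans[OF sum_abs] sum_mono)
      fix i assume i: "i \<in> I"
      have "\<bar>G \<theta> \<omega> * ?s \<theta> \<omega> i\<bar> \<le> G \<theta> \<omega>"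
        using G0 softmax_nonneg[OF p fin ne] softmax_le_1[OF p fin ne i] by (auto simp: abs_mult intro!: mult_left_le)
      then show "\<bar>y' \<theta> \<omega> i * (G \<theta> \<omega> * ?s \<theta> \<omega> i)\<bar> \<le> (x i + \<bar>D i i\<bar>) * G \<theta> \<omega>"
        unfolding abs_mult[of "y' \<theta> \<omega> i"] using y'b by (intro mult_mono) (auto simp: x_def)
    qed
    also have "\<dots> = ((\<Sum>i\<in>I. x i) + (\<Sum>i\<in>I. \<bar>D i i\<bar>)) * G \<theta> \<omega>" by (simp add: sum_distrib_right[symmetric] sum.distrib)
    also have "\<dots> \<le> exp ((\<Sum>i\<in>I. x i) + (\<Sum>i\<in>I. \<bar>D i i\<bar>)) * (exp (ln (\<Sum>i\<in>I. exp (p * E i)) / p) * exp (\<Sum>i\<in>I. x i))"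
    proof (intro mult_mono Gb G0)
      show "(\<Sum>i\<in>I. x i) + (\<Sum>i\<in>I. \<bar>D i i\<bar>) \<le> exp ((\<Sum>i\<in>I. x i) + (\<Sum>i\<in>I. \<bar>D i i\<bar>))"
        by (rule order_trans[OF _ exp_ge_add_one_self]) simp
    qed simp
    also have "\<dots> = A * exp (2 * SX (fst \<omega>) + 2 * SW (snd \<omega>))"
      unfolding A_def sx by (simp add: exp_add[symmetric] algebra_simps)
    also have "\<dots> \<le> A * (exp (2 * (2 * SX (fst \<omega>))) + exp (2 * (2 * SW (snd \<omega>))))"
      by (intro mult_left_mono exp_add_le_sum) (simp add: A_def)
    finally show ?thesis unfolding H_def by simp
  qed
  have iH: "integrable ?P H"
    unfolding H_def by (intro integrable_mult_right Bochner_Integration.integrable_add integrable_pair_fst[OF pM pN] integrable_pair_snd[OF pM pN] iSX iSW) auto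
  \<comment> \<open>The angle becomes an integration variable, so that Fubini and the fundamental
    theorem along each sample replace differentiation under the expectation.\<close>
  define \<psi> where "\<psi> z = indicator {0..pi/2} (snd z) * \<phi> (snd z) (fst z)" for z
  have ftc: "(LINT \<theta>|lborel. \<psi> (\<omega>, \<theta>)) = G (pi/2) \<omega> - G 0 \<omega>" for \<omega>
    unfolding \<psi>_def fst_conv snd_conv
    using integral_FTC_Icc_real[of 0 "pi/2" "\<lambda>\<theta>. G \<theta> \<omega>" "\<lambda>\<theta>. \<phi> \<theta> \<omega>"] dG c\<phi>[of \<omega>] pi_ge_zero
    by (simp add: continuous_on_eq_continuous_at mult.commute)
  have \<psi>m: "\<psi> \<in> borel_measurable (?P \<Otimes>\<^sub>M lborel)"
    unfolding \<psi>_def[abs_def] \<phi>_def G_def lse_def softmax_def y_def y'_def Z_def U_def e_def by measurable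
  have \<psi>b: "\<bar>\<psi> (\<omega>, \<theta>)\<bar> \<le> indicator {0..pi/2} \<theta> * H \<omega>" for \<omega> \<theta>
    using \<phi>b[of \<theta> \<omega>] by (auto simp: \<psi>_def abs_mult indicator_def)
  have i1: "integrable lborel (\<lambda>\<theta>. indicator {0..pi/2} \<theta> * H \<omega>)" for \<omega> by simp
  have ae: "integrable lborel (\<lambda>\<theta>. \<psi> (\<omega>, \<theta>))" if "\<omega> \<in> space ?P" for \<omega>
  proof (rule Bochner_Integration.integrable_bound[OF i1])
    show "(\<lambda>\<theta>. \<psi> (\<omega>, \<theta>)) \<in> borel_measurable lborel" using measurable_compose[OF measurable_Pair1'[OF that] \<psi>m] by simp
    show "AE \<theta> in lborel. norm (\<psi> (\<omega>, \<theta>)) \<le> norm (indicator {0..pi/2} \<theta> * H \<omega>)"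
      unfolding real_norm_def by (intro AE_I2 order_trans[OF _ abs_ge_self] \<psi>b)
  qed
  have i\<psi>: "integrable (?P \<Otimes>\<^sub>M lborel) \<psi>"
  proof (rule PL.Fubini_integrable[OF \<psi>m])
    show "AE \<omega> in ?P. integrable lborel (\<lambda>\<theta>. \<psi> (\<omega>, \<theta>))" by (rule AE_I2[OF ae])
    show "integrable ?P (\<lambda>\<omega>. LINT \<theta>|lborel. norm (\<psi> (\<omega>, \<theta>)))"
    proof (rule Bochner_Integration.integrable_bound)
      show "integrable ?P (\<lambda>\<omega>. pi / 2 * H \<omega>)" by (intro integrable_mult_right iH)
      show "(\<lambda>\<omega>. LINT \<theta>|lborel. norm (\<psi> (\<omega>, \<theta>))) \<in> borel_measurable ?P"
        using \<psi>m by (intro lborel.borel_measurable_lebesgue_integral) (auto simp: split_beta')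
      have "norm (LINT \<theta>|lborel. norm (\<psi> (\<omega>, \<theta>))) \<le> norm (pi / 2 * H \<omega>)" if "\<omega> \<in> space ?P" for \<omega>
      proof -
        have "(LINT \<theta>|lborel. norm (\<psi> (\<omega>, \<theta>))) \<le> (LINT \<theta>|lborel. indicator {0..pi/2} \<theta> * H \<omega>)"
          unfolding real_norm_def by (intro integral_mono \<psi>b i1 integrable_abs ae that)
        also have "\<dots> = pi / 2 * H \<omega>" by simp
        finally have "(LINT \<theta>|lborel. norm (\<psi> (\<omega>, \<theta>))) \<le> pi / 2 * H \<omega>" .
        moreover have "0 \<le> (LINT \<theta>|lborel. norm (\<psi> (\<omega>, \<theta>)))" by (rule Bochner_Integration.integral_nonneg) auto
        ultimately show ?thesis unfolding real_norm_def[of "integral\<^sup>L _ _"] real_norm_def[of "_ * _"] by (simp only: abs_of_nonneg order_trans)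
      qed
      then show "AE \<omega> in ?P. norm (LINT \<theta>|lborel. norm (\<psi> (\<omega>, \<theta>))) \<le> norm (pi / 2 * H \<omega>)" by (rule AE_I2)
    qed
  qed
  have G0: "G 0 \<omega> = lse p I (\<lambda>i. W i (snd \<omega>) - (L i i / 2 + d i))" for \<omega>
    unfolding G_def y_def[abs_def] Z_def e_def by simp
  have G1: "G (pi/2) \<omega> = lse p I (\<lambda>i. X i (fst \<omega>) - (K i i / 2 + d i))" for \<omega>
    unfolding G_def y_def[abs_def] Z_def e_def by simp
  have "0 \<le> (LINT \<theta>|lborel. LINT \<omega>|?P. \<psi> (\<omega>, \<theta>))"
  proof (rule Bochner_Integration.integral_nonneg)
    fix \<theta> :: real
    have "(LINT \<omega>|?P. \<psi> (\<omega>, \<theta>)) = indicator {0..pi/2} \<theta> * (LINT \<omega>|?P. \<phi> \<theta> \<omega>)"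
      by (simp add: \<psi>_def)
    then show "0 \<le> (LINT \<omega>|?P. \<psi> (\<omega>, \<theta>))"
      using \<phi>_nonneg[of \<theta>] by (cases "\<theta> \<in> {0..pi/2}") simp_all
  qed
  also have "\<dots> = (LINT \<omega>|?P. LINT \<theta>|lborel. \<psi> (\<omega>, \<theta>))"
    using PL.Fubini_integral[of "\<lambda>\<omega> \<theta>. \<psi> (\<omega>, \<theta>)"] i\<psi> by (simp add: split_beta')
  also have "\<dots> = (LINT \<omega>|?P. G (pi/2) \<omega> - G 0 \<omega>)" by (simp only: ftc)
  also have "\<dots> = (LINT \<omega>|?P. G (pi/2) \<omega>) - (LINT \<omega>|?P. G 0 \<omega>)"
    unfolding G0 G1 by (intro Bochner_Integration.integral_diff integrable_pair_fst[OF pM pN intM] integrable_pair_snd[OF pM pN intN])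
  also have "(LINT \<omega>|?P. G (pi/2) \<omega>) = (LINT \<omega>|M. lse p I (\<lambda>i. X i \<omega> - (K i i / 2 + d i)))"
    unfolding G1 using P.integral_fst'[OF integrable_pair_fst[OF pM pN intM]] by (simp add: N.prob_space)
  also have "(LINT \<omega>|?P. G 0 \<omega>) = (LINT \<omega>|N. lse p I (\<lambda>i. W i \<omega> - (L i i / 2 + d i)))"
    unfolding G0 using P.integral_fst'[OF integrable_pair_snd[OF pM pN intN]] by (simp add: M.prob_space)
  finally show "(LINT \<omega>|N. lse p I (\<lambda>i. W i \<omega> - (L i i / 2 + d i))) \<le> (LINT \<omega>|M. lse p I (\<lambda>i. X i \<omega> - (K i i / 2 + d i)))" by simp
qed

section \<open>Suprema over grids\<close>

lemma gaussian_vectorD: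
  assumes "gaussian_vector M I X K"
  shows "prob_space M" "finite I" "\<And>i. i \<in> I \<Longrightarrow> X i \<in> borel_measurable M"
  using assms by (auto simp: gaussian_vector_def)

text \<open>If the right-hand side is finite, it is a fixed number \<open>b\<close>, and the
  dependence on \<open>p\<close> sits entirely in the root of \<open>card I\<close> in front of it.
  The limit in \<open>p\<close> is thus a limit of real constants.\<close>

lemma gaussian_max_comparison:
  assumes X: "gaussian_vector M I X K" and W: "gaussian_vector N I W L" and ne: "I \<noteq> {}"
    and V: "\<And>i j. i \<in> I \<Longrightarrow> j \<in> I \<Longrightarrow> L i i + L j j - 2 * L i j \<le> K i i + K j j - 2 * K i j"
  shows "(\<integral>\<^sup>+\<omega>. ennreal (Max ((\<lambda>i. exp (W i \<omega> - (L i i / 2 + d i))) ` I)) \<partial>N)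
       \<le> (\<integral>\<^sup>+\<omega>. ennreal (Max ((\<lambda>i. exp (X i \<omega> - (K i i / 2 + d i))) ` I)) \<partial>M)" (is "?A \<le> ?B")
proof (cases "?B = \<infinity>")
  case False
  then obtain b where b: "?B = ennreal b" "b \<ge> 0" by (cases ?B rule: ennreal_cases) auto
  note fin = gaussian_vectorD(2)[OF X]
  have [measurable]: "\<And>i. i \<in> I \<Longrightarrow> X i \<in> borel_measurable M" using gaussian_vectorD(3)[OF X] .
  have le: "?A \<le> ennreal (exp (ln (card I) / p) * b)" if p: "p \<ge> 1" for p :: real
  proof -
    note cmp = lse_comparison[OF X W ne p V, of d]
    note lp = lse_pos[OF p fin ne, THEN less_imp_le]
    have "?A \<le> (\<integral>\<^sup>+\<omega>. ennreal (lse p I (\<lambda>i. W i \<omega> - (L i i / 2 + d i))) \<partial>N)"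
      by (intro nn_integral_mono ennreal_leI lse_ge_Max[OF p fin ne])
    also have "\<dots> = ennreal (LINT \<omega>|N. lse p I (\<lambda>i. W i \<omega> - (L i i / 2 + d i)))"
      by (rule nn_integral_eq_integral[OF gaussian_vector_integrable_lse[OF W p ne]]) (auto intro: lp)
    also have "\<dots> \<le> ennreal (LINT \<omega>|M. lse p I (\<lambda>i. X i \<omega> - (K i i / 2 + d i)))"
      by (rule ennreal_leI[OF cmp])
    also have "\<dots> = (\<integral>\<^sup>+\<omega>. ennreal (lse p I (\<lambda>i. X i \<omega> - (K i i / 2 + d i))) \<partial>M)"
      by (rule nn_integral_eq_integral[OF gaussian_vector_integrable_lse[OF X p ne], symmetric]) (auto intro: lp)
    also have "\<dots> \<le> (\<integral>\<^sup>+\<omega>. ennreal (exp (ln (card I) / p)) * ennreal (Max ((\<lambda>i. exp (X i \<omega> - (K i i / 2 + d i))) ` I)) \<partial>M)"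
      by (intro nn_integral_mono, subst ennreal_mult'[symmetric]) (auto intro!: ennreal_leI lse_le_Max[OF p fin ne])
    also have "\<dots> = ennreal (exp (ln (card I) / p)) * ?B"
      by (rule nn_integral_cmult) (use fin in measurable)
    finally show ?thesis using b by (simp add: ennreal_mult')
  qed
  have "(\<lambda>n. ennreal (exp (ln (card I) / real (Suc n)) * b)) \<longlonglongrightarrow> ennreal (exp 0 * b)"
    by (intro tendsto_ennrealI tendsto_mult tendsto_exp tendsto_const LIMSEQ_Suc lim_const_over_n)
  then have "?A \<le> ennreal (exp 0 * b)"
    by (rule LIMSEQ_le_const) (auto intro!: exI[of _ 0] le)
  then show ?thesis using b by simp
qed simp

section \<open>Path suprema as limits over grids\<close>

definition grid_max :: "real \<Rightarrow> nat \<Rightarrow> (real \<Rightarrow> real) \<Rightarrow> real" where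
  "grid_max \<delta> n g = Max ((\<lambda>k. exp (g (\<delta> * real k))) ` {..n})"

lemma grid_max_ge: "k \<le> n \<Longrightarrow> exp (g (\<delta> * real k)) \<le> grid_max \<delta> n g"
  unfolding grid_max_def by (intro Max_ge) auto

lemma grid_max_le: "(\<And>k. k \<le> n \<Longrightarrow> exp (g (\<delta> * real k)) \<le> B) \<Longrightarrow> grid_max \<delta> n g \<le> B"
  unfolding grid_max_def by (auto intro!: Max.boundedI)

lemma cSUP_continuous_bdd:
  fixes g :: "real \<Rightarrow> real"
  assumes "continuous_on {0..T} g"
  shows "bdd_above (g ` {0..T})"
  using compact_imp_bounded[OF compact_continuous_image[OF assms compact_Icc]] by (rule bounded_imp_bdd_above)

lemma grid_max_le_exp_SUP:
  assumes "continuous_on {0..T} g" "0 \<le> \<delta>" "\<delta> * real n \<le> T"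
  shows "grid_max \<delta> n g \<le> exp (SUP s\<in>{0..T}. g s)"
proof (rule grid_max_le)
  fix k assume "k \<le> n"
  then have "\<delta> * real k \<le> \<delta> * real n" using assms(2) by (intro mult_left_mono) auto
  then have "\<delta> * real k \<in> {0..T}" using assms by auto
  then show "exp (g (\<delta> * real k)) \<le> exp (SUP s\<in>{0..T}. g s)"
    by (auto intro!: cSUP_upper cSUP_continuous_bdd assms)
qed

text \<open>Dyadic refinement nests the grids; the resulting monotonicity is what monotone
  convergence asks for.\<close>

lemma grid_max_dyadic_mono: "grid_max (T / 2 ^ n) (2 ^ n) g \<le> grid_max (T / 2 ^ Suc n) (2 ^ Suc n) g"
proof (rule grid_max_le)
  fix k :: nat assume "k \<le> 2 ^ n"
  then have "2 * k \<le> 2 ^ Suc n" by simp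
  from grid_max_ge[OF this, of g "T / 2 ^ Suc n"]
  show "exp (g (T / 2 ^ n * real k)) \<le> grid_max (T / 2 ^ Suc n) (2 ^ Suc n) g" by simp
qed

lemma exp_SUP_eq_SUP_grid_max:
  assumes c: "continuous_on {0..T} g" and T: "T > 0"
  shows "ennreal (exp (SUP s\<in>{0..T}. g s)) = (SUP n. ennreal (grid_max (T / 2 ^ n) (2 ^ n) g))" (is "_ = (SUP n. ennreal (?m n))")
proof (rule antisym)
  obtain s where s: "s \<in> {0..T}" "\<And>x. x \<in> {0..T} \<Longrightarrow> g x \<le> g s"
    using continuous_attains_sup[OF compact_Icc _ c] T by auto
  have "(SUP s\<in>{0..T}. g s) = g s" using s by (intro cSup_eq_maximum) auto
  moreover have "ennreal (exp (g s)) \<le> (SUP n. ennreal (?m n))"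
  proof -
    \<comment> \<open>\<open>x n\<close> will be the last grid point not exceeding the maximiser
      \<open>s\<close>, hence within \<open>T / 2 ^ n\<close> of it.\<close>
    define k where "k n = nat \<lfloor>s / T * 2 ^ n\<rfloor>" for n
    define x where "x n = T / 2 ^ n * real (k n)" for n
    have kr: "real (k n) = of_int \<lfloor>s / T * 2 ^ n\<rfloor>" for n unfolding k_def using s T by (subst of_nat_nat) auto
    have kle: "k n \<le> 2 ^ n" for n
    proof -
      have "real (k n) \<le> s / T * 2 ^ n" unfolding kr by (rule of_int_floor_le)
      also have "\<dots> \<le> 1 * 2 ^ n" using s T by (intro mult_right_mono) auto
      finally show ?thesis by (metis mult_1 of_nat_le_iff of_nat_numeral of_nat_power)
    qed
    have xle: "x n \<le> s" for n
    proof -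
      have "real (k n) \<le> s / T * 2 ^ n" unfolding kr by (rule of_int_floor_le)
      then have "T / 2 ^ n * real (k n) \<le> T / 2 ^ n * (s / T * 2 ^ n)" using T by (intro mult_left_mono) auto
      then show ?thesis using T by (simp add: x_def)
    qed
    have xge: "s - T / 2 ^ n \<le> x n" for n
    proof -
      have "s / T * 2 ^ n - 1 \<le> real (k n)" unfolding kr by linarith
      then have "T / 2 ^ n * (s / T * 2 ^ n - 1) \<le> T / 2 ^ n * real (k n)" using T by (intro mult_left_mono) auto
      then show ?thesis using T by (simp add: x_def right_diff_distrib)
    qed
    have "(\<lambda>n. s - T / 2 ^ n) \<longlonglongrightarrow> s"
      by real_asymp
    then have "x \<longlonglongrightarrow> s" by (rule tendsto_sandwich[rotated 2]) (use xle xge in auto)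
    moreover have "x n \<in> {0..T}" for n using xle[of n] s T by (auto simp: x_def)
    ultimately have "(\<lambda>n. g (x n)) \<longlonglongrightarrow> g s"
      using continuous_on_tendsto_compose[OF c _ s(1), of x sequentially] by auto
    then have "(\<lambda>n. ennreal (exp (g (x n)))) \<longlonglongrightarrow> ennreal (exp (g s))" by (intro tendsto_ennrealI tendsto_exp)
    then show ?thesis
    proof (rule LIMSEQ_le_const2)
      have "ennreal (exp (g (x n))) \<le> (SUP n. ennreal (?m n))" for n
        unfolding x_def by (intro SUP_upper2[of n] UNIV_I ennreal_leI grid_max_ge kle)
      then show "\<exists>N. \<forall>n\<ge>N. ennreal (exp (g (x n))) \<le> (SUP n. ennreal (?m n))" by auto
    qed
  qed
  ultimately show "ennreal (exp (SUP s\<in>{0..T}. g s)) \<le> (SUP n. ennreal (?m n))" by simp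
  show "(SUP n. ennreal (?m n)) \<le> ennreal (exp (SUP s\<in>{0..T}. g s))"
    using T by (intro SUP_least ennreal_leI grid_max_le_exp_SUP[OF c]) auto
qed

text \<open>Almost surely the uncountable supremum agrees with a countable supremum of measurable
  maxima, so bounds that are uniform over finite grids pass to the supremum over the
  interval.\<close>

lemma nn_integral_exp_SUP_eq:
  fixes g :: "real \<Rightarrow> 'a \<Rightarrow> real"
  assumes c: "AE \<omega> in M. continuous_on {0..T} (\<lambda>s. g s \<omega>)" and T: "T > 0"
    and m[measurable]: "\<And>s. s \<ge> 0 \<Longrightarrow> g s \<in> borel_measurable M"
  shows "(\<integral>\<^sup>+\<omega>. ennreal (exp (SUP s\<in>{0..T}. g s \<omega>)) \<partial>M)
     = (SUP n. \<integral>\<^sup>+\<omega>. ennreal (grid_max (T / 2 ^ n) (2 ^ n) (\<lambda>s. g s \<omega>)) \<partial>M)"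
proof -
  let ?m = "\<lambda>n \<omega>. grid_max (T / 2 ^ n) (2 ^ n) (\<lambda>s. g s \<omega>)"
  have "(\<integral>\<^sup>+\<omega>. ennreal (exp (SUP s\<in>{0..T}. g s \<omega>)) \<partial>M) = (\<integral>\<^sup>+\<omega>. (SUP n. ennreal (?m n \<omega>)) \<partial>M)"
    using c by (intro nn_integral_cong_AE) (auto elim!: eventually_mono simp: exp_SUP_eq_SUP_grid_max T)
  also have "\<dots> = (SUP n. \<integral>\<^sup>+\<omega>. ennreal (?m n \<omega>) \<partial>M)"
  proof (rule nn_integral_monotone_convergence_SUP)
    show "incseq (\<lambda>n \<omega>. ennreal (?m n \<omega>))"
      by (intro incseq_SucI le_funI ennreal_leI grid_max_dyadic_mono)
    have "g (\<delta> * real k) \<in> borel_measurable M" if "\<delta> \<ge> 0" for \<delta> k using that by (intro m) auto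
    then show "(\<lambda>\<omega>. ennreal (?m n \<omega>)) \<in> borel_measurable M" for n
      unfolding grid_max_def using T by (intro measurable_compose[OF _ measurable_ennreal] borel_measurable_Max borel_measurable_exp[THEN measurable_compose[rotated]]) auto
  qed
  finally show ?thesis .
qed

lemma tendsto_at_top_SUP_mono:
  fixes f :: "real \<Rightarrow> ennreal"
  assumes "\<And>S T. 0 \<le> S \<Longrightarrow> S \<le> T \<Longrightarrow> f S \<le> f T"
  shows "(f \<longlongrightarrow> (SUP T\<in>{0..}. f T)) at_top"
proof (rule order_tendstoI)
  fix a assume "a < (SUP T\<in>{0..}. f T)"
  then obtain S where S: "S \<ge> 0" "a < f S" by (auto simp: less_SUP_iff)
  show "eventually (\<lambda>T. a < f T) at_top"
    using eventually_ge_at_top[of S] by eventually_elim (use S assms in \<open>auto intro: less_le_trans\<close>)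
next
  fix a assume a: "(SUP T\<in>{0..}. f T) < a"
  show "eventually (\<lambda>T. f T < a) at_top"
    using eventually_ge_at_top[of 0] by eventually_elim (use a in \<open>auto intro: le_less_trans[OF SUP_upper]\<close>)
qed

section \<open>Self-similar Gaussian processes\<close>

lemma centered_gaussian_moments:
  assumes "prob_space M" "U \<in> borel_measurable M"
    and ch: "\<And>t. (CLINT \<omega>|M. iexp (t * U \<omega>)) = of_real (exp (- (t\<^sup>2 * v) / 2))"
  shows "integrable M (\<lambda>\<omega>. (U \<omega>)\<^sup>2)" "(LINT \<omega>|M. (U \<omega>)\<^sup>2) = v"
proof -
  note d = centered_gaussian_distr[OF assms]
  have i: "integrable std_normal_distribution (\<lambda>x. (sqrt v * x)\<^sup>2)"
    using integrable_std_normal_distribution_moment[of 2] by (simp add: power_mult_distrib)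
  then have "integrable (distr std_normal_distribution borel (\<lambda>x. sqrt v * x)) (\<lambda>x. x\<^sup>2)"
    by (subst integrable_distr_eq) auto
  then show "integrable M (\<lambda>\<omega>. (U \<omega>)\<^sup>2)" using assms(2) unfolding d(2)[symmetric] by (subst (asm) integrable_distr_eq) auto
  have "(LINT \<omega>|M. (U \<omega>)\<^sup>2) = (LINT x|distr M borel U. x\<^sup>2)" by (rule integral_distr[symmetric]) (use assms(2) in auto)
  also have "\<dots> = (LINT x|std_normal_distribution. (sqrt v * x)\<^sup>2)" unfolding d(2) by (rule integral_distr) auto
  also have "\<dots> = v" using d(1) std_normal_distribution_even_moments[of 1] by (simp add: power_mult_distrib)
  finally show "(LINT \<omega>|M. (U \<omega>)\<^sup>2) = v" .
qed

text \<open>Merges the two branches of \<open>gaussian_rv\<close> into one formula: centring forces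
  the mean parameter to be 0, and the point mass becomes the case of variance 0.\<close>

lemma gaussian_rv_iexp:
  assumes "prob_space M" "gaussian_rv M X" and E0: "prob_space.expectation M X = 0"
  shows "X \<in> borel_measurable M" "integrable M (\<lambda>\<omega>. (X \<omega>)\<^sup>2)"
    and "(CLINT \<omega>|M. iexp (t * X \<omega>)) = of_real (exp (- (t\<^sup>2 * (LINT \<omega>|M. (X \<omega>)\<^sup>2)) / 2))"
proof -
  interpret prob_space M by fact
  show X[measurable]: "X \<in> borel_measurable M" using assms(2) by (simp add: gaussian_rv_def)
  obtain \<mu> \<sigma> where ms: "(\<sigma> = 0 \<and> (AE \<omega> in M. X \<omega> = \<mu>)) \<or> (\<sigma> > 0 \<and> distributed M lborel X (normal_density \<mu> \<sigma>))"
    using assms(2) by (auto simp: gaussian_rv_def)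
  have "\<exists>v. \<forall>t. (CLINT \<omega>|M. iexp (t * X \<omega>)) = of_real (exp (- (t\<^sup>2 * v) / 2))"
    using ms
  proof
    assume "\<sigma> = 0 \<and> (AE \<omega> in M. X \<omega> = \<mu>)"
    then have ae: "AE \<omega> in M. X \<omega> = \<mu>" by simp
    then have "expectation X = expectation (\<lambda>_. \<mu>)" by (intro integral_cong_AE) auto
    then have "\<mu> = 0" using E0 by (simp add: prob_space)
    then have "(CLINT \<omega>|M. iexp (t * X \<omega>)) = (CLINT \<omega>|M. 1)" for t
      using ae by (intro integral_cong_AE) auto
    then show ?thesis by (intro exI[of _ 0]) (simp add: prob_space)
  next
    assume a: "\<sigma> > 0 \<and> distributed M lborel X (normal_density \<mu> \<sigma>)"
    then have mu: "\<mu> = 0" using normal_distributed_expectation[of \<sigma> X \<mu>] E0 by simp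
    from a have "distributed M lborel (\<lambda>x. X x / \<sigma>) std_normal_density"
      using normal_standard_normal_convert[of \<sigma> X \<mu>] by (simp add: mu)
    then have "distr M lborel (\<lambda>x. X x / \<sigma>) = std_normal_distribution"
      by (simp add: distributed_distr_eq_density)
    then have d: "distr M borel (\<lambda>x. X x / \<sigma>) = std_normal_distribution"
      by (metis distr_cong sets_lborel)
    have "(CLINT \<omega>|M. iexp (t * X \<omega>)) = of_real (exp (- (t\<^sup>2 * \<sigma>\<^sup>2) / 2))" for t
    proof -
      have "(CLINT \<omega>|M. iexp (t * X \<omega>)) = (CLINT \<omega>|M. iexp ((t * \<sigma>) * (X \<omega> / \<sigma>)))" using a by simp
      also have "\<dots> = char (distr M borel (\<lambda>x. X x / \<sigma>)) (t * \<sigma>)"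
        by (rule char_distr_eq_integral[symmetric]) (use prob_space_axioms in auto)
      finally show ?thesis unfolding d by (simp add: char_std_normal_distribution power_mult_distrib)
    qed
    then show ?thesis by blast
  qed
  then obtain v where v: "\<And>t. (CLINT \<omega>|M. iexp (t * X \<omega>)) = of_real (exp (- (t\<^sup>2 * v) / 2))" by blast
  note m = centered_gaussian_moments[OF prob_space_axioms X v]
  show "integrable M (\<lambda>\<omega>. (X \<omega>)\<^sup>2)" by (rule m)
  show "(CLINT \<omega>|M. iexp (t * X \<omega>)) = of_real (exp (- (t\<^sup>2 * (LINT \<omega>|M. (X \<omega>)\<^sup>2)) / 2))" unfolding m(2) by (rule v)
qed

lemma integrable_mult_of_squares:
  fixes X Y :: "'a \<Rightarrow> real"
  assumes "integrable M (\<lambda>\<omega>. (X \<omega>)\<^sup>2)" "integrable M (\<lambda>\<omega>. (Y \<omega>)\<^sup>2)"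
    and [measurable]: "X \<in> borel_measurable M" "Y \<in> borel_measurable M"
  shows "integrable M (\<lambda>\<omega>. X \<omega> * Y \<omega>)"
proof (rule Bochner_Integration.integrable_bound)
  show "integrable M (\<lambda>\<omega>. (X \<omega>)\<^sup>2 + (Y \<omega>)\<^sup>2)" using assms by auto
  have "\<bar>x * y\<bar> \<le> x\<^sup>2 + y\<^sup>2" for x y :: real
  proof -
    have "2 * \<bar>x\<bar> * \<bar>y\<bar> \<le> x\<^sup>2 + y\<^sup>2" using sum_squares_bound[of "\<bar>x\<bar>" "\<bar>y\<bar>"] by simp
    moreover have "0 \<le> \<bar>x\<bar> * \<bar>y\<bar>" by simp
    ultimately show ?thesis unfolding abs_mult by linarith
  qed
  then show "AE \<omega> in M. norm (X \<omega> * Y \<omega>) \<le> norm ((X \<omega>)\<^sup>2 + (Y \<omega>)\<^sup>2)" by auto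
qed auto

text \<open>Holds the global properties of \<open>class_S\<close>. The local expansion at time 1 is
  passed as an explicit assumption to the lemmas that bound the variogram ratio.\<close>

locale self_similar_gaussian = prob_space M for M :: "'a measure" +
  fixes Y :: "real \<Rightarrow> 'a \<Rightarrow> real" and \<alpha> :: real
  assumes gp: "gaussian_process M Y" and cen: "centered M Y" and cont: "ae_continuous_paths M Y"
    and ss: "self_similar M (\<alpha> / 2) Y" and var1: "variance (Y 1) = 1" and \<alpha>: "\<alpha> > 0"
begin

definition cov :: "real \<Rightarrow> real \<Rightarrow> real" where
  "cov s t = expectation (\<lambda>\<omega>. Y s \<omega> * Y t \<omega>)"

lemma Y_gaussian: "t \<ge> 0 \<Longrightarrow> gaussian_rv M (Y t)"
  using gp[unfolded gaussian_process_def, rule_format, of "{t}" "\<lambda>_. 1"] by simp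

lemma Y_mean: "t \<ge> 0 \<Longrightarrow> expectation (Y t) = 0"
  using cen by (simp add: centered_def)

lemma Y_measurable[measurable]: "t \<ge> 0 \<Longrightarrow> Y t \<in> borel_measurable M"
  by (rule gaussian_rv_iexp(1)[OF prob_space_axioms Y_gaussian Y_mean])

lemma Y_square_integrable: "t \<ge> 0 \<Longrightarrow> integrable M (\<lambda>\<omega>. (Y t \<omega>)\<^sup>2)"
  by (rule gaussian_rv_iexp(2)[OF prob_space_axioms Y_gaussian Y_mean])

lemma Y_integrable: "t \<ge> 0 \<Longrightarrow> integrable M (Y t)"
  by (rule square_integrable_imp_integrable) (auto simp: Y_square_integrable)

lemma Y_mult_integrable: "s \<ge> 0 \<Longrightarrow> t \<ge> 0 \<Longrightarrow> integrable M (\<lambda>\<omega>. Y s \<omega> * Y t \<omega>)"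
  by (intro integrable_mult_of_squares Y_square_integrable Y_measurable)

lemma cov_sym: "cov s t = cov t s"
  by (simp add: cov_def mult.commute)

lemma incr_var_eq: 
  assumes "s \<ge> 0" "t \<ge> 0" 
  shows "incr_var M Y s t = cov s s + cov t t - 2 * cov s t"
proof -
  have "expectation (\<lambda>\<omega>. Y s \<omega> - Y t \<omega>) = 0" using assms by (simp add: Y_integrable Y_mean)
  then have "incr_var M Y s t = expectation (\<lambda>\<omega>. Y s \<omega> * Y s \<omega> + Y t \<omega> * Y t \<omega> - 2 * (Y s \<omega> * Y t \<omega>))"
    unfolding incr_var_def by (simp add: power2_eq_square algebra_simps)
  then show ?thesis unfolding cov_def using assms by (simp add: Y_mult_integrable)
qed

lemma incr_var_nonneg: "incr_var M Y s t \<ge> 0"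
  unfolding incr_var_def by (rule variance_positive)

lemma process_gaussian_vector:
  assumes "finite I" "inj_on \<tau> I" "\<And>i. i \<in> I \<Longrightarrow> \<tau> i \<ge> 0"
  shows "gaussian_vector M I (\<lambda>i \<omega>. r * Y (\<tau> i) \<omega>) (\<lambda>i j. r\<^sup>2 * cov (\<tau> i) (\<tau> j))"
  unfolding gaussian_vector_def
proof (intro conjI ballI allI)
  show "prob_space M" "finite I" by (fact prob_space_axioms, fact assms)
  show "(\<lambda>\<omega>. r * Y (\<tau> i) \<omega>) \<in> borel_measurable M" if "i \<in> I" for i using assms(3)[OF that] by measurable
  show "r\<^sup>2 * cov (\<tau> i) (\<tau> j) = r\<^sup>2 * cov (\<tau> j) (\<tau> i)" for i j by (simp add: cov_sym)
  fix c
  define S where "S \<omega> = (\<Sum>i\<in>I. c i * (r * Y (\<tau> i) \<omega>))" for \<omega>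
  \<comment> \<open>\<open>gaussian_process\<close> speaks of sums over sets of times, so the sum
    over indices is rewritten along \<open>\<tau>\<close>; its injectivity determines the
    coefficient at each time.\<close>
  have S: "S = (\<lambda>\<omega>. \<Sum>t\<in>\<tau> ` I. (c (the_inv_into I \<tau> t) * r) * Y t \<omega>)"
    unfolding S_def using assms by (subst sum.reindex) (auto simp: the_inv_into_f_f mult.assoc)
  have gS: "gaussian_rv M S"
    unfolding S by (rule gp[unfolded gaussian_process_def, rule_format]) (use assms in auto)
  have ES: "expectation S = 0"
  proof -
    have "expectation S = (\<Sum>i\<in>I. expectation (\<lambda>\<omega>. c i * (r * Y (\<tau> i) \<omega>)))"
      unfolding S_def by (intro Bochner_Integration.integral_sum integrable_mult_right Y_integrable assms(3))
    also have "\<dots> = (\<Sum>i\<in>I. 0)" by (intro sum.cong refl) (simp only: integral_mult_right_zero Y_mean assms(3) mult_zero_right)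
    finally show ?thesis by simp
  qed
  have sq: "(S \<omega>)\<^sup>2 = (\<Sum>i\<in>I. \<Sum>j\<in>I. c i * c j * r\<^sup>2 * (Y (\<tau> i) \<omega> * Y (\<tau> j) \<omega>))" for \<omega>
    unfolding S_def power2_eq_square sum_product by (intro sum.cong refl) (simp only: mult_ac)
  have "expectation (\<lambda>\<omega>. (S \<omega>)\<^sup>2) = (\<Sum>i\<in>I. expectation (\<lambda>\<omega>. \<Sum>j\<in>I. c i * c j * r\<^sup>2 * (Y (\<tau> i) \<omega> * Y (\<tau> j) \<omega>)))"
    unfolding sq by (intro Bochner_Integration.integral_sum Bochner_Integration.integrable_sum integrable_mult_right Y_mult_integrable assms(3))
  also have "\<dots> = (\<Sum>i\<in>I. \<Sum>j\<in>I. expectation (\<lambda>\<omega>. c i * c j * r\<^sup>2 * (Y (\<tau> i) \<omega> * Y (\<tau> j) \<omega>)))"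
    by (intro sum.cong refl Bochner_Integration.integral_sum integrable_mult_right Y_mult_integrable assms(3))
  also have "\<dots> = (\<Sum>i\<in>I. \<Sum>j\<in>I. c i * c j * r\<^sup>2 * cov (\<tau> i) (\<tau> j))"
    unfolding cov_def by (simp only: integral_mult_right_zero)
  finally have "expectation (\<lambda>\<omega>. (S \<omega>)\<^sup>2) = (\<Sum>i\<in>I. \<Sum>j\<in>I. c i * c j * (r\<^sup>2 * cov (\<tau> i) (\<tau> j)))" by (simp add: mult.assoc)
  with gaussian_rv_iexp(3)[OF prob_space_axioms gS ES, of 1]
  show "(CLINT \<omega>|M. iexp (\<Sum>i\<in>I. c i * (r * Y (\<tau> i) \<omega>))) = of_real (exp (- (\<Sum>i\<in>I. \<Sum>j\<in>I. c i * c j * (r\<^sup>2 * cov (\<tau> i) (\<tau> j))) / 2))"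
    unfolding S_def by simp
qed

text \<open>Self-similarity equates two measures on path space. Integrating the product of the
  coordinates at \<open>s\<close> and \<open>t\<close> against both transfers it to covariances, the
  index \<alpha>/2 being counted twice.\<close>

lemma cov_scale:
  assumes a: "a > 0" and st: "s \<ge> 0" "t \<ge> 0"
  shows "cov (a * s) (a * t) = a powr \<alpha> * cov s t"
proof -
  let ?P = "\<Pi>\<^sub>M t\<in>{0..}. (borel :: real measure)"
  have law: "process_law M (\<lambda>t. Y (a * t)) = process_law M (\<lambda>t \<omega>. a powr (\<alpha> / 2) * Y t \<omega>)"
    using ss a by (simp add: self_similar_def)
  have m1: "(\<lambda>\<omega>. \<lambda>t\<in>{0..}. Y (a * t) \<omega>) \<in> measurable M ?P" using a by (intro measurable_restrict Y_measurable) auto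
  have m2: "(\<lambda>\<omega>. \<lambda>t\<in>{0..}. a powr (\<alpha> / 2) * Y t \<omega>) \<in> measurable M ?P" by (intro measurable_restrict) auto
  have g: "(\<lambda>w. w s * w t) \<in> borel_measurable ?P" using st by (intro borel_measurable_times measurable_component_singleton) auto
  have "cov (a * s) (a * t) = (LINT w|process_law M (\<lambda>t. Y (a * t)). w s * w t)"
    unfolding process_law_def integral_distr[OF m1 g] cov_def using st by simp
  also have "\<dots> = expectation (\<lambda>\<omega>. (a powr (\<alpha> / 2) * Y s \<omega>) * (a powr (\<alpha> / 2) * Y t \<omega>))"
    unfolding law unfolding process_law_def integral_distr[OF m2 g] using st by simp
  also have "\<dots> = expectation (\<lambda>\<omega>. a powr \<alpha> * (Y s \<omega> * Y t \<omega>))"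
  proof -
    have "a powr \<alpha> = a powr (\<alpha> / 2) * a powr (\<alpha> / 2)" by (simp add: powr_add[symmetric])
    then show ?thesis by (simp add: mult_ac)
  qed
  finally show ?thesis by (simp add: cov_def)
qed

lemma incr_var_scale:
  assumes "a > 0" "s \<ge> 0" "t \<ge> 0"
  shows "incr_var M Y (a * s) (a * t) = a powr \<alpha> * incr_var M Y s t"
  using assms by (simp add: incr_var_eq cov_scale algebra_simps)

lemma cov_diag: "t \<ge> 0 \<Longrightarrow> cov t t = t powr \<alpha>"
proof -
  assume t: "t \<ge> 0"
  have c1: "cov 1 1 = 1" using var1 Y_mean[of 1] by (simp add: cov_def power2_eq_square)
  show ?thesis
  proof (cases "t = 0")
    case True
    \<comment> \<open>Time 0 is fixed by scaling, so its variance is multiplied by a factor above 1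
      and yet unchanged.\<close>
    have "cov 0 0 = 2 powr \<alpha> * cov 0 0" using cov_scale[of 2 0 0] by simp
    moreover have "2 powr \<alpha> > (1::real)" using \<alpha> by simp
    ultimately have "cov 0 0 = 0" by auto
    then show ?thesis using True by simp
  next
    case False
    then show ?thesis using cov_scale[of t 1 1] c1 t by simp
  qed
qed

lemma Y_continuous: "AE \<omega> in M. continuous_on {0..} (\<lambda>t. Y t \<omega>)"
  using cont by (simp add: ae_continuous_paths_def)

lemma Y_zero: "AE \<omega> in M. Y 0 \<omega> = 0"
proof -
  have "expectation (\<lambda>\<omega>. (Y 0 \<omega>)\<^sup>2) = 0" using cov_diag[of 0] by (simp add: cov_def power2_eq_square)
  then show ?thesis using Y_square_integrable[of 0] by (subst (asm) integral_nonneg_eq_0_iff_AE) auto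
qed

end

lemma class_S_imp_self_similar_gaussian:
  assumes "prob_space M" "\<alpha> > 0" "class_S M \<alpha> \<kappa> c Y"
  shows "self_similar_gaussian M Y \<alpha>"
proof -
  interpret prob_space M by fact
  show ?thesis by unfold_locales (use assms in \<open>auto simp: class_S_def\<close>)
qed

section \<open>Gaussian random walks\<close>

text \<open>Infinite sequences, so that splitting off one coordinate leaves a sequence with the same
  law. Recursions over the length of the walk then stay on a single space.\<close>

definition seq_normal :: "(nat \<Rightarrow> real) measure" where
  "seq_normal = PiM UNIV (\<lambda>_. std_normal_distribution)"

lemma sequence_space_std_normal: "sequence_space std_normal_distribution"
proof -
  interpret real_distribution std_normal_distribution by (rule real_dist_normal_dist)
  show ?thesis unfolding sequence_space_def by (intro product_prob_spaceI prob_space_axioms)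
qed

lemma prob_space_std_normal: "prob_space std_normal_distribution"
  using real_dist_normal_dist by (simp add: real_distribution_def)

lemma prob_space_seq_normal: "prob_space seq_normal"
  unfolding seq_normal_def by (intro prob_space_PiM prob_space_std_normal)

lemma measurable_seq_normal_component[measurable]: "(\<lambda>\<omega>. \<omega> i) \<in> borel_measurable seq_normal"
proof -
  have "(\<lambda>\<omega>. \<omega> i) \<in> measurable seq_normal std_normal_distribution"
    unfolding seq_normal_def by (rule measurable_component_singleton) simp
  then show ?thesis by (simp cong: measurable_cong_sets)
qed

lemma measurable_case_nat_seq_normal:
  "(\<lambda>z. case_nat (fst z) (snd z)) \<in> measurable (std_normal_distribution \<Otimes>\<^sub>M seq_normal) seq_normal"
proof -
  have "(\<lambda>z. case_nat (fst z) (snd z) i) \<in> measurable (std_normal_distribution \<Otimes>\<^sub>M seq_normal) std_normal_distribution" for i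
    by (cases i) (simp_all cong: measurable_cong_sets)
  then show ?thesis unfolding seq_normal_def by (intro measurable_PiM_single') (auto simp: space_PiM)
qed

lemma distr_case_nat_seq_normal:
  "distr (std_normal_distribution \<Otimes>\<^sub>M seq_normal) seq_normal (\<lambda>z. case_nat (fst z) (snd z)) = seq_normal"
  using sequence_space.PiM_iter[OF sequence_space_std_normal] by (simp add: seq_normal_def split_beta')

lemma seq_normal_iexp:
  "(CLINT \<omega>|seq_normal. iexp (\<Sum>i<n. a i * \<omega> i)) = of_real (exp (- (\<Sum>i<n. (a i)\<^sup>2) / 2))"
proof (induction n arbitrary: a)
  case 0
  interpret prob_space seq_normal by (rule prob_space_seq_normal)
  show ?case by (simp add: prob_space)
next
  case (Suc n)
  have "(CLINT \<omega>|seq_normal. iexp (\<Sum>i<Suc n. a i * \<omega> i))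
    = (CLINT z|(std_normal_distribution \<Otimes>\<^sub>M seq_normal). iexp (\<Sum>i<Suc n. a i * case_nat (fst z) (snd z) i))"
    by (subst distr_case_nat_seq_normal[symmetric], subst integral_distr[OF measurable_case_nat_seq_normal]) auto
  also have "\<dots> = (CLINT z|(std_normal_distribution \<Otimes>\<^sub>M seq_normal). iexp (a 0 * fst z + (\<Sum>i<n. a (Suc i) * snd z i)))"
    by (simp only: sum.lessThan_Suc_shift nat.case)
  also have "\<dots> = (CLINT x|std_normal_distribution. iexp (a 0 * x)) * (CLINT \<omega>|seq_normal. iexp (\<Sum>i<n. a (Suc i) * \<omega> i))"
    by (rule integral_iexp_pair[OF prob_space_std_normal prob_space_seq_normal]) auto
  also have "(CLINT x|std_normal_distribution. iexp (a 0 * x)) = of_real (exp (- (a 0)\<^sup>2 / 2))"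
    using char_std_normal_distribution unfolding char_def by (metis)
  also have "of_real (exp (- (a 0)\<^sup>2 / 2)) * (CLINT \<omega>|seq_normal. iexp (\<Sum>i<n. a (Suc i) * \<omega> i))
     = of_real (exp (- (\<Sum>i<Suc n. (a i)\<^sup>2) / 2))"
    unfolding Suc.IH of_real_mult[symmetric] exp_add[symmetric] sum.lessThan_Suc_shift by (simp add: add_divide_distrib)
  finally show ?case .
qed

lemma walk_gaussian_vector:
  "gaussian_vector seq_normal {..n} (\<lambda>k \<omega>. r * (\<Sum>i<k. \<omega> i)) (\<lambda>k l. r\<^sup>2 * real (min k l))"
  unfolding gaussian_vector_def
proof (intro conjI ballI allI)
  fix c :: "nat \<Rightarrow> real"
  \<comment> \<open>\<open>b k i\<close> records whether step \<open>i\<close> has been taken by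
    time \<open>k\<close>. It rewrites a combination of positions as one of independent steps, and
    summing \<open>b k i * b l i\<close> over \<open>i\<close> gives the covariance
    \<open>min k l\<close>.\<close>
  define b where "b k i = (if i < k then 1 else 0 :: real)" for k i :: nat
  define a where "a i = (\<Sum>k\<le>n. b k i * (c k * r))" for i
  have lin: "(\<Sum>k\<le>n. c k * (r * (\<Sum>i<k. \<omega> i))) = (\<Sum>i<n. a i * \<omega> i)" for \<omega> :: "nat \<Rightarrow> real"
  proof -
    have "(\<Sum>k\<le>n. c k * (r * (\<Sum>i<k. \<omega> i))) = (\<Sum>k\<le>n. \<Sum>i<n. b k i * (c k * r) * \<omega> i)"
    proof (rule sum.cong[OF refl])
      fix k assume k: "k \<in> {..n}"
      have "(\<Sum>i<n. b k i * (c k * r) * \<omega> i) = (\<Sum>i<k. b k i * (c k * r) * \<omega> i)"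
        using k by (intro sum.mono_neutral_right) (auto simp: b_def)
      also have "\<dots> = (\<Sum>i<k. c k * r * \<omega> i)" by (intro sum.cong) (auto simp: b_def)
      finally show "c k * (r * (\<Sum>i<k. \<omega> i)) = (\<Sum>i<n. b k i * (c k * r) * \<omega> i)" by (simp add: sum_distrib_left mult.assoc)
    qed
    also have "\<dots> = (\<Sum>i<n. a i * \<omega> i)" unfolding a_def sum_distrib_right by (rule sum.swap)
    finally show ?thesis .
  qed
  have bm: "(\<Sum>i<n. b k i * b l i) = real (min k l)" if "k \<le> n" "l \<le> n" for k l
  proof -
    have "(\<Sum>i<n. b k i * b l i) = (\<Sum>i<min k l. b k i * b l i)"
      using that by (intro sum.mono_neutral_right) (auto simp: b_def)
    also have "\<dots> = (\<Sum>i<min k l. 1)" by (intro sum.cong) (auto simp: b_def)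
    finally show ?thesis by simp
  qed
  have "(\<Sum>i<n. (a i)\<^sup>2) = (\<Sum>i<n. \<Sum>k\<le>n. \<Sum>l\<le>n. c k * c l * r\<^sup>2 * (b k i * b l i))"
    unfolding a_def power2_eq_square sum_product by (intro sum.cong refl) (simp only: mult_ac)
  also have "\<dots> = (\<Sum>k\<le>n. \<Sum>l\<le>n. \<Sum>i<n. c k * c l * r\<^sup>2 * (b k i * b l i))"
    by (rule trans[OF sum.swap]) (intro sum.cong[OF refl] sum.swap)
  also have "\<dots> = (\<Sum>k\<le>n. \<Sum>l\<le>n. c k * c l * (r\<^sup>2 * real (min k l)))"
    by (intro sum.cong refl) (simp add: sum_distrib_left[symmetric] bm)
  finally show "(CLINT \<omega>|seq_normal. iexp (\<Sum>k\<le>n. c k * (r * (\<Sum>i<k. \<omega> i)))) = of_real (exp (- (\<Sum>k\<le>n. \<Sum>l\<le>n. c k * c l * (r\<^sup>2 * real (min k l))) / 2))"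
    unfolding lin seq_normal_iexp by simp
qed (auto simp: prob_space_seq_normal min.commute)

definition walk_max :: "real \<Rightarrow> real \<Rightarrow> nat \<Rightarrow> (nat \<Rightarrow> real) \<Rightarrow> real" where
  "walk_max r m n \<omega> = Max ((\<lambda>k. exp (\<Sum>i<k. r * \<omega> i - m)) ` {..n})"

lemma walk_max_measurable[measurable]: "walk_max r m n \<in> borel_measurable seq_normal"
  unfolding walk_max_def[abs_def] by measurable

lemma walk_max_0: "walk_max r m 0 \<omega> = 1"
  by (simp add: walk_max_def)

lemma walk_max_ge_1: "walk_max r m n \<omega> \<ge> 1"
  unfolding walk_max_def by (intro Max_ge) (auto intro!: image_eqI[of _ _ 0])

lemma walk_max_mono: "walk_max r m n \<omega> \<le> walk_max r m (Suc n) \<omega>"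
  unfolding walk_max_def by (intro Max_mono) auto

text \<open>Lindley's recursion in multiplicative form. The split is made at the initial step, so
  the remaining factor is the same functional of the shifted sequence and is independent of
  \<open>x\<close>.\<close>

lemma walk_max_Suc: "walk_max r m (Suc n) (case_nat x \<omega>) = max 1 (exp (r * x - m) * walk_max r m n \<omega>)"
proof -
  have "(\<lambda>k. exp (\<Sum>i<k. r * case_nat x \<omega> i - m)) ` {..Suc n}
    = insert 1 ((\<lambda>k. exp (r * x - m) * exp (\<Sum>i<k. r * \<omega> i - m)) ` {..n})"
    unfolding atMost_Suc_eq_insert_0 image_insert image_image
    by (simp add: sum.lessThan_Suc_shift exp_add del: sum.lessThan_Suc)
  moreover have "Max ((\<lambda>k. exp (r * x - m) * exp (\<Sum>i<k. r * \<omega> i - m)) ` {..n}) = exp (r * x - m) * walk_max r m n \<omega>"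
    unfolding walk_max_def
    using mono_Max_commute[of "\<lambda>y. exp (r * x - m) * y" "(\<lambda>k. exp (\<Sum>i<k. r * \<omega> i - m)) ` {..n}"]
    by (simp add: mono_def image_image)
  ultimately show ?thesis by (simp add: walk_max_def[of _ _ "Suc n"])
qed

lemma nn_integral_seq_normal_shift:
  assumes [measurable]: "f \<in> borel_measurable seq_normal"
  shows "(\<integral>\<^sup>+\<omega>. f \<omega> \<partial>seq_normal) = (\<integral>\<^sup>+x. \<integral>\<^sup>+\<omega>. f (case_nat x \<omega>) \<partial>seq_normal \<partial>std_normal_distribution)"
proof -
  interpret prob_space seq_normal by (rule prob_space_seq_normal)
  have "(\<integral>\<^sup>+\<omega>. f \<omega> \<partial>seq_normal) = (\<integral>\<^sup>+z. f (case_nat (fst z) (snd z)) \<partial>(std_normal_distribution \<Otimes>\<^sub>M seq_normal))"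
    by (subst distr_case_nat_seq_normal[symmetric], subst nn_integral_distr[OF measurable_case_nat_seq_normal]) auto
  also have "\<dots> = (\<integral>\<^sup>+x. \<integral>\<^sup>+\<omega>. f (case_nat x \<omega>) \<partial>seq_normal \<partial>std_normal_distribution)"
    using measurable_compose[OF measurable_case_nat_seq_normal assms] by (subst nn_integral_fst[symmetric]) auto
  finally show ?thesis .
qed

text \<open>The Laplace transform of one step. With the later choice of \<open>r\<close> and
  \<open>m\<close> it is used at \<open>a = 1\<close>, where it equals
  \<open>exp (- (R * \<delta>))\<close>, and at \<open>a = 1 + R / C\<close>, where it equals
  1.\<close>

lemma integral_step_exp:
  "integrable std_normal_distribution (\<lambda>x. exp (a * (r * x - m)))"
  "(LINT x|std_normal_distribution. exp (a * (r * x - m))) = exp (a\<^sup>2 * r\<^sup>2 / 2 - a * m)"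
proof -
  have e: "exp (a * (r * x - m)) = exp (- a * m) * exp ((a * r) * x)" for x
    by (simp add: exp_add[symmetric] algebra_simps)
  show "integrable std_normal_distribution (\<lambda>x. exp (a * (r * x - m)))"
    unfolding e by (intro integrable_mult_right integrable_std_normal_exp)
  show "(LINT x|std_normal_distribution. exp (a * (r * x - m))) = exp (a\<^sup>2 * r\<^sup>2 / 2 - a * m)"
    unfolding e integral_mult_right_zero integral_std_normal_exp by (simp add: exp_add[symmetric] power_mult_distrib)
qed

text \<open>The inequality \<open>exp u \<ge> 1 + u\<close> is applied at \<open>(l - 1) * z\<close>
  and at \<open>- z\<close>; the terms linear in \<open>z\<close> cancel because
  \<open>K * (l - 1) = 1\<close>.\<close>

lemma supermartingale_ineq:
  fixes K l z :: real
  assumes "K > 0" "K * (l - 1) = 1" "z \<ge> 0"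
  shows "exp z * (1 + K) \<le> 1 + K * exp (l * z)"
proof -
  have "exp z * (K * (1 + (l - 1) * z)) \<le> exp z * (K * exp ((l - 1) * z))"
    using assms by (intro mult_left_mono) auto
  also have "\<dots> = K * exp (l * z)" by (simp add: exp_add[symmetric] algebra_simps)
  finally have a: "exp z * (K + K * (l - 1) * z) \<le> K * exp (l * z)" by (simp add: algebra_simps)
  have "exp z * (1 - z) \<le> exp z * exp (- z)" using exp_ge_add_one_self[of "- z"] by (intro mult_left_mono) auto
  then have "exp z * (1 - z) \<le> 1" by (simp add: exp_add[symmetric])
  with a show ?thesis unfolding assms(2) by (simp add: algebra_simps)
qed

section \<open>Upper bound for the maximum of the walk, uniform in the mesh\<close>

context
  fixes C R \<delta> r m :: real
  assumes C: "C > 0" and R: "R > 0" and \<delta>: "\<delta> > 0"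
    and r: "r\<^sup>2 = 2 * C * \<delta>" and m: "m = (C + R) * \<delta>"
begin

text \<open>The bound is the value of \<open>E (max (exp y) (exp S))\<close> for \<open>S\<close> exponential with rate \<open>1 + R / C\<close>,
  the law of the supremum of the Brownian motion that the walk discretises.\<close>

lemma walk_max_upper_aux:
  assumes "y \<ge> 0"
  shows "(\<integral>\<^sup>+\<omega>. ennreal (max (exp y) (walk_max r m n \<omega>)) \<partial>seq_normal) \<le> ennreal (exp y + C / R * exp (- (R / C) * y))"
  using assms
proof (induction n arbitrary: y)
  case 0
  interpret prob_space seq_normal by (rule prob_space_seq_normal)
  show ?case using 0 C R by (simp add: walk_max_0 emeasure_space_1 max_def)
next
  case (Suc n)
  define K where "K = C / R"
  \<comment> \<open>The Lundberg exponent: the nonzero root of the equation that the exponential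
    moment of a step equals 1. Averaging the bound over one step therefore reproduces it
    exactly.\<close>
  define l where "l = 1 + R / C"
  have K: "K > 0" "K * (l - 1) = 1" and l1: "l - 1 = R / C" using C R by (auto simp: K_def l_def)
  have step: "(\<integral>\<^sup>+\<omega>. ennreal (max (exp y) (walk_max r m (Suc n) (case_nat x \<omega>))) \<partial>seq_normal)
     \<le> ennreal (exp y + K * exp (- (R / C) * y) * exp (l * (r * x - m)))" for x
  proof -
    define \<xi> where "\<xi> = r * x - m"
    \<comment> \<open>Seen from the position \<open>\<xi>\<close> after one step, the level
      \<open>y\<close> lies at \<open>y - \<xi>\<close>. It is cut off at 0 because the induction
      hypothesis asks for a nonnegative level; nothing is lost, as \<open>walk_max\<close> is at
      least 1.\<close>
    have le: "max (exp y) (walk_max r m (Suc n) (case_nat x \<omega>)) \<le> exp \<xi> * max (exp (max 0 (y - \<xi>))) (walk_max r m n \<omega>)" for \<omega>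
    proof -
      have y1: "exp y \<ge> 1" using Suc.prems by simp
      have "max (exp y) (walk_max r m (Suc n) (case_nat x \<omega>)) = max (exp y) (exp \<xi> * walk_max r m n \<omega>)"
        unfolding walk_max_Suc \<xi>_def[symmetric] using y1 by (subst max.assoc[symmetric]) (simp add: max_absorb1)
      also have "\<dots> = exp \<xi> * max (exp (y - \<xi>)) (walk_max r m n \<omega>)"
        unfolding max_mult_distrib_left by (simp add: exp_diff)
      also have "\<dots> \<le> exp \<xi> * max (exp (max 0 (y - \<xi>))) (walk_max r m n \<omega>)"
        by (intro mult_left_mono max.mono) auto
      finally show ?thesis .
    qed
    have "(\<integral>\<^sup>+\<omega>. ennreal (max (exp y) (walk_max r m (Suc n) (case_nat x \<omega>))) \<partial>seq_normal)
      \<le> (\<integral>\<^sup>+\<omega>. ennreal (exp \<xi>) * ennreal (max (exp (max 0 (y - \<xi>))) (walk_max r m n \<omega>)) \<partial>seq_normal)"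
      by (intro nn_integral_mono, subst ennreal_mult'[symmetric]) (auto intro!: ennreal_leI le)
    also have "\<dots> = ennreal (exp \<xi>) * (\<integral>\<^sup>+\<omega>. ennreal (max (exp (max 0 (y - \<xi>))) (walk_max r m n \<omega>)) \<partial>seq_normal)"
      by (rule nn_integral_cmult) measurable
    also have "\<dots> \<le> ennreal (exp \<xi>) * ennreal (exp (max 0 (y - \<xi>)) + C / R * exp (- (R / C) * max 0 (y - \<xi>)))"
      by (intro mult_left_mono Suc.IH) auto
    also have "\<dots> = ennreal (exp \<xi> * (exp (max 0 (y - \<xi>)) + K * exp (- (R / C) * max 0 (y - \<xi>))))"
      using C R by (simp add: ennreal_mult' K_def)
    also have "\<dots> \<le> ennreal (exp y + K * exp (- (R / C) * y) * exp (l * \<xi>))"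
    proof (rule ennreal_leI, cases "y - \<xi> \<ge> 0")
      case True
      then have "exp \<xi> * (exp (max 0 (y - \<xi>)) + K * exp (- (R / C) * max 0 (y - \<xi>))) = exp y + K * exp (- (R / C) * y) * exp (l * \<xi>)"
        by (simp add: distrib_left exp_add[symmetric] l_def) (simp add: algebra_simps diff_divide_distrib flip: exp_add)
      then show "exp \<xi> * (exp (max 0 (y - \<xi>)) + K * exp (- (R / C) * max 0 (y - \<xi>))) \<le> exp y + K * exp (- (R / C) * y) * exp (l * \<xi>)" by simp
    next
      \<comment> \<open>The step has crossed the level, with overshoot \<open>\<xi> - y\<close>.
        Here the exact formula is replaced by an upper bound of the same shape as in the other
        case.\<close>
      case False
      then have "exp \<xi> * (exp (max 0 (y - \<xi>)) + K * exp (- (R / C) * max 0 (y - \<xi>))) = exp y * (exp (\<xi> - y) * (1 + K))"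
        by (simp add: exp_diff)
      also have "\<dots> \<le> exp y * (1 + K * exp (l * (\<xi> - y)))"
        using False by (intro mult_left_mono supermartingale_ineq K) auto
      also have "\<dots> = exp y + K * exp (- (R / C) * y) * exp (l * \<xi>)"
        unfolding l1[symmetric] by (simp add: distrib_left exp_add[symmetric] mult.left_commute) (simp add: algebra_simps)
      finally show "exp \<xi> * (exp (max 0 (y - \<xi>)) + K * exp (- (R / C) * max 0 (y - \<xi>))) \<le> exp y + K * exp (- (R / C) * y) * exp (l * \<xi>)" .
    qed
    finally show ?thesis unfolding \<xi>_def .
  qed
  have "(\<integral>\<^sup>+\<omega>. ennreal (max (exp y) (walk_max r m (Suc n) \<omega>)) \<partial>seq_normal)
    \<le> (\<integral>\<^sup>+x. ennreal (exp y + K * exp (- (R / C) * y) * exp (l * (r * x - m))) \<partial>std_normal_distribution)"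
    by (subst nn_integral_seq_normal_shift, measurable) (intro nn_integral_mono step)
  also have "\<dots> = ennreal (LINT x|std_normal_distribution. exp y + K * exp (- (R / C) * y) * exp (l * (r * x - m)))"
    by (intro nn_integral_eq_integral Bochner_Integration.integrable_add integrable_mult_right integral_step_exp)
      (use K in \<open>auto intro!: add_nonneg_nonneg simp: prob_space.finite_measure[OF prob_space_std_normal] finite_measure.integrable_const\<close>)
  also have "(LINT x|std_normal_distribution. exp y + K * exp (- (R / C) * y) * exp (l * (r * x - m))) = exp y + K * exp (- (R / C) * y)"
  proof -
    interpret prob_space std_normal_distribution by (rule prob_space_std_normal)
    have "prob UNIV = 1" using prob_space by simp
    moreover have "l\<^sup>2 * r\<^sup>2 / 2 - l * m = 0" unfolding r m l_def using C by (simp add: field_simps power2_eq_square)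
    ultimately show ?thesis
      by (subst Bochner_Integration.integral_add) (auto intro!: integrable_mult_right integral_step_exp(1) simp: integral_step_exp(2) prob_space)
  qed
  finally show ?case unfolding K_def .
qed

lemma walk_max_upper: "(\<integral>\<^sup>+\<omega>. ennreal (walk_max r m n \<omega>) \<partial>seq_normal) \<le> ennreal (1 + C / R)"
proof -
  have "(\<integral>\<^sup>+\<omega>. ennreal (walk_max r m n \<omega>) \<partial>seq_normal) \<le> (\<integral>\<^sup>+\<omega>. ennreal (max (exp 0) (walk_max r m n \<omega>)) \<partial>seq_normal)"
    by (intro nn_integral_mono ennreal_leI) simp
  also have "\<dots> \<le> ennreal (1 + C / R)" using walk_max_upper_aux[of 0 n] by simp
  finally show ?thesis .
qed

end

section \<open>Lower bound for the maximum of the walk as the mesh vanishes\<close>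

lemma integral_pair_fst_eq:
  fixes f :: "'a \<Rightarrow> real"
  assumes "prob_space M" "prob_space N" "f \<in> borel_measurable M"
  shows "(LINT z|(M \<Otimes>\<^sub>M N). f (fst z)) = (LINT x|M. f x)"
proof -
  interpret N: prob_space N by fact
  have "(LINT z|(M \<Otimes>\<^sub>M N). f (fst z)) = (LINT x|distr (M \<Otimes>\<^sub>M N) M fst. f x)"
    by (rule integral_distr[symmetric]) (use assms in auto)
  then show ?thesis by (simp add: N.distr_pair_fst)
qed

lemma integral_pair_snd_eq:
  fixes f :: "'b \<Rightarrow> real"
  assumes "prob_space M" "prob_space N" "integrable N f"
  shows "(LINT z|(M \<Otimes>\<^sub>M N). f (snd z)) = (LINT x|N. f x)"
proof -
  interpret M: prob_space M by fact
  interpret N: prob_space N by fact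
  interpret P: pair_prob_space M N ..
  show ?thesis using P.integral_fst'[OF integrable_pair_snd[OF assms]] by (simp add: M.prob_space)
qed

lemma integral_seq_normal_shift:
  fixes f :: "(nat \<Rightarrow> real) \<Rightarrow> real"
  assumes f: "f \<in> borel_measurable seq_normal"
  shows "(LINT \<omega>|seq_normal. f \<omega>) = (LINT z|(std_normal_distribution \<Otimes>\<^sub>M seq_normal). f (case_nat (fst z) (snd z)))"
    and "integrable seq_normal f \<Longrightarrow> integrable (std_normal_distribution \<Otimes>\<^sub>M seq_normal) (\<lambda>z. f (case_nat (fst z) (snd z)))"
proof -
  show "(LINT \<omega>|seq_normal. f \<omega>) = (LINT z|(std_normal_distribution \<Otimes>\<^sub>M seq_normal). f (case_nat (fst z) (snd z)))"
    by (subst distr_case_nat_seq_normal[symmetric]) (rule integral_distr[OF measurable_case_nat_seq_normal f])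
  assume "integrable seq_normal f"
  then have "integrable (distr (std_normal_distribution \<Otimes>\<^sub>M seq_normal) seq_normal (\<lambda>z. case_nat (fst z) (snd z))) f"
    by (simp only: distr_case_nat_seq_normal)
  then show "integrable (std_normal_distribution \<Otimes>\<^sub>M seq_normal) (\<lambda>z. f (case_nat (fst z) (snd z)))"
    by (rule integrable_distr[OF measurable_case_nat_seq_normal])
qed

text \<open>For \<open>w \<le> \<eta>\<close> the loss against \<open>w\<close> is quadratic, hence
  at most \<open>\<eta> * w\<close>. For larger \<open>w\<close> the subtracted term already exceeds
  \<open>w\<close>, because \<open>w * \<eta> ^ 3 \<le> w ^ 4 \<le> x ^ 4\<close>, and the left side
  is not positive.\<close>

lemma one_minus_exp_lower:
  fixes w x \<eta> :: real
  assumes "0 \<le> w" "w \<le> \<bar>x\<bar>" "0 < \<eta>"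
  shows "(1 - \<eta>) * w - x ^ 4 / \<eta> ^ 3 \<le> 1 - exp (- w)"
proof -
  have x4: "w ^ 4 \<le> x ^ 4" using power_mono[of w "\<bar>x\<bar>" 4] assms by simp
  show ?thesis
  proof (cases "w \<le> \<eta>")
    case True
    have "exp (- w) * (1 + w) \<le> exp (- w) * exp w" using exp_ge_add_one_self[of w] by (intro mult_left_mono) auto
    then have a: "exp (- w) * (1 + w) \<le> 1" by (simp add: exp_add[symmetric])
    have "(1 - w + w * w) * (1 + w) = 1 + w ^ 3" by (simp add: algebra_simps power3_eq_cube)
    moreover have "0 \<le> w ^ 3" using assms by simp
    ultimately have "exp (- w) * (1 + w) \<le> (1 - w + w * w) * (1 + w)" using a by linarith
    then have "exp (- w) \<le> 1 - w + w * w" using assms by (simp add: mult_le_cancel_right)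
    moreover have "w * w \<le> \<eta> * w" using True assms by (intro mult_right_mono) auto
    moreover have "0 \<le> x ^ 4 / \<eta> ^ 3" using assms by simp
    ultimately show ?thesis by (simp add: left_diff_distrib)
  next
    case False
    have "w * \<eta> ^ 3 \<le> w * w ^ 3" using False assms by (intro mult_left_mono power_mono) auto
    also have "\<dots> \<le> x ^ 4" using x4 by (simp add: power_Suc[symmetric] del: power_Suc) 
    finally have "w \<le> x ^ 4 / \<eta> ^ 3" using assms by (simp add: field_simps)
    moreover have "(1 - \<eta>) * w \<le> w" using assms by (simp add: left_diff_distrib)
    moreover have "exp (- w) \<le> 1" using assms by simp
    ultimately show ?thesis by linarith
  qed
qed

context
  fixes C R \<delta> r m :: real
  assumes C: "C > 0" and R: "R > 0" and \<delta>: "\<delta> > 0"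
    and r: "r\<^sup>2 = 2 * C * \<delta>" and m: "m = (C + R) * \<delta>"
begin

lemma integrable_walk_max: "integrable seq_normal (walk_max r m n)"
proof (rule integrableI_bounded)
  have "(\<integral>\<^sup>+\<omega>. ennreal (norm (walk_max r m n \<omega>)) \<partial>seq_normal) = (\<integral>\<^sup>+\<omega>. ennreal (walk_max r m n \<omega>) \<partial>seq_normal)"
    using walk_max_ge_1[of r m n] by (intro nn_integral_cong) (auto simp: abs_of_nonneg order_trans[OF zero_le_one])
  also have "\<dots> < \<infinity>" using walk_max_upper[OF C R \<delta> r m, of n] by (simp add: le_less_trans)
  finally show "(\<integral>\<^sup>+\<omega>. ennreal (norm (walk_max r m n \<omega>)) \<partial>seq_normal) < \<infinity>" .
qed measurable

lemma integrable_ln_walk_max: "integrable seq_normal (\<lambda>\<omega>. ln (walk_max r m n \<omega>))"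
proof (rule Bochner_Integration.integrable_bound[OF integrable_walk_max])
  have "norm (ln (walk_max r m n \<omega>)) \<le> norm (walk_max r m n \<omega>)" for \<omega>
    using walk_max_ge_1[of r m n \<omega>] ln_bound[of "walk_max r m n \<omega>"] by simp
  then show "AE \<omega> in seq_normal. norm (ln (walk_max r m n \<omega>)) \<le> norm (walk_max r m n \<omega>)" by simp
qed measurable

text \<open>Writing \<open>w\<close> for the undershoot below \<open>0\<close> in Lindley's recursion for \<open>ln (walk_max r m n)\<close>, the
  expected maximum gains \<open>E (1 - exp (- w))\<close> in each step. Since the mean of \<open>ln (walk_max r m n)\<close> is
  nondecreasing in \<open>n\<close>, \<open>E w\<close> is at least the drift \<open>m\<close>; the fourth moment of a step, which is of order
  \<open>\<delta>\<^sup>2\<close>, controls the loss from large undershoots.\<close>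

lemma walk_max_recursion:
  assumes \<eta>: "0 < \<eta>" "\<eta> < 1"
  shows "exp (- (R * \<delta>)) * (LINT \<omega>|seq_normal. walk_max r m n \<omega>) + ((1 - \<eta>) * m - 8 * (3 * r ^ 4 + m ^ 4) / \<eta> ^ 3)
     \<le> (LINT \<omega>|seq_normal. walk_max r m (Suc n) \<omega>)"
proof -
  let ?w = "walk_max r m n" and ?w' = "walk_max r m (Suc n)"
  note pN = prob_space_std_normal and pS = prob_space_seq_normal
  interpret N: prob_space std_normal_distribution by (rule pN)
  interpret S: prob_space seq_normal by (rule pS)
  interpret P: pair_prob_space std_normal_distribution seq_normal ..
  define Q where "Q = std_normal_distribution \<Otimes>\<^sub>M seq_normal"
  have pQ: "prob_space Q" unfolding Q_def by (rule P.prob_space_axioms)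
  interpret Q: prob_space Q by (rule pQ)
  define \<xi> where "\<xi> z = r * fst z - m" for z :: "real \<times> (nat \<Rightarrow> real)"
  define V where "V z = exp (\<xi> z) * ?w (snd z)" for z
  define w where "w z = max 0 (- (\<xi> z + ln (?w (snd z))))" for z
  have [measurable]: "\<xi> \<in> borel_measurable Q" "V \<in> borel_measurable Q" "w \<in> borel_measurable Q"
    unfolding \<xi>_def[abs_def] V_def[abs_def] w_def[abs_def] Q_def by measurable
  have wm1: "?w \<omega> \<ge> 1" "?w \<omega> > 0" "0 \<le> ln (?w \<omega>)" for \<omega>
    using walk_max_ge_1[of r m n \<omega>] by (auto intro: ln_ge_zero)
  have Vln: "V z = exp (\<xi> z + ln (?w (snd z)))" for z
    unfolding V_def exp_add using wm1 by simp
  have w0: "0 \<le> w z" and wle: "w z \<le> \<bar>\<xi> z\<bar>" for z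
    unfolding w_def using wm1(3)[of "snd z"] by auto
  \<comment> \<open>If \<open>V z < 1\<close> then \<open>exp (- w z)\<close> is \<open>V z\<close>
    itself and the sum is 1; otherwise \<open>w z = 0\<close>.\<close>
  have Suc1: "?w' (case_nat (fst z) (snd z)) = V z + (1 - exp (- w z))" for z
    unfolding walk_max_Suc \<xi>_def[symmetric] V_def[symmetric] by (auto simp: w_def Vln max_def)
  have Suc2: "ln (?w' (case_nat (fst z) (snd z))) = \<xi> z + ln (?w (snd z)) + w z" for z
    unfolding walk_max_Suc \<xi>_def[symmetric] V_def[symmetric] by (auto simp: w_def Vln max_def)
  have step_int: "integrable std_normal_distribution (\<lambda>x. r * x - m)" "(LINT x|std_normal_distribution. r * x - m) = - m"
    using integrable_std_normal_distribution_moment[of 1] integral_std_normal_distribution_moment_odd[of 1] N.prob_space by auto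
  have i\<xi>: "integrable Q \<xi>" unfolding \<xi>_def Q_def by (rule integrable_pair_fst[OF pN pS step_int(1)])
  have E\<xi>: "(LINT z|Q. \<xi> z) = - m" unfolding \<xi>_def Q_def by (subst integral_pair_fst_eq[OF pN pS]) (auto simp: step_int(2))
  have iln: "integrable Q (\<lambda>z. ln (?w (snd z)))" unfolding Q_def by (rule integrable_pair_snd[OF pN pS integrable_ln_walk_max])
  have Eln: "(LINT z|Q. ln (?w (snd z))) = (LINT \<omega>|seq_normal. ln (?w \<omega>))" 
    unfolding Q_def by (rule integral_pair_snd_eq[OF pN pS integrable_ln_walk_max])
  have iw: "integrable Q w"
    by (rule Bochner_Integration.integrable_bound[OF i\<xi>]) (use w0 wle in auto)
  have "(LINT \<omega>|seq_normal. ln (?w \<omega>)) \<le> (LINT \<omega>|seq_normal. ln (?w' \<omega>))"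
    using wm1(2) walk_max_mono[of r m n] by (intro integral_mono integrable_ln_walk_max) (auto intro!: ln_mono)
  also have "\<dots> = (LINT z|Q. ln (?w' (case_nat (fst z) (snd z))))"
    unfolding Q_def by (rule integral_seq_normal_shift) measurable
  also have "\<dots> = (LINT z|Q. \<xi> z) + (LINT z|Q. ln (?w (snd z))) + (LINT z|Q. w z)"
    unfolding Suc2 using i\<xi> iln iw by simp
  finally have Ew: "m \<le> (LINT z|Q. w z)" unfolding E\<xi> Eln by simp
  \<comment> \<open>The factor 8 comes from using
    \<open>(a - b)\<^sup>2 \<le> 2 * (a\<^sup>2 + b\<^sup>2)\<close> and its analogue for sums in
    succession; 3 is the fourth moment of a standard normal variable.\<close>
  have i4: "integrable std_normal_distribution (\<lambda>x. (r * x - m) ^ 4)" 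
    and E4: "(LINT x|std_normal_distribution. (r * x - m) ^ 4) \<le> 8 * (3 * r ^ 4 + m ^ 4)"
  proof -
    have ib: "integrable std_normal_distribution (\<lambda>x. 8 * (r ^ 4 * x ^ 4 + m ^ 4))"
      by (intro integrable_mult_right Bochner_Integration.integrable_add integrable_std_normal_distribution_moment) auto
    have b: "(r * x - m) ^ 4 \<le> 8 * (r ^ 4 * x ^ 4 + m ^ 4)" for x
    proof -
      have sq: "(a - b)\<^sup>2 \<le> 2 * (a\<^sup>2 + b\<^sup>2)" "(a + b)\<^sup>2 \<le> 2 * (a\<^sup>2 + b\<^sup>2)" for a b :: real
        using zero_le_power2[of "a + b"] zero_le_power2[of "a - b"] by (auto simp: power2_eq_square algebra_simps)
      have "(r * x - m) ^ 4 = ((r * x - m)\<^sup>2)\<^sup>2" by simp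
      also have "\<dots> \<le> (2 * ((r * x)\<^sup>2 + m\<^sup>2))\<^sup>2" by (intro power_mono sq) auto
      also have "\<dots> = 4 * ((r * x)\<^sup>2 + m\<^sup>2)\<^sup>2" unfolding power_mult_distrib[of 2] by simp
      also have "\<dots> \<le> 4 * (2 * (((r * x)\<^sup>2)\<^sup>2 + (m\<^sup>2)\<^sup>2))" by (intro mult_left_mono sq) auto
      also have "\<dots> = 8 * (r ^ 4 * x ^ 4 + m ^ 4)" by (simp add: power_mult_distrib)
      finally show ?thesis .
    qed
    show i: "integrable std_normal_distribution (\<lambda>x. (r * x - m) ^ 4)"
      by (rule Bochner_Integration.integrable_bound[OF ib]) (use b in \<open>auto intro!: AE_I2 order_trans[OF _ abs_ge_self]\<close>)
    have "(LINT x|std_normal_distribution. (r * x - m) ^ 4) \<le> (LINT x|std_normal_distribution. 8 * (r ^ 4 * x ^ 4 + m ^ 4))"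
      by (intro integral_mono i ib b)
    also have "\<dots> = 8 * (r ^ 4 * (LINT x|std_normal_distribution. x ^ 4) + m ^ 4)"
      using integrable_std_normal_distribution_moment[of 4] N.prob_space by simp
    also have "(LINT x|std_normal_distribution. x ^ 4) = 3"
      using std_normal_distribution_even_moments(1)[of 2] by (simp add: fact_numeral)
    also have "8 * (r ^ 4 * 3 + m ^ 4) = 8 * (3 * r ^ 4 + m ^ 4)" by simp
    finally show "(LINT x|std_normal_distribution. (r * x - m) ^ 4) \<le> 8 * (3 * r ^ 4 + m ^ 4)" .
  qed
  have i4Q: "integrable Q (\<lambda>z. (\<xi> z) ^ 4)" unfolding \<xi>_def Q_def by (rule integrable_pair_fst[OF pN pS i4])
  have E4Q: "(LINT z|Q. (\<xi> z) ^ 4) \<le> 8 * (3 * r ^ 4 + m ^ 4)"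
    unfolding \<xi>_def Q_def integral_pair_fst_eq[OF pN pS borel_measurable_integrable[OF i4]] by (rule E4)
  have ie: "integrable Q (\<lambda>z. 1 - exp (- w z))"
    by (rule integrable_bounded_real[OF pQ, where B=1]) (use w0 in \<open>auto simp: abs_le_iff intro: order_trans[of _ 0] less_imp_le\<close>)
  have "(1 - \<eta>) * m - 8 * (3 * r ^ 4 + m ^ 4) / \<eta> ^ 3 \<le> (1 - \<eta>) * (LINT z|Q. w z) - (LINT z|Q. (\<xi> z) ^ 4) / \<eta> ^ 3"
    using \<eta> Ew E4Q by (intro diff_mono mult_left_mono divide_right_mono) auto
  also have "\<dots> = (LINT z|Q. (1 - \<eta>) * w z - (\<xi> z) ^ 4 / \<eta> ^ 3)"
    using iw i4Q by simp
  also have "\<dots> \<le> (LINT z|Q. 1 - exp (- w z))"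
    using iw i4Q ie \<eta> by (intro integral_mono one_minus_exp_lower w0 wle) auto
  finally have b: "(1 - \<eta>) * m - 8 * (3 * r ^ 4 + m ^ 4) / \<eta> ^ 3 \<le> (LINT z|Q. 1 - exp (- w z))" .
  have iSuc: "integrable Q (\<lambda>z. ?w' (case_nat (fst z) (snd z)))"
    unfolding Q_def by (rule integral_seq_normal_shift(2)[OF walk_max_measurable integrable_walk_max])
  have iV: "integrable Q V"
    using Bochner_Integration.integrable_diff[OF iSuc ie] unfolding Suc1 by simp
  have EV: "(LINT z|Q. V z) = exp (- (R * \<delta>)) * (LINT \<omega>|seq_normal. ?w \<omega>)"
  proof -
    have "(LINT z|Q. V z) = (LINT x|std_normal_distribution. LINT \<omega>|seq_normal. exp (r * x - m) * ?w \<omega>)"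
      unfolding Q_def
      by (subst P.integral_fst'[OF iV[unfolded Q_def], symmetric]) (simp only: V_def \<xi>_def fst_conv snd_conv)
    also have "\<dots> = (LINT x|std_normal_distribution. exp (1 * (r * x - m))) * (LINT \<omega>|seq_normal. ?w \<omega>)"
      by (simp only: integral_mult_right_zero integral_mult_left_zero mult_1)
    also have "(LINT x|std_normal_distribution. exp (1 * (r * x - m))) = exp (- (R * \<delta>))"
      unfolding integral_step_exp(2) r m by (simp add: algebra_simps)
    finally show ?thesis .
  qed
  have "(LINT \<omega>|seq_normal. ?w' \<omega>) = (LINT z|Q. V z + (1 - exp (- w z)))"
    unfolding Q_def integral_seq_normal_shift(1)[OF walk_max_measurable] Suc1 ..
  also have "\<dots> = (LINT z|Q. V z) + (LINT z|Q. 1 - exp (- w z))" by (rule Bochner_Integration.integral_add[OF iV ie])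
  finally show ?thesis using b EV by simp
qed

text \<open>The affine recursion of \<open>walk_max_recursion\<close>, iterated from a nonnegative
  start; the quotient is the finite geometric sum of \<open>exp (- (R * \<delta>))\<close>.\<close>

lemma walk_max_lower_geometric:
  assumes \<eta>: "0 < \<eta>" "\<eta> < 1"
  shows "((1 - \<eta>) * m - 8 * (3 * r ^ 4 + m ^ 4) / \<eta> ^ 3) * ((1 - exp (- (R * \<delta>)) ^ n) / (1 - exp (- (R * \<delta>))))
     \<le> (LINT \<omega>|seq_normal. walk_max r m n \<omega>)"
proof (induction n)
  case 0
  have "0 \<le> (LINT \<omega>|seq_normal. walk_max r m 0 \<omega>)" by (rule Bochner_Integration.integral_nonneg) (simp add: walk_max_0)
  then show ?case by simp
next
  case (Suc n)
  define q where "q = exp (- (R * \<delta>))"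
  define b where "b = (1 - \<eta>) * m - 8 * (3 * r ^ 4 + m ^ 4) / \<eta> ^ 3"
  have q: "q > 0" "q < 1" unfolding q_def using R \<delta> by auto
  have "b * ((1 - q ^ Suc n) / (1 - q)) = q * (b * ((1 - q ^ n) / (1 - q))) + b"
    using q by (simp add: field_simps)
  also have "\<dots> \<le> q * (LINT \<omega>|seq_normal. walk_max r m n \<omega>) + b"
    using Suc.IH q by (intro add_right_mono mult_left_mono) (auto simp: q_def b_def)
  also have "\<dots> \<le> (LINT \<omega>|seq_normal. walk_max r m (Suc n) \<omega>)"
    unfolding q_def b_def by (rule walk_max_recursion[OF \<eta>])
  finally show ?case unfolding q_def b_def .
qed

end

text \<open>With mesh \<open>\<delta> = \<eta> ^ 4\<close> the error term, of order
  \<open>\<delta>\<^sup>2 / \<eta> ^ 3\<close>, is of order \<open>\<eta> * \<delta>\<close> and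
  thus small against the drift \<open>m\<close>; 4 is the least integer exponent for which this
  works. Letting the number of steps grow gives \<open>b / (1 - q)\<close>, which is at least
  \<open>b / (R * \<delta>) = g \<eta>\<close>, and \<open>g \<eta>\<close> tends to
  \<open>(C + R) / R\<close>.\<close>

lemma walk_max_lower:
  assumes C: "C > 0" and R: "R > 0" and B: "B < 1 + C / R"
  shows "\<exists>\<delta>>0. \<exists>n. ennreal B \<le> (\<integral>\<^sup>+\<omega>. ennreal (walk_max (sqrt (2 * C * \<delta>)) ((C + R) * \<delta>) n \<omega>) \<partial>seq_normal)"
proof -
  define \<mu> where "\<mu> = C + R"
  define g where "g \<eta> = ((1 - \<eta>) * \<mu> - 8 * (12 * C\<^sup>2 + \<mu> ^ 4 * \<eta> ^ 8) * \<eta>) / R" for \<eta>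
  have "(g \<longlongrightarrow> g 0) (at_right 0)" unfolding g_def using R by (intro tendsto_intros) auto
  moreover have g0: "g 0 = 1 + C / R" unfolding g_def \<mu>_def using R by (simp add: field_simps)
  \<comment> \<open>Staying above 0 as well as above \<open>B\<close> makes the gain
    \<open>b\<close> positive, as is needed when the denominator \<open>R * \<delta>\<close> is
    replaced by the smaller \<open>1 - q\<close>.\<close>
  ultimately have "eventually (\<lambda>\<eta>. max 0 B < g \<eta>) (at_right 0)"
    by (intro order_tendstoD) (use B C R in \<open>auto intro: add_pos_pos\<close>)
  moreover have "eventually (\<lambda>\<eta>::real. \<eta> < 1) (at_right 0)" by (intro eventually_at_rightI[of 0 1]) auto
  ultimately have "eventually (\<lambda>\<eta>. max 0 B < g \<eta> \<and> \<eta> < 1 \<and> \<eta> > 0) (at_right 0)"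
    using eventually_at_right_less[of 0] by eventually_elim auto
  then obtain \<eta> where \<eta>: "max 0 B < g \<eta>" "\<eta> < 1" "0 < \<eta>"
    using eventually_happens[of _ "at_right (0::real)"] by fastforce
  define \<delta> where "\<delta> = \<eta> ^ 4"
  define r where "r = sqrt (2 * C * \<delta>)"
  define m where "m = (C + R) * \<delta>"
  define b where "b = (1 - \<eta>) * m - 8 * (3 * r ^ 4 + m ^ 4) / \<eta> ^ 3"
  define q where "q = exp (- (R * \<delta>))"
  have \<delta>: "\<delta> > 0" using \<eta> by (simp add: \<delta>_def)
  have r2: "r\<^sup>2 = 2 * C * \<delta>" using C \<delta> by (simp add: r_def)
  have "r ^ 4 = (r\<^sup>2)\<^sup>2" by simp
  then have r4: "r ^ 4 = 4 * C\<^sup>2 * \<eta> ^ 8" unfolding r2 \<delta>_def by (simp add: power_mult_distrib)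
  have bg: "b = g \<eta> * (R * \<delta>)"
  proof -
    have "8 * (3 * r ^ 4 + m ^ 4) / \<eta> ^ 3 = 8 * (12 * C\<^sup>2 + \<mu> ^ 4 * \<eta> ^ 8) * \<eta> * \<delta>"
      unfolding r4 m_def \<mu>_def[symmetric] \<delta>_def power_mult_distrib power_mult[symmetric] using \<eta>
      by (simp add: field_simps eval_nat_numeral)
    moreover have "g \<eta> * (R * \<delta>) = ((1 - \<eta>) * \<mu> - 8 * (12 * C\<^sup>2 + \<mu> ^ 4 * \<eta> ^ 8) * \<eta>) * \<delta>"
      unfolding g_def using R by simp
    moreover have "(1 - \<eta>) * m = (1 - \<eta>) * \<mu> * \<delta>" unfolding m_def \<mu>_def by simp
    ultimately show ?thesis unfolding b_def by (simp only: left_diff_distrib[of _ _ \<delta>])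
  qed
  have b0: "b > 0" unfolding bg using \<eta> R \<delta> by (intro mult_pos_pos) auto
  have q: "0 < q" "q < 1" "1 - q \<le> R * \<delta>" unfolding q_def using R \<delta> exp_ge_add_one_self[of "- (R * \<delta>)"] by auto
  have "g \<eta> = b / (R * \<delta>)" unfolding bg using R \<delta> by simp
  also have "\<dots> \<le> b / (1 - q)" using b0 q R \<delta> by (intro divide_left_mono) auto
  finally have gb: "g \<eta> \<le> b / (1 - q)" .
  have "(\<lambda>n. b * ((1 - q ^ n) / (1 - q))) \<longlonglongrightarrow> b * ((1 - 0) / (1 - q))"
    using q by (intro tendsto_intros LIMSEQ_realpow_zero) auto
  moreover have "B < b * ((1 - 0) / (1 - q))" using \<eta>(1) gb by auto
  ultimately have "eventually (\<lambda>n. B < b * ((1 - q ^ n) / (1 - q))) sequentially" by (rule order_tendstoD)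
  then obtain n where n: "B < b * ((1 - q ^ n) / (1 - q))" by (auto simp: eventually_sequentially)
  also have "\<dots> \<le> (LINT \<omega>|seq_normal. walk_max r m n \<omega>)"
    unfolding b_def q_def by (rule walk_max_lower_geometric[OF C R \<delta> r2 m_def]) (use \<eta> in auto)
  finally have "ennreal B \<le> ennreal (LINT \<omega>|seq_normal. walk_max r m n \<omega>)" by (intro ennreal_leI) simp
  also have "\<dots> = (\<integral>\<^sup>+\<omega>. ennreal (walk_max r m n \<omega>) \<partial>seq_normal)"
    by (rule nn_integral_eq_integral[symmetric, OF integrable_walk_max[OF C R \<delta> r2 m_def]])
      (auto intro: order_trans[OF zero_le_one walk_max_ge_1])
  finally show ?thesis unfolding r_def m_def using \<delta> by blast
qed

section \<open>The linear Gaussian process\<close>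

lemma linear_gaussian_vector:
  "gaussian_vector std_normal_distribution {..n} (\<lambda>k x. r * real k * x) (\<lambda>k l. r\<^sup>2 * (real k * real l))"
  unfolding gaussian_vector_def
proof (intro conjI ballI allI)
  fix c :: "nat \<Rightarrow> real"
  define a where "a = (\<Sum>k\<le>n. c k * (r * real k))"
  have lin: "(\<Sum>k\<le>n. c k * (r * real k * x)) = a * x" for x unfolding a_def sum_distrib_right by (intro sum.cong) auto
  have "a\<^sup>2 = (\<Sum>k\<le>n. \<Sum>l\<le>n. c k * c l * (r\<^sup>2 * (real k * real l)))"
    unfolding a_def power2_eq_square sum_product by (intro sum.cong refl) (simp only: mult_ac)
  moreover have "(CLINT x|std_normal_distribution. iexp (a * x)) = of_real (exp (- (a\<^sup>2) / 2))"
    using char_std_normal_distribution unfolding char_def by metis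
  ultimately show "(CLINT x|std_normal_distribution. iexp (\<Sum>k\<le>n. c k * (r * real k * x)))
      = of_real (exp (- (\<Sum>k\<le>n. \<Sum>l\<le>n. c k * c l * (r\<^sup>2 * (real k * real l))) / 2))"
    unfolding lin by simp
qed (auto simp: prob_space_std_normal)

lemma nn_integral_std_normal_uminus:
  assumes [measurable]: "f \<in> borel_measurable borel"
  shows "(\<integral>\<^sup>+x. f (- x) \<partial>std_normal_distribution) = (\<integral>\<^sup>+x. f x \<partial>std_normal_distribution)"
proof -
  have "(\<integral>\<^sup>+x. f (- x) \<partial>std_normal_distribution) = (\<integral>\<^sup>+x. ennreal (std_normal_density (- x)) * f (- x) \<partial>lborel)"
    by (subst nn_integral_density) (auto simp: normal_density_def)
  also have "\<dots> = (\<integral>\<^sup>+x. ennreal (std_normal_density x) * f x \<partial>distr lborel borel uminus)"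
    by (subst nn_integral_distr) auto
  also have "distr lborel borel uminus = (lborel :: real measure)" by (rule lborel_distr_uminus)
  finally show ?thesis by (subst (2) nn_integral_density) auto
qed

lemma nn_integral_std_normal_exp_square:
  assumes b: "b < 1"
  shows "(\<integral>\<^sup>+x. ennreal (exp (b * x\<^sup>2 / 2)) \<partial>std_normal_distribution) = ennreal (1 / sqrt (1 - b))"
proof -
  define s where "s = 1 / sqrt (1 - b)"
  have s: "s > 0" "s\<^sup>2 = 1 / (1 - b)" using b by (auto simp: s_def power_divide)
  have e: "std_normal_density x * exp (b * x\<^sup>2 / 2) = s * normal_density 0 s x" for x
  proof -
    have "- x\<^sup>2 / 2 + b * x\<^sup>2 / 2 = - (x\<^sup>2 / (2 * s\<^sup>2))" unfolding s(2) using b by (simp add: field_simps)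
    moreover have "s * (1 / sqrt (2 * pi * s\<^sup>2)) = 1 / sqrt (2 * pi)" using s(1) by (simp add: real_sqrt_mult)
    ultimately show ?thesis
      unfolding normal_density_def using s(1) by (simp add: exp_add[symmetric] field_simps real_sqrt_mult)
  qed
  have "(\<integral>\<^sup>+x. ennreal (exp (b * x\<^sup>2 / 2)) \<partial>std_normal_distribution) = (\<integral>\<^sup>+x. ennreal (s * normal_density 0 s x) \<partial>lborel)"
    by (subst nn_integral_density) (auto simp: ennreal_mult'[symmetric] e)
  also have "\<dots> = ennreal (LINT x|lborel. s * normal_density 0 s x)"
    by (rule nn_integral_eq_integral) (use s in auto)
  also have "\<dots> = ennreal s" using s by simp
  finally show ?thesis unfolding s_def .
qed

text \<open>By symmetry of the normal law, twice the integral is that of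
  \<open>h x + h (- x)\<close>, and off the null point 0 this sum is 1 plus the full exponential of
  the square.\<close>

lemma nn_integral_half_exp_square:
  assumes b: "0 \<le> b" "b < 1"
  shows "(\<integral>\<^sup>+x. ennreal (if x > 0 then exp (b * x\<^sup>2 / 2) else 1) \<partial>std_normal_distribution) = ennreal (1 / 2 * (1 + 1 / sqrt (1 - b)))"
proof -
  interpret prob_space std_normal_distribution by (rule prob_space_std_normal)
  define h where "h x = ennreal (if x > 0 then exp (b * x\<^sup>2 / 2) else 1)" for x :: real
  let ?I = "\<integral>\<^sup>+x. h x \<partial>std_normal_distribution"
  have [measurable]: "h \<in> borel_measurable borel" unfolding h_def by measurable
  have ae: "AE x in std_normal_distribution. x \<noteq> (0::real)"
    using AE_lborel_singleton[of "0::real"] by (subst AE_density) auto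
  have "?I + ?I
    = ?I + (\<integral>\<^sup>+x. h (- x) \<partial>std_normal_distribution)"
    by (simp add: nn_integral_std_normal_uminus)
  also have "\<dots> = (\<integral>\<^sup>+x. h x + h (- x) \<partial>std_normal_distribution)"
    by (rule nn_integral_add[symmetric]) auto
  also have "\<dots> = (\<integral>\<^sup>+x. 1 + ennreal (exp (b * x\<^sup>2 / 2)) \<partial>std_normal_distribution)"
    using ae by (intro nn_integral_cong_AE) (auto elim!: eventually_mono simp: h_def add.commute)
  also have "\<dots> = 1 + ennreal (1 / sqrt (1 - b))"
    using b emeasure_space_1 by (subst nn_integral_add) (auto simp: nn_integral_std_normal_exp_square)
  also have "\<dots> = ennreal (1 + 1 / sqrt (1 - b))" using b by (simp add: ennreal_plus flip: ennreal_1)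
  finally have dbl: "?I + ?I = ennreal (1 + 1 / sqrt (1 - b))" .
  then obtain a where a: "?I = ennreal a" "a \<ge> 0"
    by (cases "?I" rule: ennreal_cases) auto
  have "ennreal (a + a) = ennreal (1 + 1 / sqrt (1 - b))" 
    unfolding ennreal_plus[OF a(2) a(2)] using dbl a by simp
  then have "a + a = 1 + 1 / sqrt (1 - b)" using a b by (subst (asm) ennreal_inj) auto
  then show ?thesis using a unfolding h_def by simp
qed

section \<open>The maximum of a random parabola\<close>

context
  fixes C R :: real
  assumes C: "C > 0" and R: "R > 0"
begin

text \<open>For \<open>x > 0\<close> this is the value at the vertex of the parabola in
  \<open>s\<close>. For \<open>x \<le> 0\<close> the vertex is not to the right of 0, and the value
  at \<open>s = 0\<close> dominates.\<close>

lemma linear_max_le: 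
  fixes x s :: real
  assumes "s \<ge> 0"
  shows "exp (sqrt (2 * C) * x * s - (C + R) * s\<^sup>2) \<le> (if x > 0 then exp (C / (C + R) * x\<^sup>2 / 2) else 1)"
proof (cases "x > 0")
  case True
  define q where "q = sqrt (2 * C)"
  have q: "q\<^sup>2 = 2 * C" using C by (simp add: q_def)
  have "0 \<le> (q * x - 2 * (C + R) * s)\<^sup>2 / (4 * (C + R))" using C R by simp
  also have "\<dots> = (q\<^sup>2 * x\<^sup>2) / (4 * (C + R)) - (q * x * s - (C + R) * s\<^sup>2)"
    using C R by (simp add: field_simps power2_eq_square)
  finally have "q * x * s - (C + R) * s\<^sup>2 \<le> C / (C + R) * x\<^sup>2 / 2" unfolding q using C R by (simp add: field_simps)
  then show ?thesis using True unfolding q_def by simp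
next
  case False
  then have "sqrt (2 * C) * x * s \<le> 0" using C assms by (auto simp: mult_nonneg_nonpos mult_nonpos_nonneg)
  moreover have "0 \<le> (C + R) * s\<^sup>2" using C R by simp
  ultimately show ?thesis using False by simp
qed

lemma linear_constant: "1 / sqrt (1 - C / (C + R)) = sqrt (1 + 1 / R * C)"
proof -
  have "1 - C / (C + R) = inverse (1 + 1 / R * C)" using C R by (simp add: field_simps)
  then show ?thesis by (simp add: inverse_eq_divide real_sqrt_divide)
qed

lemma linear_max_upper:
  assumes "\<delta> \<ge> 0"
  shows "(\<integral>\<^sup>+x. ennreal (grid_max \<delta> n (\<lambda>s. sqrt (2 * C) * x * s - (C + R) * s\<^sup>2)) \<partial>std_normal_distribution)
    \<le> ennreal (1 / 2 * (1 + sqrt (1 + 1 / R * C)))"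
proof -
  have "(\<integral>\<^sup>+x. ennreal (grid_max \<delta> n (\<lambda>s. sqrt (2 * C) * x * s - (C + R) * s\<^sup>2)) \<partial>std_normal_distribution)
    \<le> (\<integral>\<^sup>+x. ennreal (if x > 0 then exp (C / (C + R) * x\<^sup>2 / 2) else 1) \<partial>std_normal_distribution)"
    using assms by (intro nn_integral_mono ennreal_leI grid_max_le linear_max_le) auto
  also have "\<dots> = ennreal (1 / 2 * (1 + sqrt (1 + 1 / R * C)))"
    using C R by (subst nn_integral_half_exp_square) (simp_all add: linear_constant del: times_divide_eq_left)
  finally show ?thesis .
qed

text \<open>Dyadic grids exhaust the supremum over a bounded interval, and \<open>h T\<close> keeps
  only those \<open>x\<close> whose vertex \<open>s0 x\<close> is at most \<open>T\<close>. Monotone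
  convergence in \<open>T\<close> recovers the whole integral.\<close>

lemma linear_max_lower:
  assumes le: "\<And>\<delta> n. \<delta> > 0 \<Longrightarrow> (\<integral>\<^sup>+x. ennreal (grid_max \<delta> n (\<lambda>s. sqrt (2 * C) * x * s - (C + R) * s\<^sup>2)) \<partial>std_normal_distribution) \<le> B"
  shows "ennreal (1 / 2 * (1 + sqrt (1 + 1 / R * C))) \<le> B"
proof -
  define s0 where "s0 x = sqrt (2 * C) * x / (2 * (C + R))" for x
  define h where "h T x = ennreal (if x > 0 \<and> s0 x \<le> real T then exp (C / (C + R) * x\<^sup>2 / 2) else 1)" for T :: nat and x
  have "ennreal (1 / 2 * (1 + sqrt (1 + 1 / R * C))) = (\<integral>\<^sup>+x. ennreal (if x > 0 then exp (C / (C + R) * x\<^sup>2 / 2) else 1) \<partial>std_normal_distribution)"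
    using C R by (subst nn_integral_half_exp_square) (simp_all add: linear_constant del: times_divide_eq_left)
  also have "\<dots> = (\<integral>\<^sup>+x. (SUP T. h T x) \<partial>std_normal_distribution)"
  proof (intro nn_integral_cong antisym)
    fix x :: real
    obtain T :: nat where "s0 x \<le> real T" using real_arch_simple by blast
    then show "ennreal (if x > 0 then exp (C / (C + R) * x\<^sup>2 / 2) else 1) \<le> (SUP T. h T x)"
      by (intro SUP_upper2[of T]) (auto simp: h_def)
    show "(SUP T. h T x) \<le> ennreal (if x > 0 then exp (C / (C + R) * x\<^sup>2 / 2) else 1)"
      using C R by (intro SUP_least) (auto simp: h_def intro!: ennreal_leI)
  qed
  also have "\<dots> = (SUP T. \<integral>\<^sup>+x. h T x \<partial>std_normal_distribution)"
  proof (rule nn_integral_monotone_convergence_SUP)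
    show "incseq h" using C R by (intro incseq_SucI le_funI) (auto simp: h_def intro!: ennreal_leI)
    have "h T \<in> borel_measurable borel" for T unfolding h_def s0_def by measurable
    then show "h T \<in> borel_measurable std_normal_distribution" for T by simp
  qed
  also have "\<dots> \<le> B"
  proof (rule SUP_least)
    fix T :: nat
    let ?g = "\<lambda>s x. sqrt (2 * C) * x * s - (C + R) * s\<^sup>2"
    \<comment> \<open>The interval ends at \<open>Suc T\<close> so that it has positive length even
      for \<open>T = 0\<close>, as the passage to dyadic grids requires.\<close>
    have hle: "h T x \<le> ennreal (exp (SUP s\<in>{0..real (Suc T)}. ?g s x))" for x
    proof -
      have bdd: "bdd_above ((\<lambda>s. ?g s x) ` {0..real (Suc T)})" by (intro cSUP_continuous_bdd continuous_intros)
      have up: "exp (?g s x) \<le> exp (SUP s\<in>{0..real (Suc T)}. ?g s x)" if "s \<in> {0..real (Suc T)}" for s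
        using cSUP_upper[OF that bdd] by simp
      show ?thesis
      proof (cases "x > 0 \<and> s0 x \<le> real T")
        case True
        have "?g (s0 x) x = (sqrt (2 * C))\<^sup>2 * x\<^sup>2 / (4 * (C + R))"
        proof -
          have e: "q * x * (q * x / (2 * a)) - a * (q * x / (2 * a))\<^sup>2 = q\<^sup>2 * x\<^sup>2 / (4 * a)" if "a > 0" for q a :: real
            using that by (simp add: field_simps power2_eq_square)
          show ?thesis unfolding s0_def by (rule e) (use C R in simp)
        qed
        also have "\<dots> = C / (C + R) * x\<^sup>2 / 2" using C R by (simp add: field_simps)
        finally have "?g (s0 x) x = C / (C + R) * x\<^sup>2 / 2" .
        moreover have "s0 x \<in> {0..real (Suc T)}" using True C R by (auto simp: s0_def)
        ultimately show ?thesis using up[of "s0 x"] True by (simp add: h_def ennreal_leI)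
      next
        case False
        then show ?thesis using up[of 0] by (auto simp: h_def ennreal_leI simp flip: ennreal_1)
      qed
    qed
    have "(\<integral>\<^sup>+x. h T x \<partial>std_normal_distribution) \<le> (\<integral>\<^sup>+x. ennreal (exp (SUP s\<in>{0..real (Suc T)}. ?g s x)) \<partial>std_normal_distribution)"
      by (intro nn_integral_mono hle)
    also have "\<dots> = (SUP n. \<integral>\<^sup>+x. ennreal (grid_max (real (Suc T) / 2 ^ n) (2 ^ n) (\<lambda>s. ?g s x)) \<partial>std_normal_distribution)"
      by (rule nn_integral_exp_SUP_eq) (auto intro!: AE_I2 continuous_intros)
    also have "\<dots> \<le> B" by (intro SUP_least le) auto
    finally show "(\<integral>\<^sup>+x. h T x \<partial>std_normal_distribution) \<le> B" .
  qed
  finally show ?thesis .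
qed

end

section \<open>Bounds for the Pickands constant\<close>

context self_similar_gaussian
begin

definition pickands_trunc :: "real \<Rightarrow> real \<Rightarrow> ennreal" where
  "pickands_trunc R T = (\<integral>\<^sup>+ \<omega>. ennreal (exp (SUP t\<in>{0..T}. sqrt 2 * Y t \<omega> - (1 + R) * t powr \<alpha>)) \<partial>M)"

abbreviation tc :: "real \<Rightarrow> real \<Rightarrow> real" where
  "tc \<kappa> s \<equiv> s powr (\<kappa> / \<alpha>)"

text \<open>The substitution \<open>t = tc \<kappa> s\<close> turns the variance \<open>t powr \<alpha>\<close> into \<open>s powr \<kappa>\<close>.\<close>

definition changed :: "real \<Rightarrow> real \<Rightarrow> real \<Rightarrow> 'a \<Rightarrow> real" where
  "changed \<kappa> R s \<omega> = sqrt 2 * Y (tc \<kappa> s) \<omega> - (1 + R) * s powr \<kappa>"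

lemma changed_measurable: "changed \<kappa> R s \<in> borel_measurable M"
  unfolding changed_def[abs_def]
  by (intro borel_measurable_diff borel_measurable_times borel_measurable_const Y_measurable powr_ge_zero)

lemma exponent_continuous: "AE \<omega> in M. continuous_on {0..T} (\<lambda>t. sqrt 2 * Y t \<omega> - (1 + R) * t powr \<alpha>)"
  using Y_continuous
proof eventually_elim
  case (elim \<omega>)
  then have "continuous_on {0..T} (\<lambda>t. Y t \<omega>)" by (rule continuous_on_subset) auto
  then show ?case using \<alpha> by (intro continuous_intros continuous_on_powr') auto
qed

lemma changed_continuous:
  assumes "\<kappa> > 0"
  shows "AE \<omega> in M. continuous_on {0..S} (\<lambda>s. changed \<kappa> R s \<omega>)"
  using Y_continuous
proof eventually_elim
  case (elim \<omega>)
  have "continuous_on {0..S} (\<lambda>s. tc \<kappa> s)" using assms \<alpha> by (intro continuous_on_powr' continuous_intros) auto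
  then have "continuous_on {0..S} (\<lambda>s. Y (tc \<kappa> s) \<omega>)"
    by (rule continuous_on_compose2[OF elim]) auto
  then show ?case unfolding changed_def using assms by (intro continuous_intros continuous_on_powr') auto
qed

lemma pickands_trunc_mono:
  assumes "0 \<le> S" "S \<le> T"
  shows "pickands_trunc R S \<le> pickands_trunc R T"
  unfolding pickands_trunc_def
proof (rule nn_integral_mono_AE)
  show "AE \<omega> in M. ennreal (exp (SUP t\<in>{0..S}. sqrt 2 * Y t \<omega> - (1 + R) * t powr \<alpha>)) \<le> ennreal (exp (SUP t\<in>{0..T}. sqrt 2 * Y t \<omega> - (1 + R) * t powr \<alpha>))"
    using exponent_continuous[of T R]
  proof eventually_elim
    case (elim \<omega>)
    from cSUP_continuous_bdd[OF elim] have "(SUP t\<in>{0..S}. sqrt 2 * Y t \<omega> - (1 + R) * t powr \<alpha>) \<le> (SUP t\<in>{0..T}. sqrt 2 * Y t \<omega> - (1 + R) * t powr \<alpha>)"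
      using assms by (intro cSUP_subset_mono) auto
    then show ?case by (intro ennreal_leI) simp
  qed
qed

lemma pickands_const_eq: "pickands_const M \<alpha> Y R = (SUP T\<in>{0..}. pickands_trunc R T)"
  unfolding pickands_const_def pickands_trunc_def[symmetric]
  by (intro tendsto_Lim tendsto_at_top_SUP_mono pickands_trunc_mono) auto

lemma pickands_trunc_changed:
  assumes \<kappa>: "\<kappa> > 0" and S: "S \<ge> 0"
  shows "pickands_trunc R (tc \<kappa> S) = (\<integral>\<^sup>+ \<omega>. ennreal (exp (SUP s\<in>{0..S}. changed \<kappa> R s \<omega>)) \<partial>M)"
proof -
  have img: "(\<lambda>s. tc \<kappa> s) ` {0..S} = {0..tc \<kappa> S}"
  proof (intro equalityI subsetI)
    fix t assume "t \<in> (\<lambda>s. tc \<kappa> s) ` {0..S}"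
    then show "t \<in> {0..tc \<kappa> S}" using \<kappa> \<alpha> by (auto intro!: powr_mono2)
  next
    fix t assume t: "t \<in> {0..tc \<kappa> S}"
    have "t = tc \<kappa> (t powr (\<alpha> / \<kappa>))" using t \<kappa> \<alpha> by (simp add: powr_powr)
    moreover have "t powr (\<alpha> / \<kappa>) \<le> (tc \<kappa> S) powr (\<alpha> / \<kappa>)" using t \<kappa> \<alpha> by (intro powr_mono2) auto
    then have "t powr (\<alpha> / \<kappa>) \<in> {0..S}" using S \<kappa> \<alpha> by (simp add: powr_powr)
    ultimately show "t \<in> (\<lambda>s. tc \<kappa> s) ` {0..S}" by (rule image_eqI)
  qed
  have "(tc \<kappa> s) powr \<alpha> = s powr \<kappa>" for s using \<alpha> by (simp add: powr_powr)
  then have "(SUP t\<in>{0..tc \<kappa> S}. sqrt 2 * Y t \<omega> - (1 + R) * t powr \<alpha>) = (SUP s\<in>{0..S}. changed \<kappa> R s \<omega>)" for \<omega>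
    unfolding img[symmetric] image_image changed_def by simp
  then show ?thesis unfolding pickands_trunc_def by simp
qed

lemma grid_le_pickands_const:
  assumes \<kappa>: "\<kappa> > 0" and \<delta>: "\<delta> > 0"
  shows "(\<integral>\<^sup>+ \<omega>. ennreal (grid_max \<delta> n (\<lambda>s. changed \<kappa> R s \<omega>)) \<partial>M) \<le> pickands_const M \<alpha> Y R"
proof -
  define S where "S = \<delta> * real n"
  have "(\<integral>\<^sup>+ \<omega>. ennreal (grid_max \<delta> n (\<lambda>s. changed \<kappa> R s \<omega>)) \<partial>M) \<le> (\<integral>\<^sup>+ \<omega>. ennreal (exp (SUP s\<in>{0..S}. changed \<kappa> R s \<omega>)) \<partial>M)"
    using changed_continuous[OF \<kappa>, of S R] \<delta>
    by (intro nn_integral_mono_AE) (auto elim!: eventually_mono intro!: ennreal_leI grid_max_le_exp_SUP simp: S_def)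
  also have "\<dots> = pickands_trunc R (tc \<kappa> S)" using \<delta> by (intro pickands_trunc_changed[symmetric] \<kappa>) (auto simp: S_def)
  also have "\<dots> \<le> pickands_const M \<alpha> Y R" unfolding pickands_const_eq by (intro SUP_upper) auto
  finally show ?thesis .
qed

text \<open>The counterpart of \<open>grid_le_pickands_const\<close>: together they reduce both
  bounds to estimates on uniform grids in the new clock, with constants independent of mesh and
  length.\<close>

lemma pickands_const_le:
  assumes \<kappa>: "\<kappa> > 0" 
    and le: "\<And>\<delta> n. \<delta> > 0 \<Longrightarrow> (\<integral>\<^sup>+ \<omega>. ennreal (grid_max \<delta> n (\<lambda>s. changed \<kappa> R s \<omega>)) \<partial>M) \<le> B"
  shows "pickands_const M \<alpha> Y R \<le> B"
  unfolding pickands_const_eq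
proof (rule SUP_least)
  fix T :: real assume T: "T \<in> {0..}"
  \<comment> \<open>Enlarging \<open>T\<close> by 1 keeps \<open>S\<close> positive, which the
    dyadic grids require; monotonicity in \<open>T\<close> pays for it.\<close>
  define S where "S = (T + 1) powr (\<alpha> / \<kappa>)"
  have S: "S > 0" using T by (simp add: S_def)
  have "T + 1 = tc \<kappa> S" using T \<kappa> \<alpha> by (simp add: S_def powr_powr)
  then have "pickands_trunc R T \<le> pickands_trunc R (tc \<kappa> S)" using T by (intro pickands_trunc_mono) auto
  also have "\<dots> = (\<integral>\<^sup>+ \<omega>. ennreal (exp (SUP s\<in>{0..S}. changed \<kappa> R s \<omega>)) \<partial>M)" using S by (intro pickands_trunc_changed \<kappa>) auto
  also have "\<dots> = (SUP n. \<integral>\<^sup>+\<omega>. ennreal (grid_max (S / 2 ^ n) (2 ^ n) (\<lambda>s. changed \<kappa> R s \<omega>)) \<partial>M)"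
    by (intro nn_integral_exp_SUP_eq changed_continuous changed_measurable S \<kappa>)
  also have "\<dots> \<le> B" using S by (intro SUP_least le) auto
  finally show "pickands_trunc R T \<le> B" .
qed

section \<open>Scaling of the variogram and comparison on grids\<close>

lemma incr_var_self: "t \<ge> 0 \<Longrightarrow> incr_var M Y t t = 0"
  by (simp add: incr_var_eq)

lemma incr_var_sym: "s \<ge> 0 \<Longrightarrow> t \<ge> 0 \<Longrightarrow> incr_var M Y s t = incr_var M Y t s"
  by (simp add: incr_var_eq cov_sym[of s t])

text \<open>Self-similarity divides both times by the larger one; \<open>x\<close> is the ratio of
  the smaller to the larger in the new clock. The variogram and the power of the distance acquire
  the same factor, so their quotient depends on \<open>x\<close> alone.\<close>

lemma incr_var_tc:
  assumes \<kappa>: "\<kappa> > 0" and su: "0 \<le> s" "0 \<le> u" "s \<noteq> u"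
  obtains x where "0 \<le> x" "x < 1"
    "incr_var M Y (tc \<kappa> s) (tc \<kappa> u) = max s u powr \<kappa> * incr_var M Y 1 (tc \<kappa> x)"
    "\<bar>s - u\<bar> powr \<kappa> = max s u powr \<kappa> * (1 - x) powr \<kappa>"
proof -
  define m where "m = max s u"
  define x where "x = min s u / m"
  have m: "m > 0" and x: "0 \<le> x" "x < 1" using su by (auto simp: m_def x_def max_def min_def divide_less_eq)
  have "incr_var M Y (tc \<kappa> m * 1) (tc \<kappa> m * tc \<kappa> x) = (tc \<kappa> m) powr \<alpha> * incr_var M Y 1 (tc \<kappa> x)"
    using m by (intro incr_var_scale) auto
  moreover have "tc \<kappa> m * tc \<kappa> x = tc \<kappa> (min s u)" using m x su by (simp add: x_def powr_mult[symmetric])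
  moreover have "(tc \<kappa> m) powr \<alpha> = m powr \<kappa>" using \<alpha> by (simp add: powr_powr)
  moreover have "incr_var M Y (tc \<kappa> s) (tc \<kappa> u) = incr_var M Y (tc \<kappa> m) (tc \<kappa> (min s u))"
    by (auto simp: m_def max_def min_def incr_var_sym)
  ultimately have e: "incr_var M Y (tc \<kappa> s) (tc \<kappa> u) = m powr \<kappa> * incr_var M Y 1 (tc \<kappa> x)" by simp
  have "\<bar>s - u\<bar> = m * (1 - x)" using m by (simp add: x_def right_diff_distrib) (auto simp: m_def)
  then have "\<bar>s - u\<bar> powr \<kappa> = m powr \<kappa> * (1 - x) powr \<kappa>" using m x by (simp add: powr_mult)
  then show thesis using that[OF x] e unfolding m_def by blast
qed

lemma incr_var_tc_upper:
  assumes \<kappa>: "\<kappa> > 0" and V: "\<And>x. 0 \<le> x \<Longrightarrow> x < 1 \<Longrightarrow> incr_var M Y 1 (tc \<kappa> x) \<le> C * (1 - x) powr \<kappa>"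
    and su: "0 \<le> s" "0 \<le> u"
  shows "incr_var M Y (tc \<kappa> s) (tc \<kappa> u) \<le> C * \<bar>s - u\<bar> powr \<kappa>"
proof (cases "s = u")
  case False
  from incr_var_tc[OF \<kappa> su this] obtain x where x: "0 \<le> x" "x < 1"
    and e: "incr_var M Y (tc \<kappa> s) (tc \<kappa> u) = max s u powr \<kappa> * incr_var M Y 1 (tc \<kappa> x)" "\<bar>s - u\<bar> powr \<kappa> = max s u powr \<kappa> * (1 - x) powr \<kappa>" .
  show ?thesis unfolding e mult.left_commute[of C] by (intro mult_left_mono V x) simp
qed (simp add: incr_var_self)

lemma incr_var_tc_lower:
  assumes \<kappa>: "\<kappa> > 0" and V: "\<And>x. 0 \<le> x \<Longrightarrow> x < 1 \<Longrightarrow> C * (1 - x) powr \<kappa> \<le> incr_var M Y 1 (tc \<kappa> x)"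
    and su: "0 \<le> s" "0 \<le> u"
  shows "C * \<bar>s - u\<bar> powr \<kappa> \<le> incr_var M Y (tc \<kappa> s) (tc \<kappa> u)"
proof (cases "s = u")
  case False
  from incr_var_tc[OF \<kappa> su this] obtain x where x: "0 \<le> x" "x < 1"
    and e: "incr_var M Y (tc \<kappa> s) (tc \<kappa> u) = max s u powr \<kappa> * incr_var M Y 1 (tc \<kappa> x)" "\<bar>s - u\<bar> powr \<kappa> = max s u powr \<kappa> * (1 - x) powr \<kappa>" .
  show ?thesis unfolding e mult.left_commute[of C] by (intro mult_left_mono V x) simp
qed (simp add: incr_var_self)

lemma changed_gaussian_vector:
  assumes "\<kappa> > 0" "\<delta> > 0"
  shows "gaussian_vector M {..n} (\<lambda>k \<omega>. sqrt 2 * Y (tc \<kappa> (\<delta> * real k)) \<omega>)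
    (\<lambda>k l. (sqrt 2)\<^sup>2 * cov (tc \<kappa> (\<delta> * real k)) (tc \<kappa> (\<delta> * real l)))"
proof (rule process_gaussian_vector)
  show "inj_on (\<lambda>k. tc \<kappa> (\<delta> * real k)) {..n}"
  proof (rule inj_onI)
    fix k l assume "tc \<kappa> (\<delta> * real k) = tc \<kappa> (\<delta> * real l)"
    then have "(tc \<kappa> (\<delta> * real k)) powr (\<alpha> / \<kappa>) = (tc \<kappa> (\<delta> * real l)) powr (\<alpha> / \<kappa>)" by simp
    then show "k = l" using assms \<alpha> by (simp add: powr_powr)
  qed
qed auto

lemma changed_exponent:
  assumes "\<kappa> > 0" "s \<ge> 0"
  shows "changed \<kappa> R s \<omega> = sqrt 2 * Y (tc \<kappa> s) \<omega> - ((sqrt 2)\<^sup>2 * cov (tc \<kappa> s) (tc \<kappa> s) / 2 + R * s powr \<kappa>)"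
proof -
  have "cov (tc \<kappa> s) (tc \<kappa> s) = s powr \<kappa>" using \<alpha> by (simp add: cov_diag powr_powr)
  then show ?thesis by (simp add: changed_def algebra_simps)
qed

lemma grid_changed_eq:
  assumes "\<kappa> > 0" "\<delta> > 0"
  shows "grid_max \<delta> n (\<lambda>s. changed \<kappa> R s \<omega>) = Max ((\<lambda>k. exp (sqrt 2 * Y (tc \<kappa> (\<delta> * real k)) \<omega>
     - ((sqrt 2)\<^sup>2 * cov (tc \<kappa> (\<delta> * real k)) (tc \<kappa> (\<delta> * real k)) / 2 + R * (\<delta> * real k) powr \<kappa>))) ` {..n})"
  unfolding grid_max_def using assms by (simp add: changed_exponent)

text \<open>The factor 2 in the condition on \<open>L\<close> is the square of the
  \<open>sqrt 2\<close> in front of \<open>Y\<close>. The penalty \<open>R * s powr \<kappa>\<close>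
  is the offset common to both vectors, so it passes through the comparison unchanged.\<close>

lemma grid_comparison_upper:
  assumes \<kappa>: "\<kappa> > 0" and \<delta>: "\<delta> > 0" and V: "\<And>x. 0 \<le> x \<Longrightarrow> x < 1 \<Longrightarrow> incr_var M Y 1 (tc \<kappa> x) \<le> C * (1 - x) powr \<kappa>"
    and W: "gaussian_vector N {..n} W L"
    and L: "\<And>k l. L k k + L l l - 2 * L k l = 2 * C * \<bar>\<delta> * real k - \<delta> * real l\<bar> powr \<kappa>"
  shows "(\<integral>\<^sup>+ \<omega>. ennreal (grid_max \<delta> n (\<lambda>s. changed \<kappa> R s \<omega>)) \<partial>M)
     \<le> (\<integral>\<^sup>+ \<omega>. ennreal (Max ((\<lambda>k. exp (W k \<omega> - (L k k / 2 + R * (\<delta> * real k) powr \<kappa>))) ` {..n})) \<partial>N)"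
  unfolding grid_changed_eq[OF \<kappa> \<delta>]
proof (rule gaussian_max_comparison[OF W changed_gaussian_vector[OF \<kappa> \<delta>]])
  fix k l
  let ?t = "\<lambda>k. tc \<kappa> (\<delta> * real k)"
  have "(sqrt 2)\<^sup>2 * cov (?t k) (?t k) + (sqrt 2)\<^sup>2 * cov (?t l) (?t l) - 2 * ((sqrt 2)\<^sup>2 * cov (?t k) (?t l)) = 2 * incr_var M Y (?t k) (?t l)"
    by (simp add: incr_var_eq)
  also have "\<dots> \<le> 2 * (C * \<bar>\<delta> * real k - \<delta> * real l\<bar> powr \<kappa>)" using \<delta> by (intro mult_left_mono incr_var_tc_upper[OF \<kappa> V]) auto
  finally show "(sqrt 2)\<^sup>2 * cov (?t k) (?t k) + (sqrt 2)\<^sup>2 * cov (?t l) (?t l) - 2 * ((sqrt 2)\<^sup>2 * cov (?t k) (?t l)) \<le> L k k + L l l - 2 * L k l"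
    unfolding L by simp
qed simp

lemma grid_comparison_lower:
  assumes \<kappa>: "\<kappa> > 0" and \<delta>: "\<delta> > 0" and V: "\<And>x. 0 \<le> x \<Longrightarrow> x < 1 \<Longrightarrow> C * (1 - x) powr \<kappa> \<le> incr_var M Y 1 (tc \<kappa> x)"
    and W: "gaussian_vector N {..n} W L"
    and L: "\<And>k l. L k k + L l l - 2 * L k l = 2 * C * \<bar>\<delta> * real k - \<delta> * real l\<bar> powr \<kappa>"
  shows "(\<integral>\<^sup>+ \<omega>. ennreal (Max ((\<lambda>k. exp (W k \<omega> - (L k k / 2 + R * (\<delta> * real k) powr \<kappa>))) ` {..n})) \<partial>N)
     \<le> (\<integral>\<^sup>+ \<omega>. ennreal (grid_max \<delta> n (\<lambda>s. changed \<kappa> R s \<omega>)) \<partial>M)"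
  unfolding grid_changed_eq[OF \<kappa> \<delta>]
proof (rule gaussian_max_comparison[OF changed_gaussian_vector[OF \<kappa> \<delta>] W])
  fix k l
  let ?t = "\<lambda>k. tc \<kappa> (\<delta> * real k)"
  have "2 * (C * \<bar>\<delta> * real k - \<delta> * real l\<bar> powr \<kappa>) \<le> 2 * incr_var M Y (?t k) (?t l)" using \<delta> by (intro mult_left_mono incr_var_tc_lower[OF \<kappa> V]) auto
  also have "\<dots> = (sqrt 2)\<^sup>2 * cov (?t k) (?t k) + (sqrt 2)\<^sup>2 * cov (?t l) (?t l) - 2 * ((sqrt 2)\<^sup>2 * cov (?t k) (?t l))"
    by (simp add: incr_var_eq)
  finally show "L k k + L l l - 2 * L k l \<le> (sqrt 2)\<^sup>2 * cov (?t k) (?t k) + (sqrt 2)\<^sup>2 * cov (?t l) (?t l) - 2 * ((sqrt 2)\<^sup>2 * cov (?t k) (?t l))"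
    unfolding L by simp
qed simp

end

text \<open>For bases in the unit interval a larger exponent gives a smaller power, so rounding
  \<gamma> up to an integer reduces the claim to Bernoulli's inequality.\<close>

lemma one_minus_powr_le:
  fixes x \<gamma> :: real
  assumes "0 \<le> x" "x \<le> 1" "\<gamma> > 0"
  shows "1 - x powr \<gamma> \<le> real (nat \<lceil>\<gamma>\<rceil>) * (1 - x)"
proof -
  define n where "n = nat \<lceil>\<gamma>\<rceil>"
  have n: "\<gamma> \<le> real n" "n \<ge> 1" using assms(3) unfolding n_def by linarith+
  have "1 + real n * (x - 1) \<le> (1 + (x - 1)) ^ n" by (rule Bernoulli_inequality) (use assms in auto)
  also have "\<dots> = x ^ n" by simp
  also have "x ^ n \<le> x powr \<gamma>"
  proof (cases "x = 0")
    case True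
    then show ?thesis using n by (simp add: zero_power)
  next
    case False
    then have "x ^ n = x powr real n" using assms by (simp add: powr_realpow)
    also have "\<dots> \<le> x powr \<gamma>" using assms n by (intro powr_mono') auto
    finally show ?thesis .
  qed
  finally show ?thesis unfolding n_def by (simp add: algebra_simps)
qed

section \<open>A priori bounds on the variogram ratio\<close>

context self_similar_gaussian
begin

lemma cov_zero: "t \<ge> 0 \<Longrightarrow> cov t 0 = 0"
proof -
  assume t: "t \<ge> 0"
  have "cov t 0 = expectation (\<lambda>_. 0)"
    unfolding cov_def using t Y_zero by (intro integral_cong_AE borel_measurable_times Y_measurable) auto
  then show ?thesis by simp
qed

lemma incr_var_le_four:
  assumes "0 \<le> t" "t \<le> 1"
  shows "incr_var M Y 1 t \<le> 4"
proof -
  have "0 \<le> expectation (\<lambda>\<omega>. (Y 1 \<omega> + Y t \<omega>)\<^sup>2)" by (rule Bochner_Integration.integral_nonneg) simp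
  also have "\<dots> = expectation (\<lambda>\<omega>. Y 1 \<omega> * Y 1 \<omega> + Y t \<omega> * Y t \<omega> + 2 * (Y 1 \<omega> * Y t \<omega>))"
    by (simp add: power2_eq_square algebra_simps)
  also have "\<dots> = cov 1 1 + cov t t + 2 * cov 1 t" unfolding cov_def using assms by (simp add: Y_mult_integrable)
  finally have "incr_var M Y 1 t \<le> 2 * (cov 1 1 + cov t t)" using assms by (simp add: incr_var_eq)
  also have "\<dots> \<le> 4"
    using assms \<alpha> powr_mono2[of \<alpha> t 1] by (simp add: cov_diag)
  finally show ?thesis .
qed

text \<open>Near \<open>x = 1\<close> the local expansion with tolerance 1 gives
  \<open>(c + 1) * h powr \<kappa>\<close> at \<open>h = 1 - tc \<kappa> x\<close>, and
  \<open>h\<close> is at most \<open>n * (1 - x)\<close> by \<open>one_minus_powr_le\<close>; the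
  threshold \<open>d / n\<close> keeps \<open>h\<close> below \<open>d\<close>. Elsewhere
  \<open>1 - x\<close> is bounded away from 0 and the crude bound 4 suffices. \<open>B\<close> is
  the larger of the two constants.\<close>

lemma incr_var_ratio_bounded:
  assumes \<kappa>: "\<kappa> > 0" and c: "c > 0"
    and S2: "(\<lambda>h. incr_var M Y 1 (1 - h) - c * \<bar>h\<bar> powr \<kappa>) \<in> o[at 0](\<lambda>h. \<bar>h\<bar> powr \<kappa>)"
  shows "\<exists>B. \<forall>x. 0 \<le> x \<and> x < 1 \<longrightarrow> incr_var M Y 1 (tc \<kappa> x) \<le> B * (1 - x) powr \<kappa>"
proof -
  from landau_o.smallD[OF S2 zero_less_one] 
  obtain d where d: "d > 0" "\<And>h. h \<noteq> 0 \<Longrightarrow> \<bar>h\<bar> < d \<Longrightarrow> \<bar>incr_var M Y 1 (1 - h) - c * \<bar>h\<bar> powr \<kappa>\<bar> \<le> \<bar>h\<bar> powr \<kappa>"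
    by (auto simp: eventually_at dist_real_def)
  define n where "n = real (nat \<lceil>\<kappa> / \<alpha>\<rceil>)"
  have n: "n \<ge> 1" using \<kappa> \<alpha> unfolding n_def by (simp add: Suc_le_eq)
  define B where "B = max ((c + 1) * n powr \<kappa>) (4 / (d / n) powr \<kappa>)"
  have "incr_var M Y 1 (tc \<kappa> x) \<le> B * (1 - x) powr \<kappa>" if x: "0 \<le> x" "x < 1" for x
  proof (cases "1 - x < d / n")
    case True
    define h where "h = 1 - tc \<kappa> x"
    have lt: "tc \<kappa> x < 1" using powr_less_mono2[of "\<kappa> / \<alpha>" x 1] x \<kappa> \<alpha> by simp
    have hn: "h \<le> n * (1 - x)" unfolding h_def n_def using x \<kappa> \<alpha> by (intro one_minus_powr_le) auto
    have h: "0 < h" "h < d"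
      using lt hn True n d(1) by (auto simp: h_def field_simps)
    have "incr_var M Y 1 (1 - h) \<le> (c + 1) * h powr \<kappa>" using d(2)[of h] h by (auto simp: algebra_simps abs_le_iff)
    also have "\<dots> \<le> (c + 1) * (n * (1 - x)) powr \<kappa>" using hn h c \<kappa> by (intro mult_left_mono powr_mono2) auto
    also have "\<dots> = (c + 1) * n powr \<kappa> * (1 - x) powr \<kappa>" using n x by (simp add: powr_mult)
    also have "\<dots> \<le> B * (1 - x) powr \<kappa>" unfolding B_def by (intro mult_right_mono) auto
    finally show ?thesis by (simp add: h_def)
  next
    case False
    have dn: "d / n > 0" using d n by simp
    have "incr_var M Y 1 (tc \<kappa> x) \<le> 4"
      using x \<kappa> \<alpha> powr_mono2[of "\<kappa> / \<alpha>" x 1] by (intro incr_var_le_four) auto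
    also have "\<dots> = 4 / (d / n) powr \<kappa> * (d / n) powr \<kappa>" using d n by simp
    also have "\<dots> \<le> 4 / (d / n) powr \<kappa> * (1 - x) powr \<kappa>"
      using False dn \<kappa> by (intro mult_left_mono powr_mono2) auto
    also have "\<dots> \<le> B * (1 - x) powr \<kappa>" unfolding B_def by (intro mult_right_mono) auto
    finally show ?thesis .
  qed
  then show ?thesis by blast
qed

text \<open>The supremum of an unbounded set of reals carries no information, so this is what makes
  the \<open>SUP\<close> in the upper bounds an actual upper bound of the ratios.\<close>

lemma incr_var_ratio_bdd_above:
  assumes \<kappa>: "\<kappa> > 0" and c: "c > 0"
    and S2: "(\<lambda>h. incr_var M Y 1 (1 - h) - c * \<bar>h\<bar> powr \<kappa>) \<in> o[at 0](\<lambda>h. \<bar>h\<bar> powr \<kappa>)"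
  shows "bdd_above ((\<lambda>x. incr_var M Y 1 (tc \<kappa> x) / (1 - x) powr \<kappa>) ` {0..<1})"
proof -
  obtain B where "\<And>x. 0 \<le> x \<Longrightarrow> x < 1 \<Longrightarrow> incr_var M Y 1 (tc \<kappa> x) \<le> B * (1 - x) powr \<kappa>"
    using incr_var_ratio_bounded[OF assms] by blast
  then have "incr_var M Y 1 (tc \<kappa> x) / (1 - x) powr \<kappa> \<le> B" if "x \<in> {0..<1}" for x
    using that by (simp add: divide_le_eq)
  then show ?thesis by (rule bdd_aboveI2)
qed

text \<open>At \<open>x = 0\<close> the ratio is the variance of \<open>Y 1\<close>, because
  \<open>Y 0\<close> vanishes almost surely. This gives \<open>C\<close> the positivity that the
  comparison processes require.\<close>

lemma incr_var_le_SUP_ratio: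
  assumes "\<kappa> > 0" and bdd: "bdd_above ((\<lambda>x. incr_var M Y 1 (tc \<kappa> x) / (1 - x) powr \<kappa>) ` {0..<1})"
  defines "C \<equiv> SUP x\<in>{0..<1}. incr_var M Y 1 (tc \<kappa> x) / (1 - x) powr \<kappa>"
  shows "1 \<le> C" and "\<And>x. 0 \<le> x \<Longrightarrow> x < 1 \<Longrightarrow> incr_var M Y 1 (tc \<kappa> x) \<le> C * (1 - x) powr \<kappa>"
proof -
  have up: "incr_var M Y 1 (tc \<kappa> x) / (1 - x) powr \<kappa> \<le> C" if "0 \<le> x" "x < 1" for x
    unfolding C_def using that by (intro cSUP_upper bdd) auto
  have "incr_var M Y 1 0 = 1" using \<alpha> by (simp add: incr_var_eq cov_diag cov_zero)
  then show "1 \<le> C" using up[of 0] by simp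
  show "incr_var M Y 1 (tc \<kappa> x) \<le> C * (1 - x) powr \<kappa>" if "0 \<le> x" "x < 1" for x
    using up[OF that] that by (simp add: divide_le_eq)
qed

text \<open>Cauchy-Schwarz: with \<open>t = x powr (2 / \<alpha>)\<close> the standard deviation of
  \<open>Y t\<close> is \<open>x\<close>, so \<open>cov 1 t \<le> x\<close>. The factor 1 on the
  left is the constant \<open>C\<close> of \<open>pickands_const_lower_2\<close>.\<close>

lemma incr_var_ge_square:
  assumes x: "0 \<le> x" "x < 1"
  shows "1 * (1 - x) powr 2 \<le> incr_var M Y 1 (x powr (2 / \<alpha>))"
proof -
  define t where "t = x powr (2 / \<alpha>)"
  have t: "t \<ge> 0" by (simp add: t_def)
  have ctt: "cov t t = x\<^sup>2" using \<alpha> x by (simp add: cov_diag t_def powr_powr)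
  have "cov 1 t \<le> x"
  proof (cases "x = 0")
    case True
    then show ?thesis by (simp add: t_def cov_zero)
  next
    case False
    \<comment> \<open>This combination makes both squares contribute \<open>x\<^sup>2\<close>, so a
      factor \<open>2 * x\<close> splits off; it can be cancelled since \<open>x\<close> is positive
      here.\<close>
    have "0 \<le> expectation (\<lambda>\<omega>. (x * Y 1 \<omega> - Y t \<omega>)\<^sup>2)" by (rule Bochner_Integration.integral_nonneg) simp
    also have "\<dots> = expectation (\<lambda>\<omega>. x\<^sup>2 * (Y 1 \<omega> * Y 1 \<omega>) + Y t \<omega> * Y t \<omega> - 2 * x * (Y 1 \<omega> * Y t \<omega>))"
      by (simp add: power2_eq_square algebra_simps)
    also have "\<dots> = x\<^sup>2 * cov 1 1 + cov t t - 2 * x * cov 1 t" unfolding cov_def using t by (simp add: Y_mult_integrable)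
    also have "\<dots> = 2 * x * (x - cov 1 t)" unfolding ctt by (simp add: cov_diag power2_eq_square algebra_simps)
    finally show ?thesis using False x by (simp add: zero_le_mult_iff)
  qed
  then show ?thesis unfolding t_def[symmetric] using x t
    by (simp add: incr_var_eq ctt cov_diag power2_eq_square algebra_simps)
qed

section \<open>Comparison with the random walk and with the random line\<close>

lemma walk_exponent:
  assumes C: "C > 0" and \<delta>: "\<delta> > 0"
  shows "Max ((\<lambda>k. exp (sqrt (2 * C * \<delta>) * (\<Sum>i<k. \<omega> i) - ((sqrt (2 * C * \<delta>))\<^sup>2 * real (min k k) / 2 + R * (\<delta> * real k) powr 1))) ` {..n})
     = walk_max (sqrt (2 * C * \<delta>)) ((C + R) * \<delta>) n \<omega>"
proof -
  have "sqrt (2 * C * \<delta>) * (\<Sum>i<k. \<omega> i) - ((sqrt (2 * C * \<delta>))\<^sup>2 * real (min k k) / 2 + R * (\<delta> * real k) powr 1)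
    = (\<Sum>i<k. sqrt (2 * C * \<delta>) * \<omega> i - (C + R) * \<delta>)" for k
  proof -
    have "(sqrt (2 * C * \<delta>))\<^sup>2 = 2 * C * \<delta>" using C \<delta> by simp
    moreover have "(\<Sum>i<k. sqrt (2 * C * \<delta>) * \<omega> i - (C + R) * \<delta>) = sqrt (2 * C * \<delta>) * (\<Sum>i<k. \<omega> i) - real k * ((C + R) * \<delta>)"
      by (simp add: sum_subtractf sum_distrib_left)
    ultimately show ?thesis using \<delta> by (simp only:) (simp add: algebra_simps)
  qed
  then show ?thesis unfolding walk_max_def by simp
qed

lemma walk_variogram:
  assumes C: "C > 0" and \<delta>: "\<delta> > 0"
  shows "(sqrt (2 * C * \<delta>))\<^sup>2 * real (min k k) + (sqrt (2 * C * \<delta>))\<^sup>2 * real (min l l) - 2 * ((sqrt (2 * C * \<delta>))\<^sup>2 * real (min k l))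
     = 2 * C * \<bar>\<delta> * real k - \<delta> * real l\<bar> powr 1"
proof -
  have "(sqrt (2 * C * \<delta>))\<^sup>2 = 2 * C * \<delta>" using C \<delta> by simp
  moreover have "\<bar>\<delta> * real k - \<delta> * real l\<bar> = \<delta> * (real k + real l - 2 * real (min k l))"
    unfolding right_diff_distrib[symmetric] abs_mult using \<delta> by (auto simp: min_def abs_if)
  moreover from this have "\<bar>\<delta> * real k - \<delta> * real l\<bar> powr 1 = \<delta> * (real k + real l - 2 * real (min k l))"
    by (metis abs_ge_zero powr_one)
  ultimately show ?thesis by (simp only: min.idem) (simp add: algebra_simps)
qed

lemma pickands_const_upper_1:
  assumes R: "R > 0" and C: "C > 0" 
    and V: "\<And>x. 0 \<le> x \<Longrightarrow> x < 1 \<Longrightarrow> incr_var M Y 1 (x powr (1 / \<alpha>)) \<le> C * (1 - x) powr 1"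
  shows "pickands_const M \<alpha> Y R \<le> ennreal (1 + C / R)"
proof (rule pickands_const_le[of 1])
  fix \<delta> :: real and n assume \<delta>: "\<delta> > 0"
  have "(\<integral>\<^sup>+ \<omega>. ennreal (grid_max \<delta> n (\<lambda>s. changed 1 R s \<omega>)) \<partial>M)
     \<le> (\<integral>\<^sup>+ \<omega>. ennreal (walk_max (sqrt (2 * C * \<delta>)) ((C + R) * \<delta>) n \<omega>) \<partial>seq_normal)"
    using grid_comparison_upper[OF zero_less_one \<delta> V walk_gaussian_vector walk_variogram[OF C \<delta>], where R=R]
    unfolding walk_exponent[OF C \<delta>] .
  also have "\<dots> \<le> ennreal (1 + C / R)"
    using C \<delta> by (intro walk_max_upper[OF C R \<delta>]) auto
  finally show "(\<integral>\<^sup>+ \<omega>. ennreal (grid_max \<delta> n (\<lambda>s. changed 1 R s \<omega>)) \<partial>M) \<le> ennreal (1 + C / R)" .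
qed simp

text \<open>Time 0 alone contributes the value 1. This serves the case \<open>C = 0\<close> of the
  lower bound, where the comparison walk has no positive step variance.\<close>

lemma one_le_pickands_const: "1 \<le> pickands_const M \<alpha> Y R"
proof -
  have "AE \<omega> in M. grid_max 1 0 (\<lambda>s. changed 1 R s \<omega>) = 1"
    using Y_zero by eventually_elim (simp add: grid_max_def changed_def)
  then have "(\<integral>\<^sup>+ \<omega>. ennreal (grid_max 1 0 (\<lambda>s. changed 1 R s \<omega>)) \<partial>M) = (\<integral>\<^sup>+ \<omega>. 1 \<partial>M)"
    by (intro nn_integral_cong_AE) (auto elim!: eventually_mono)
  then show ?thesis using grid_le_pickands_const[of 1 1 0 R] by (simp add: emeasure_space_1)
qed

lemma pickands_const_lower_1:
  assumes R: "R > 0" and C: "C \<ge> 0" 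
    and V: "\<And>x. 0 \<le> x \<Longrightarrow> x < 1 \<Longrightarrow> C * (1 - x) powr 1 \<le> incr_var M Y 1 (x powr (1 / \<alpha>))"
  shows "ennreal (1 + C / R) \<le> pickands_const M \<alpha> Y R"
proof (cases "C = 0")
  case False
  then have C: "C > 0" using C by simp
  show ?thesis
  \<comment> \<open>\<open>walk_max_lower\<close> yields a grid for each value strictly below the
    target, so the bound is approached from below.\<close>
  proof (rule dense_le_bounded)
    show "0 < ennreal (1 + C / R)" using C R by (simp add: add_pos_pos)
    fix b assume b: "0 < b" "b < ennreal (1 + C / R)"
    then obtain B where B: "b = ennreal B" "B \<ge> 0" by (cases b rule: ennreal_cases) auto
    then have "B < 1 + C / R" using b by (simp add: ennreal_less_iff)
    then obtain \<delta> n where \<delta>: "\<delta> > 0" and "ennreal B \<le> (\<integral>\<^sup>+\<omega>. ennreal (walk_max (sqrt (2 * C * \<delta>)) ((C + R) * \<delta>) n \<omega>) \<partial>seq_normal)"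
      using walk_max_lower[OF C R] by blast
    note this(2)
    also have "(\<integral>\<^sup>+\<omega>. ennreal (walk_max (sqrt (2 * C * \<delta>)) ((C + R) * \<delta>) n \<omega>) \<partial>seq_normal)
       \<le> (\<integral>\<^sup>+ \<omega>. ennreal (grid_max \<delta> n (\<lambda>s. changed 1 R s \<omega>)) \<partial>M)"
      using grid_comparison_lower[OF zero_less_one \<delta> V walk_gaussian_vector walk_variogram[OF C \<delta>], where R=R]
      unfolding walk_exponent[OF C \<delta>] .
    also have "\<dots> \<le> pickands_const M \<alpha> Y R" by (rule grid_le_pickands_const[OF zero_less_one \<delta>])
    finally show "b \<le> pickands_const M \<alpha> Y R" using B by simp
  qed
qed (simp add: one_le_pickands_const)

lemma linear_exponent:
  assumes C: "C > 0" and \<delta>: "\<delta> > 0"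
  shows "Max ((\<lambda>k. exp (sqrt (2 * C) * \<delta> * real k * x - ((sqrt (2 * C) * \<delta>)\<^sup>2 * (real k * real k) / 2 + R * (\<delta> * real k) powr 2))) ` {..n})
     = grid_max \<delta> n (\<lambda>s. sqrt (2 * C) * x * s - (C + R) * s\<^sup>2)"
proof -
  have "sqrt (2 * C) * \<delta> * real k * x - ((sqrt (2 * C) * \<delta>)\<^sup>2 * (real k * real k) / 2 + R * (\<delta> * real k) powr 2)
    = sqrt (2 * C) * x * (\<delta> * real k) - (C + R) * (\<delta> * real k)\<^sup>2" for k
  proof -
    have "(sqrt (2 * C) * \<delta>)\<^sup>2 = 2 * C * \<delta>\<^sup>2" using C by (simp add: power_mult_distrib)
    then show ?thesis using \<delta> by (simp add: algebra_simps power2_eq_square)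
  qed
  then show ?thesis unfolding grid_max_def by (simp only:)
qed

lemma linear_variogram:
  assumes C: "C > 0" and \<delta>: "\<delta> > 0"
  shows "(sqrt (2 * C) * \<delta>)\<^sup>2 * (real k * real k) + (sqrt (2 * C) * \<delta>)\<^sup>2 * (real l * real l) - 2 * ((sqrt (2 * C) * \<delta>)\<^sup>2 * (real k * real l))
     = 2 * C * \<bar>\<delta> * real k - \<delta> * real l\<bar> powr 2"
proof -
  have "(sqrt (2 * C) * \<delta>)\<^sup>2 = 2 * C * \<delta>\<^sup>2" using C by (simp add: power_mult_distrib)
  then show ?thesis by (simp only:) (simp add: algebra_simps power2_eq_square)
qed

lemma pickands_const_upper_2:
  assumes R: "R > 0" and C: "C > 0" 
    and V: "\<And>x. 0 \<le> x \<Longrightarrow> x < 1 \<Longrightarrow> incr_var M Y 1 (x powr (2 / \<alpha>)) \<le> C * (1 - x) powr 2"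
  shows "pickands_const M \<alpha> Y R \<le> ennreal (1 / 2 * (1 + sqrt (1 + 1 / R * C)))"
proof (rule pickands_const_le[of 2])
  fix \<delta> :: real and n assume \<delta>: "\<delta> > 0"
  have "(\<integral>\<^sup>+ \<omega>. ennreal (grid_max \<delta> n (\<lambda>s. changed 2 R s \<omega>)) \<partial>M)
     \<le> (\<integral>\<^sup>+ x. ennreal (grid_max \<delta> n (\<lambda>s. sqrt (2 * C) * x * s - (C + R) * s\<^sup>2)) \<partial>std_normal_distribution)"
    using grid_comparison_upper[OF zero_less_numeral \<delta> V linear_gaussian_vector linear_variogram[OF C \<delta>], where R=R]
    unfolding linear_exponent[OF C \<delta>] .
  also have "\<dots> \<le> ennreal (1 / 2 * (1 + sqrt (1 + 1 / R * C)))"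
    using \<delta> by (intro linear_max_upper[OF C R]) auto
  finally show "(\<integral>\<^sup>+ \<omega>. ennreal (grid_max \<delta> n (\<lambda>s. changed 2 R s \<omega>)) \<partial>M) \<le> ennreal (1 / 2 * (1 + sqrt (1 + 1 / R * C)))" .
qed simp

lemma pickands_const_lower_2:
  assumes R: "R > 0" and C: "C > 0" 
    and V: "\<And>x. 0 \<le> x \<Longrightarrow> x < 1 \<Longrightarrow> C * (1 - x) powr 2 \<le> incr_var M Y 1 (x powr (2 / \<alpha>))"
  shows "ennreal (1 / 2 * (1 + sqrt (1 + 1 / R * C))) \<le> pickands_const M \<alpha> Y R"
proof (rule linear_max_lower[OF C R])
  fix \<delta> :: real and n assume \<delta>: "\<delta> > 0"
  have "(\<integral>\<^sup>+ x. ennreal (grid_max \<delta> n (\<lambda>s. sqrt (2 * C) * x * s - (C + R) * s\<^sup>2)) \<partial>std_normal_distribution)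
     \<le> (\<integral>\<^sup>+ \<omega>. ennreal (grid_max \<delta> n (\<lambda>s. changed 2 R s \<omega>)) \<partial>M)"
    using grid_comparison_lower[OF zero_less_numeral \<delta> V linear_gaussian_vector linear_variogram[OF C \<delta>], where R=R]
    unfolding linear_exponent[OF C \<delta>] .
  also have "\<dots> \<le> pickands_const M \<alpha> Y R" by (rule grid_le_pickands_const[OF zero_less_numeral \<delta>])
  finally show "(\<integral>\<^sup>+ x. ennreal (grid_max \<delta> n (\<lambda>s. sqrt (2 * C) * x * s - (C + R) * s\<^sup>2)) \<partial>std_normal_distribution) \<le> pickands_const M \<alpha> Y R" .
qed

end

theorem corollary3p3:
  fixes M :: "'a measure" and Y :: "real \<Rightarrow> 'a \<Rightarrow> real" and \<alpha> \<kappa> c R :: real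
  assumes "prob_space M"
    and "\<alpha> > 0" and "0 < \<kappa>" and "\<kappa> \<le> 2" and "c > 0"
    and "class_S M \<alpha> \<kappa> c Y"
    and "R > 0"
  shows "(\<kappa> = 1 \<longrightarrow>
            ennreal (1 + 1 / R * (INF x\<in>{0..<1}. incr_var M Y 1 (x powr (1 / \<alpha>)) / \<bar>1 - x\<bar>))
              \<le> pickands_const M \<alpha> Y R \<and>
            pickands_const M \<alpha> Y R
              \<le> ennreal (1 + 1 / R * (SUP x\<in>{0..<1}. incr_var M Y 1 (x powr (1 / \<alpha>)) / \<bar>1 - x\<bar>))) \<and>
         (\<kappa> = 2 \<longrightarrow>
            ennreal (1 / 2 * (1 + sqrt (1 + 1 / R))) \<le> pickands_const M \<alpha> Y R \<and>
            pickands_const M \<alpha> Y R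
              \<le> ennreal (1 / 2 * (1 + sqrt (1 + 1 / R *
                  (SUP x\<in>{0..<1}. incr_var M Y 1 (x powr (2 / \<alpha>)) / \<bar>1 - x\<bar>\<^sup>2)))))"
proof -
  interpret self_similar_gaussian M Y \<alpha>
    using assms by (intro class_S_imp_self_similar_gaussian)
  have S2: "(\<lambda>h. incr_var M Y 1 (1 - h) - c * \<bar>h\<bar> powr \<kappa>) \<in> o[at 0](\<lambda>h. \<bar>h\<bar> powr \<kappa>)"
    using assms by (simp add: class_S_def)
  note bdd = incr_var_ratio_bdd_above[OF \<open>0 < \<kappa>\<close> \<open>c > 0\<close> S2]
  show ?thesis
  proof (intro conjI impI)
    assume \<kappa>: "\<kappa> = 1"
    define C where "C = (SUP x\<in>{0..<1}. incr_var M Y 1 (x powr (1 / \<alpha>)) / (1 - x) powr 1)"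
    define D where "D = (INF x\<in>{0..<1}. incr_var M Y 1 (x powr (1 / \<alpha>)) / \<bar>1 - x\<bar>)"
    note C = incr_var_le_SUP_ratio[OF zero_less_one bdd[unfolded \<kappa>], folded C_def]
    have "C = (SUP x\<in>{0..<1}. incr_var M Y 1 (x powr (1 / \<alpha>)) / \<bar>1 - x\<bar>)"
      unfolding C_def by (intro SUP_cong) auto
    then show "pickands_const M \<alpha> Y R \<le> ennreal (1 + 1 / R * (SUP x\<in>{0..<1}. incr_var M Y 1 (x powr (1 / \<alpha>)) / \<bar>1 - x\<bar>))"
      using pickands_const_upper_1[OF \<open>R > 0\<close> _ C(2)] C(1) by simp
    have nn: "0 \<le> incr_var M Y 1 (x powr (1 / \<alpha>)) / \<bar>1 - x\<bar>" for x by (simp add: incr_var_nonneg)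
    have D0: "0 \<le> D" unfolding D_def by (rule cINF_greatest, simp, rule nn)
    have "D \<le> incr_var M Y 1 (x powr (1 / \<alpha>)) / \<bar>1 - x\<bar>" if "0 \<le> x" "x < 1" for x
      unfolding D_def by (intro cINF_lower bdd_belowI2[where m=0] nn) (use that in auto)
    then have "D * (1 - x) powr 1 \<le> incr_var M Y 1 (x powr (1 / \<alpha>))" if "0 \<le> x" "x < 1" for x
      using that by (force simp: field_simps)
    from pickands_const_lower_1[OF \<open>R > 0\<close> D0 this]
    show "ennreal (1 + 1 / R * (INF x\<in>{0..<1}. incr_var M Y 1 (x powr (1 / \<alpha>)) / \<bar>1 - x\<bar>)) \<le> pickands_const M \<alpha> Y R"
      unfolding D_def by simp
  next
    assume \<kappa>: "\<kappa> = 2"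
    define C where "C = (SUP x\<in>{0..<1}. incr_var M Y 1 (x powr (2 / \<alpha>)) / (1 - x) powr 2)"
    note C = incr_var_le_SUP_ratio[OF zero_less_numeral bdd[unfolded \<kappa>], folded C_def]
    have "C = (SUP x\<in>{0..<1}. incr_var M Y 1 (x powr (2 / \<alpha>)) / \<bar>1 - x\<bar>\<^sup>2)"
      unfolding C_def by (intro SUP_cong) auto
    then show "pickands_const M \<alpha> Y R \<le> ennreal (1 / 2 * (1 + sqrt (1 + 1 / R * (SUP x\<in>{0..<1}. incr_var M Y 1 (x powr (2 / \<alpha>)) / \<bar>1 - x\<bar>\<^sup>2))))"
      using pickands_const_upper_2[OF \<open>R > 0\<close> _ C(2)] C(1) by simp
    show "ennreal (1 / 2 * (1 + sqrt (1 + 1 / R))) \<le> pickands_const M \<alpha> Y R"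
      using pickands_const_lower_2[OF \<open>R > 0\<close> zero_less_one incr_var_ge_square] by simp
  qed
qed

end
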